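(* Let $J:\mathbb{R}\to[0,\infty)$ be smooth, radially symmetric (even), with $\int_{\mathbb{R}}J=1$, nonincreasing in $\mathbb{R}_+$ and supported in the ball $(-d,d)$, $d>0$. Let $u_0\in L^1(\mathbb{R}_+,(1+x+x^2)\,dx)\cap L^\infty(\mathbb{R}_+)$, extended by $u_0(x)=0$ for $x<0$, and let $u$ be the solution to $$u_t=J*u-u\ \ (x\ge0,\ t>0),\qquad u(x,t)=0\ \ (x<0,\ t>0),\qquad u(x,0)=u_0(x)\ \ (x\in\mathbb{R}).$$ Let $\mathfrak q=\frac12\int_{\mathbb{R}}J(z)z^2\,dz$, let $\phi$ be the unique solution to the stationary problem $$J*\phi=\phi\ \text{ for }x\ge0,\qquad \phi=0\ \text{ for }-d<x<0,\qquad (\phi(x)-x)\in L^\infty(\mathbb{R}_+),$$ and let $M_1^*=\int_0^\infty u_0(x)\phi(x)\,dx$. Then $$\frac{t^{3/2}}{x+1}\Big|u(x,t)+2M_1^*\frac{\phi(x)}{x}D_{\mathfrak q}(x,t)\Big|\to0\quad\text{as }t\to\infty,\ \text{uniformly in }x\in[0,\infty).$$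
   Context: $\mathbb{R}_+=(0,\infty)$; convolution is in the space variable $x$. "Supported in $(-d,d)$" means $J(z)=0$ for $|z|\ge d$. $\Gamma(x,t)=(4\pi t)^{-1/2}e^{-x^2/(4t)}$, $D(x,t)=\Gamma_x(x,t)$ and $D_{\mathfrak q}(x,t)=D(x,\mathfrak q t)=-\frac{x}{2\mathfrak q t}\Gamma(x,\mathfrak q t)$; thus $\frac{\phi(x)}{x}D_{\mathfrak q}(x,t)=-\frac{\phi(x)}{2\mathfrak q t}\Gamma(x,\mathfrak q t)$, which also gives its meaning at $x=0$. The function $\phi$ is defined on $(-d,\infty)$, and $J*\phi(x)=\int J(x-y)\phi(y)\,dy$ for $x\ge0$ only involves values of $\phi$ on $(-d,\infty)$. The solution $u$ is the unique solution in $C([0,\infty);L^1(\mathbb{R}_+,(1+x)\,dx))$; uniformity in $x$ is understood up to null sets. *)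

theory Defs
  imports "HOL-Analysis.Analysis"
begin

definition smooth_real :: "(real \<Rightarrow> real) \<Rightarrow> bool" where
  "smooth_real f \<longleftrightarrow> (\<forall>n x. ((deriv ^^ n) f) differentiable (at x))"

definition dispersal_kernel :: "real \<Rightarrow> (real \<Rightarrow> real) \<Rightarrow> bool" where
  "dispersal_kernel d J \<longleftrightarrow>
     d > 0 \<and> smooth_real J \<and> (\<forall>z. J z \<ge> 0) \<and> (\<forall>z. J (- z) = J z) \<and>
     (LINT z|lebesgue. J z) = 1 \<and>
     antimono_on {0<..} J \<and>
     (\<forall>z. \<bar>z\<bar> \<ge> d \<longrightarrow> J z = 0)"

definition conv :: "(real \<Rightarrow> real) \<Rightarrow> (real \<Rightarrow> real) \<Rightarrow> real \<Rightarrow> real" where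
  "conv f g x = (LINT y|lebesgue. f (x - y) * g y)"

text \<open>Membership in \<open>L\<^sup>1(A, w(x) dx)\<close> for a weight \<open>w\<close> which is positive and measurable
  on \<open>A\<close>, and the corresponding norm. Elements are represented by functions, so that all
  statements about them are up to null sets. The values outside \<open>A\<close> play no role.\<close>

definition in_weighted_L1 :: "(real \<Rightarrow> real) \<Rightarrow> real set \<Rightarrow> (real \<Rightarrow> real) \<Rightarrow> bool" where
  "in_weighted_L1 w A f \<longleftrightarrow> set_integrable lebesgue A (\<lambda>x. w x * f x)"

definition weighted_L1_norm :: "(real \<Rightarrow> real) \<Rightarrow> real set \<Rightarrow> (real \<Rightarrow> real) \<Rightarrow> real" where
  "weighted_L1_norm w A f = (LINT x:A|lebesgue. w x * \<bar>f x\<bar>)"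

definition in_Linf :: "real set \<Rightarrow> (real \<Rightarrow> real) \<Rightarrow> bool" where
  "in_Linf A f \<longleftrightarrow> set_borel_measurable lebesgue A f \<and>
     (\<exists>C. AE x in lebesgue. x \<in> A \<longrightarrow> \<bar>f x\<bar> \<le> C)"

text \<open>\<open>u\<close> is a solution of \<open>u\<^sub>t = J * u - u\<close> on the half-line, with zero exterior condition
  and initial datum \<open>u0\<close>, in \<open>C([0,\<infinity>); L\<^sup>1(\<real>\<^sub>+, (1+x) dx))\<close>. The derivative
  \<open>u\<^sub>t\<close> (for \<open>t > 0\<close>) is that of the curve \<open>t \<mapsto> u(\<cdot>,t)\<close> with values in this space.\<close>

definition half_line_solution ::
  "(real \<Rightarrow> real) \<Rightarrow> (real \<Rightarrow> real) \<Rightarrow> (real \<Rightarrow> real \<Rightarrow> real) \<Rightarrow> bool" where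
  "half_line_solution J u0 u \<longleftrightarrow>
     (\<forall>t\<ge>0. in_weighted_L1 (\<lambda>x. 1 + x) {0<..} (\<lambda>x. u x t)) \<and>
     (\<forall>t\<ge>0. ((\<lambda>s. weighted_L1_norm (\<lambda>x. 1 + x) {0<..} (\<lambda>x. u x s - u x t)) \<longlongrightarrow> 0)
        (at t within {0..})) \<and>
     (\<forall>t>0. ((\<lambda>h. weighted_L1_norm (\<lambda>x. 1 + x) {0<..}
          (\<lambda>x. (u x (t + h) - u x t) / h - (conv J (\<lambda>y. u y t) x - u x t))) \<longlongrightarrow> 0) (at 0)) \<and>
     (\<forall>t>0. AE x in lebesgue. x < 0 \<longrightarrow> u x t = 0) \<and>
     (AE x in lebesgue. u x 0 = u0 x)"

text \<open>Since \<open>J\<close> vanishes outside \<open>(-d,d)\<close>, for \<open>x \<ge> 0\<close> the integral in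
  \<^term>\<open>conv J \<phi> x\<close> only involves the values of \<open>\<phi>\<close> on \<open>(-d,\<infinity>)\<close>; the values of
  \<open>\<phi>\<close> on \<open>(-\<infinity>,-d]\<close> are immaterial.\<close>

definition stationary_solution :: "real \<Rightarrow> (real \<Rightarrow> real) \<Rightarrow> (real \<Rightarrow> real) \<Rightarrow> bool" where
  "stationary_solution d J \<phi> \<longleftrightarrow>
     (\<forall>x\<ge>0. conv J \<phi> x = \<phi> x) \<and>
     (\<forall>x. - d < x \<and> x < 0 \<longrightarrow> \<phi> x = 0) \<and>
     in_Linf {0<..} (\<lambda>x. \<phi> x - x)"

definition diffusivity :: "(real \<Rightarrow> real) \<Rightarrow> real" where
  "diffusivity J = (1 / 2) * (LINT z|lebesgue. J z * z\<^sup>2)"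

definition modified_moment :: "(real \<Rightarrow> real) \<Rightarrow> (real \<Rightarrow> real) \<Rightarrow> real" where
  "modified_moment u0 \<phi> = (LINT x:{0<..}|lebesgue. u0 x * \<phi> x)"

definition heat_kernel :: "real \<Rightarrow> real \<Rightarrow> real" where
  "heat_kernel x t = (4 * pi * t) powr (- (1 / 2)) * exp (- (x\<^sup>2 / (4 * t)))"

definition dipole :: "real \<Rightarrow> real \<Rightarrow> real" where
  "dipole x t = deriv (\<lambda>y. heat_kernel y t) x"

text \<open>The function \<open>(\<phi>(x)/x) D\<^sub>q(x,t)\<close> where \<open>D\<^sub>q(x,t) = D(x,qt)\<close>. As
  \<open>D\<^sub>q(x,t) = -(x/(2qt)) \<Gamma>(x,qt)\<close>, its meaning at \<open>x = 0\<close> is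
  \<open>-(\<phi>(0)/(2qt)) \<Gamma>(0,qt)\<close>.\<close>

definition dipole_profile :: "real \<Rightarrow> (real \<Rightarrow> real) \<Rightarrow> real \<Rightarrow> real \<Rightarrow> real" where
  "dipole_profile q \<phi> x t =
     (if x = 0 then - (\<phi> 0 / (2 * q * t)) * heat_kernel 0 (q * t)
      else \<phi> x / x * dipole x (q * t))"

end

theory Submission
  imports Defs "HOL-Probability.Probability" "HOL-Real_Asymp.Real_Asymp"
begin

text \<open>With \<open>K f = (J * f) 1\<^bsub>[0,\<infinity>)\<^esub>\<close> the solution is \<open>e\<^bsup>-t\<^esup> \<Sum> t\<^sup>n/n! K\<^sup>n u\<^sub>0\<close>.
  For nonnegative data the powers of \<open>K\<close> lie between those of the whole-line convolution acting on
  odd reflections about \<open>0\<close> and about \<open>-d\<close>. These are explicit sine integrals, so a Fourier comparison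
  with the heat kernel gives \<open>|u(x,t)| \<le> C t\<^bsup>-3/2\<^esup>(x + d)\<close> up to an exponentially small term, and,
  restarting at a large time \<open>\<tau>\<close>, the dipole asymptotics for large \<open>x\<close>: the two bounds differ by
  a multiple of \<open>d \<parallel>u(\<tau>)\<parallel>\<^sub>1\<close>, which tends to \<open>0\<close>, while the first moment of \<open>u(\<tau>)\<close> tends to the conserved
  quantity \<open>M\<^sub>1\<^sup>*\<close>. For bounded \<open>x\<close>, \<open>u\<^sub>t\<close> is of smaller order because \<open>K\<close> is a contraction for the
  weight \<open>x + d\<close> and consecutive Poisson weights nearly cancel; hence \<open>t\<^bsup>3/2\<^esup> u\<close> is nearly stationary
  and an elliptic maximum principle compares it with a multiple of \<open>\<phi>\<close>.\<close>

subsection \<open>Cosine transform of the kernel\<close>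

text \<open>The symbol of the whole-line evolution tends to \<open>exp (- t)\<close> at high
  frequency and is not integrable. The identity term of the exponential series is therefore split
  off throughout; it is the exponentially small term above. Monotonicity of \<open>J\<close> enters
  as J(x - y) >= J(x + y) for x, y >= 0, which makes the odd kernel positive and the comparison
  monotone. The obstacle is the boundary. The two odd barriers also differ by about \<open>d\<close>
  times the first moment times t^(-3/2), which is negligible against x + 1 only for large x, and
  restarting does not help because the first moment need not decay. Hence a splitting point
  \<open>X\<close> is fixed before the restarting time and before t, and [0, X] is treated
  separately, with the far field as boundary data on the collar (X, X + d], whose width is the reach
  of the kernel. Second moments enter only the error at a fixed restarting time, so their possible
  growth in that time is harmless. The semigroup law is not extracted from the series; it is a
  by-product of uniqueness, which is needed anyway to identify the given solution.\<close>

lemma lborel_product_integrable_bound: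
  fixes f :: "real \<Rightarrow> real \<Rightarrow> real"
  assumes [measurable]: "case_prod f \<in> borel_measurable (borel \<Otimes>\<^sub>M borel)"
    and a: "integrable lborel a" and b: "integrable lborel b"
    and bnd: "\<And>x y. \<bar>f x y\<bar> \<le> a x * b y"
  shows "integrable (lborel \<Otimes>\<^sub>M lborel) (case_prod f)"
proof -
  have [measurable]: "a \<in> borel_measurable borel" "b \<in> borel_measurable borel"
    using borel_measurable_integrable[OF a] borel_measurable_integrable[OF b] by simp_all
  have fi: "integrable lborel (\<lambda>y. f x y)" for x
    by (rule Bochner_Integration.integrable_bound[OF integrable_mult_right[OF b, of "a x"]])
       (use bnd[of x] in \<open>auto intro!: AE_I2 order_trans[OF bnd]\<close>)
  show ?thesis
  proof (rule lborel_pair.Fubini_integrable)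
    show "case_prod f \<in> borel_measurable (lborel \<Otimes>\<^sub>M lborel)" by measurable
    show "AE x in lborel. integrable lborel (\<lambda>y. case (x, y) of (x, y) \<Rightarrow> f x y)"
      using fi by simp
    show "integrable lborel (\<lambda>x. LINT y|lborel. norm (case (x, y) of (x, y) \<Rightarrow> f x y))"
    proof (rule Bochner_Integration.integrable_bound[OF integrable_mult_left[OF a, of "LINT y|lborel. b y"]])
      show "(\<lambda>x. LINT y|lborel. norm (case (x, y) of (x, y) \<Rightarrow> f x y)) \<in> borel_measurable lborel"
        by measurable
      show "AE x in lborel. norm (LINT y|lborel. norm (case (x, y) of (x, y) \<Rightarrow> f x y))
           \<le> norm (a x * (LINT y|lborel. b y))"
      proof (rule AE_I2)
        fix x
        have "(LINT y|lborel. \<bar>f x y\<bar>) \<le> (LINT y|lborel. a x * b y)"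
          by (intro integral_mono integrable_abs fi integrable_mult_right b bnd)
        then show "norm (LINT y|lborel. norm (case (x, y) of (x, y) \<Rightarrow> f x y))
           \<le> norm (a x * (LINT y|lborel. b y))" by simp
      qed
    qed
  qed
qed

text \<open>Serves the exchanges of space and frequency integrals in \<open>J_damped\<close> and
  \<open>K_odd_pow\<close>, where the integrand is dominated by a function of space times a function
  of frequency.\<close>

lemma lborel_Fubini_bound:
  fixes f :: "real \<Rightarrow> real \<Rightarrow> real"
  assumes "case_prod f \<in> borel_measurable (borel \<Otimes>\<^sub>M borel)"
    and "integrable lborel a" and "integrable lborel b"
    and "\<And>x y. \<bar>f x y\<bar> \<le> a x * b y"
  shows "(LINT y|lborel. LINT x|lborel. f x y) = (LINT x|lborel. LINT y|lborel. f x y)"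
  by (intro lborel_pair.Fubini_integral lborel_product_integrable_bound[OF assms])

lemma integrable_compact_support:
  fixes f :: "real \<Rightarrow> real"
  assumes "continuous_on UNIV f" "\<And>z. \<bar>z\<bar> > r \<Longrightarrow> f z = 0"
  shows "integrable lborel f"
proof -
  have "integrable lborel (\<lambda>x. indicator {-r..r} x *\<^sub>R f x)"
    by (rule borel_integrable_compact) (auto intro: continuous_on_subset assms)
  also have "(\<lambda>x. indicator {-r..r} x *\<^sub>R f x) = f"
  proof
    fix x show "indicator {-r..r} x *\<^sub>R f x = f x"
      using assms(2)[of x] by (cases "\<bar>x\<bar> > r") (auto simp: indicator_def)
  qed
  finally show ?thesis .
qed

lemma lborel_integral_shift:
  fixes f :: "real \<Rightarrow> real"
  shows "(LINT x|lborel. f (x + c)) = (LINT x|lborel. f x)"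
  using lborel_integral_real_affine[of 1 f c] by (simp add: add.commute)

lemma lborel_integral_reflect:
  fixes f :: "real \<Rightarrow> real"
  shows "(LINT x|lborel. f (c - x)) = (LINT x|lborel. f x)"
  using lborel_integral_real_affine[of "-1" f c] by simp

lemma lborel_integrable_shift:
  fixes f :: "real \<Rightarrow> real"
  shows "integrable lborel f \<Longrightarrow> integrable lborel (\<lambda>x. f (x + c))"
  using lborel_integrable_real_affine[of f 1 c] by (simp add: add.commute)

lemma lborel_integrable_reflect:
  fixes f :: "real \<Rightarrow> real"
  shows "integrable lborel f \<Longrightarrow> integrable lborel (\<lambda>x. f (c - x))"
  using lborel_integrable_real_affine[of f "-1" c] by simp

locale kernel =
  fixes J :: "real \<Rightarrow> real" and d :: real
  assumes dispersal: "dispersal_kernel d J"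
begin

lemma d_pos: "d > 0" and J_nonneg: "J z \<ge> 0" and J_even: "J (- z) = J z"
  and J_supp: "\<bar>z\<bar> \<ge> d \<Longrightarrow> J z = 0" and J_smooth: "((deriv ^^ n) J) differentiable (at z)"
  using dispersal by (auto simp: dispersal_kernel_def smooth_real_def)

abbreviation Jd :: "nat \<Rightarrow> real \<Rightarrow> real" where "Jd n \<equiv> (deriv ^^ n) J"

lemma Jd_deriv: "(Jd n has_real_derivative Jd (Suc n) z) (at z)"
  using J_smooth[of n z] by (simp add: DERIV_deriv_iff_real_differentiable)

lemma Jd_cont: "continuous_on UNIV (Jd n)"
  using Jd_deriv by (meson DERIV_isCont continuous_at_imp_continuous_on)

lemma J_cont: "continuous_on UNIV J" using Jd_cont[of 0] by simp

lemma J_meas [measurable]: "J \<in> borel_measurable borel"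
  by (rule borel_measurable_continuous_onI[OF J_cont])

text \<open>The inequality is strict so that the region is open: \<open>Jd n\<close> vanishes on a
  neighbourhood of \<open>z\<close>, which forces its derivative at \<open>z\<close> to vanish as
  well.\<close>

lemma Jd_supp: "\<bar>z\<bar> > d \<Longrightarrow> Jd n z = 0"
proof (induction n arbitrary: z)
  case 0 then show ?case using J_supp[of z] by simp
next
  case (Suc n)
  have op: "open {z::real. \<bar>z\<bar> > d}" by (intro open_Collect_less continuous_intros)
  have "((\<lambda>z. 0) has_real_derivative Jd (Suc n) z) (at z)"
    by (rule DERIV_cong_ev[THEN iffD1, OF refl _ refl Jd_deriv[of n z]])
       (use Suc op in \<open>auto simp: eventually_nhds\<close>)
  then show ?case using DERIV_unique DERIV_const by blast
qed

lemma Jd_int: "integrable lborel (Jd n)"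
  by (rule integrable_compact_support[OF Jd_cont Jd_supp])

lemma J_int: "integrable lborel J" using Jd_int[of 0] by simp

lemma J_int1: "(LINT z|lborel. J z) = 1"
  using dispersal by (simp add: dispersal_kernel_def integral_completion)

text \<open>Monotonicity is assumed on the open half line only; the value at 0 is reached by
  continuity and negative arguments by evenness. In this form it compares J(x - y) with J(x + y) in
  \<open>K_odd_pow_le\<close>.\<close>

lemma J_antimono_abs:
  assumes "\<bar>x\<bar> \<le> \<bar>y\<bar>" shows "J y \<le> J x"
proof -
  have abs: "J z = J \<bar>z\<bar>" for z using J_even[of z] by (cases "z \<ge> 0") auto
  have am: "antimono_on {0<..} J" using dispersal by (simp add: dispersal_kernel_def)
  consider "\<bar>x\<bar> > 0" | "x = 0" "y = 0" | "x = 0" "\<bar>y\<bar> > 0" by fastforce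
  then have "J \<bar>y\<bar> \<le> J \<bar>x\<bar>"
  proof cases
    case 1 then show ?thesis using am assms by (auto simp: monotone_on_def)
  next
    case 3
    have "(J \<longlongrightarrow> J 0) (at_right 0)"
      using J_cont by (simp add: continuous_on_eq_continuous_at isCont_def filterlim_at_split)
    moreover have "eventually (\<lambda>z. J \<bar>y\<bar> \<le> J z) (at_right 0)"
      using eventually_at_right_real[OF 3(2)]
      by eventually_elim (use am 3 in \<open>auto simp: monotone_on_def\<close>)
    ultimately have "J \<bar>y\<bar> \<le> J 0" by (intro tendsto_lowerbound) auto
    then show ?thesis using 3 by simp
  qed auto
  then show ?thesis using abs[of x] abs[of y] by simp
qed

text \<open>The Fourier transform of \<open>J\<close>, which is real because \<open>J\<close> is
  even.\<close>

definition Jh :: "real \<Rightarrow> real" where "Jh \<xi> = (LINT z|lborel. J z * cos (\<xi> * z))"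

lemma J_bounded_mult_int:
  assumes [measurable]: "g \<in> borel_measurable borel" and "\<And>z. \<bar>z\<bar> < d \<Longrightarrow> \<bar>g z\<bar> \<le> C"
  shows "integrable lborel (\<lambda>z. J z * g z)"
proof (rule Bochner_Integration.integrable_bound[OF integrable_mult_right[OF J_int, of C]])
  show "AE z in lborel. norm (J z * g z) \<le> norm (C * J z)"
  proof (rule AE_I2)
    fix z show "norm (J z * g z) \<le> norm (C * J z)"
      using assms(2)[of z] J_supp[of z] J_nonneg[of z] mult_left_mono[of "\<bar>g z\<bar>" C "J z"]
      by (cases "\<bar>z\<bar> < d") (auto simp: abs_mult mult.commute)
  qed
qed measurable

lemma J_pow_int: "integrable lborel (\<lambda>z. J z * z ^ n)"
  by (rule J_bounded_mult_int[where C="d ^ n"])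
     (auto simp: power_abs intro!: power_mono)

lemma J_cos_int: "integrable lborel (\<lambda>z. J z * cos (\<xi> * z))"
  by (rule J_bounded_mult_int[where C=1]) auto
lemma J_sin_int: "integrable lborel (\<lambda>z. J z * sin (\<xi> * z))"
  by (rule J_bounded_mult_int[where C=1]) auto

lemma Jh_meas [measurable]: "Jh \<in> borel_measurable borel"
  unfolding Jh_def by measurable

lemma J_sin_zero: "(LINT z|lborel. J z * sin (\<xi> * z)) = 0"
  using lborel_integral_reflect[of "\<lambda>z. J z * sin (\<xi> * z)" 0] by (simp add: J_even)

text \<open>Sines are eigenfunctions of convolution with an even kernel: in the addition formula the
  term with \<open>cos (\<xi> * x)\<close> carries the integral of an odd function.\<close>

lemma J_shift_sin: "(LINT y|lborel. J (x - y) * sin (\<xi> * y)) = Jh \<xi> * sin (\<xi> * x)"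
proof -
  have "(LINT y|lborel. J (x - y) * sin (\<xi> * y)) = (LINT z|lborel. J z * sin (\<xi> * (x - z)))"
    using lborel_integral_reflect[of "\<lambda>y. J (x - y) * sin (\<xi> * y)" x] by simp
  also have "\<dots> = (LINT z|lborel. sin (\<xi> * x) * (J z * cos (\<xi> * z)) - cos (\<xi> * x) * (J z * sin (\<xi> * z)))"
    by (simp add: right_diff_distrib sin_diff algebra_simps)
  also have "\<dots> = sin (\<xi> * x) * Jh \<xi> - cos (\<xi> * x) * 0"
    by (simp add: J_cos_int J_sin_int J_sin_zero Jh_def)
  finally show ?thesis by simp
qed

lemma J_shift_cos: "(LINT y|lborel. J y * cos (\<xi> * (x - y))) = Jh \<xi> * cos (\<xi> * x)"
proof -
  have "(LINT y|lborel. J y * cos (\<xi> * (x - y))) = (LINT z|lborel. cos (\<xi> * x) * (J z * cos (\<xi> * z)) + sin (\<xi> * x) * (J z * sin (\<xi> * z)))"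
    by (simp add: right_diff_distrib cos_diff algebra_simps)
  also have "\<dots> = cos (\<xi> * x) * Jh \<xi> + sin (\<xi> * x) * 0"
    by (simp add: J_cos_int J_sin_int J_sin_zero Jh_def)
  finally show ?thesis by simp
qed

lemma Jh_le1: "\<bar>Jh \<xi>\<bar> \<le> 1"
proof -
  have "\<bar>Jh \<xi>\<bar> \<le> (LINT z|lborel. \<bar>J z * cos (\<xi> * z)\<bar>)" unfolding Jh_def by simp
  also have "\<dots> \<le> (LINT z|lborel. J z)"
    by (intro integral_mono integrable_abs J_cos_int J_int)
       (use J_nonneg in \<open>auto simp: abs_mult mult_left_le\<close>)
  finally show ?thesis by (simp add: J_int1)
qed

lemma Jd_cos_int: "integrable lborel (\<lambda>z. Jd n z * cos (\<xi> * z))"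
  by (rule integrable_compact_support[of _ d]) (auto intro!: continuous_intros Jd_cont simp del: funpow.simps simp: Jd_supp)

text \<open>Two integrations by parts at once; the boundary terms vanish outside the
  support.\<close>

lemma Jd_cos: "\<xi>\<^sup>2 * (LINT z|lborel. Jd n z * cos (\<xi> * z)) = - (LINT z|lborel. Jd (n+2) z * cos (\<xi> * z))"
proof -
  define R where "R = d + 1"
  let ?f = "\<lambda>z. Jd (n+2) z * cos (\<xi> * z) + \<xi>\<^sup>2 * (Jd n z * cos (\<xi> * z))"
  \<comment> \<open>\<open>?F\<close> is a primitive of \<open>?f\<close>: the two terms with
    \<open>Jd (Suc n) z * sin (\<xi> * z)\<close> cancel on differentiation.\<close>
  let ?F = "\<lambda>z. Jd (Suc n) z * cos (\<xi> * z) + \<xi> * Jd n z * sin (\<xi> * z)"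
  have "(LINT z|lborel. ?f z * indicator {-R..R} z) = ?F R - ?F (-R)"
  proof (rule integral_FTC_Icc_real)
    show "- R \<le> R" using d_pos by (simp add: R_def)
    fix z
    show "DERIV ?F z :> ?f z"
      using Jd_deriv[of n z] Jd_deriv[of "Suc n" z]
      by (auto intro!: derivative_eq_intros simp del: funpow.simps simp: algebra_simps power2_eq_square)
    have "continuous_on UNIV ?f" by (intro continuous_intros Jd_cont)
    then show "isCont ?f z" by (simp add: continuous_on_eq_continuous_at del: funpow.simps)
  qed
  also have "\<dots> = 0" using Jd_supp[of R] Jd_supp[of "-R"] d_pos by (simp add: R_def del: funpow.simps)
  also have "(\<lambda>z. ?f z * indicator {-R..R} z) = ?f"
  proof
    fix z show "?f z * indicator {-R..R} z = ?f z"
      using Jd_supp[of z] by (cases "\<bar>z\<bar> > d") (auto simp: R_def indicator_def simp del: funpow.simps)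
  qed
  also have "integral\<^sup>L lborel ?f = (LINT z|lborel. Jd (n+2) z * cos (\<xi> * z)) + \<xi>\<^sup>2 * (LINT z|lborel. Jd n z * cos (\<xi> * z))"
    by (subst Bochner_Integration.integral_add) (auto intro!: Jd_cos_int integrable_mult_right simp del: funpow.simps)
  finally show ?thesis by simp
qed

text \<open>Four derivatives are used because \<open>Jh\<close> has to remain integrable after
  multiplication by \<open>\<xi>\<^sup>2\<close>, the factor that two vanishing sines will produce;
  two derivatives would only give boundedness of that product.\<close>

lemma Jh_decay: "\<exists>A\<ge>0. \<forall>\<xi>. \<xi>^4 * \<bar>Jh \<xi>\<bar> \<le> A"
proof (intro exI[of _ "LINT z|lborel. \<bar>Jd 4 z\<bar>"] conjI allI)
  fix \<xi>
  have "\<xi>^4 * Jh \<xi> = \<xi>\<^sup>2 * (\<xi>\<^sup>2 * (LINT z|lborel. Jd 0 z * cos (\<xi> * z)))"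
    by (simp add: Jh_def power_numeral_reduce)
  also have "\<dots> = (LINT z|lborel. Jd 4 z * cos (\<xi> * z))"
    using Jd_cos[of \<xi> 0, unfolded add_0] Jd_cos[of \<xi> 2] by (simp del: funpow.simps)
  finally have e: "\<xi>^4 * Jh \<xi> = (LINT z|lborel. Jd 4 z * cos (\<xi> * z))" .
  have "\<xi>^4 * \<bar>Jh \<xi>\<bar> = \<bar>\<xi>^4 * Jh \<xi>\<bar>" by (simp add: abs_mult)
  also have "\<dots> = \<bar>LINT z|lborel. Jd 4 z * cos (\<xi> * z)\<bar>" by (simp only: e)
  also have "\<dots> \<le> (LINT z|lborel. \<bar>Jd 4 z * cos (\<xi> * z)\<bar>)" by (rule integral_abs_bound)
  also have "\<dots> \<le> (LINT z|lborel. \<bar>Jd 4 z\<bar>)"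
    by (intro integral_mono integrable_abs Jd_cos_int Jd_int) (auto simp: abs_mult mult_left_le)
  finally show "\<xi>^4 * \<bar>Jh \<xi>\<bar> \<le> (LINT z|lborel. \<bar>Jd 4 z\<bar>)" .
qed simp

end

section \<open>Taylor bounds for sine and cosine, Gaussian integrals\<close>

lemma abs_sin_minus_le: "\<bar>sin b - b\<bar> \<le> b\<^sup>2" for b :: real
proof -
  have "\<bar>sin b - (\<Sum>m<2. sin_coeff m * b ^ m)\<bar> \<le> inverse (fact 2) * \<bar>b\<bar>\<^sup>2" by (rule Maclaurin_sin_bound)
  then have "\<bar>sin b - b\<bar> \<le> b\<^sup>2 / 2" by (simp add: sin_coeff_def numeral_2_eq_2)
  also have "\<dots> \<le> b\<^sup>2" by simp
  finally show ?thesis .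
qed

lemma abs_cos_minus1_le: "\<bar>cos b - 1\<bar> \<le> b\<^sup>2 / 2" for b :: real
proof -
  obtain t where "cos b = (\<Sum>m<2. cos_coeff m * b ^ m) + (cos (t + 1/2 * real 2 * pi) / fact 2) * b\<^sup>2"
    using Maclaurin_cos_expansion[of b 2] by blast
  then have "\<bar>cos b - 1\<bar> = \<bar>cos (t + 1/2 * real 2 * pi)\<bar> * b\<^sup>2 / 2"
    by (simp add: cos_coeff_def numeral_2_eq_2 abs_mult)
  also have "\<dots> \<le> 1 * b\<^sup>2 / 2" by (intro divide_right_mono mult_right_mono) auto
  finally show ?thesis by simp
qed

lemma abs_cos_taylor_le: "\<bar>cos b - 1 + b\<^sup>2 / 2\<bar> \<le> b ^ 4" for b :: real
proof -
  obtain t where "cos b = (\<Sum>m<4. cos_coeff m * b ^ m) + (cos (t + 1/2 * real 4 * pi) / fact 4) * b ^ 4"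
    using Maclaurin_cos_expansion[of b 4] by blast
  moreover have "{..<4::nat} = {0, 1, 2, 3}" by auto
  ultimately have "\<bar>cos b - 1 + b\<^sup>2 / 2\<bar> = \<bar>cos (t + 1/2 * real 4 * pi)\<bar> * b ^ 4 / 24"
    by (simp add: cos_coeff_def abs_mult fact_numeral)
  also have "\<dots> \<le> 1 * b ^ 4 / 24" by (intro divide_right_mono mult_right_mono) auto
  also have "\<dots> \<le> b ^ 4" by simp
  finally show ?thesis .
qed

lemma abs_cos_add_le: "\<bar>cos (a + b) - cos a + b * sin a\<bar> \<le> 2 * b\<^sup>2" for a b :: real
proof -
  have "cos (a + b) - cos a + b * sin a = cos a * (cos b - 1) - sin a * (sin b - b)"
    by (simp add: cos_add algebra_simps)
  also have "\<bar>\<dots>\<bar> \<le> \<bar>cos a\<bar> * \<bar>cos b - 1\<bar> + \<bar>sin a\<bar> * \<bar>sin b - b\<bar>"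
    by (metis abs_mult abs_triangle_ineq4)
  also have "\<dots> \<le> 1 * (b\<^sup>2 / 2) + 1 * b\<^sup>2"
    by (intro add_mono mult_mono abs_cos_minus1_le abs_sin_minus_le) auto
  also have "\<dots> \<le> 2 * b\<^sup>2" by simp
  finally show ?thesis .
qed

definition gauss_moment :: "nat \<Rightarrow> real" where
  "gauss_moment k = (LINT \<xi>|lborel. \<bar>\<xi>\<bar> ^ k * exp (- \<xi>\<^sup>2))"

lemma gauss_integrable1: "integrable lborel (\<lambda>\<xi>::real. \<bar>\<xi>\<bar> ^ k * exp (- \<xi>\<^sup>2))"
proof -
  \<comment> \<open>With standard deviation \<open>1 / sqrt 2\<close> the normal density is
    proportional to \<open>exp (- x\<^sup>2)\<close>, so known moments can be quoted.\<close>
  have "integrable lborel (\<lambda>x. normal_density 0 (1 / sqrt 2) x * \<bar>x - 0\<bar>^k)"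
    by (rule integrable_normal_moment_abs) auto
  then have "integrable lborel (\<lambda>x. sqrt pi * (normal_density 0 (1 / sqrt 2) x * \<bar>x - 0\<bar>^k))"
    by (rule integrable_mult_right)
  then show ?thesis by (simp add: normal_density_def power_divide mult.commute)
qed

lemma gauss_integrable:
  assumes "a > 0" shows "integrable lborel (\<lambda>\<xi>::real. \<bar>\<xi>\<bar> ^ k * exp (- (a * \<xi>\<^sup>2)))"
proof -
  have "integrable lborel (\<lambda>\<xi>::real. \<bar>0 + sqrt a * \<xi>\<bar> ^ k * exp (- (0 + sqrt a * \<xi>)\<^sup>2))"
    using assms by (intro lborel_integrable_real_affine gauss_integrable1) auto
  then have "integrable lborel (\<lambda>\<xi>::real. inverse (sqrt a ^ k) * (\<bar>0 + sqrt a * \<xi>\<bar> ^ k * exp (- (0 + sqrt a * \<xi>)\<^sup>2)))"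
    by (rule integrable_mult_right)
  also have "(\<lambda>\<xi>::real. inverse (sqrt a ^ k) * (\<bar>0 + sqrt a * \<xi>\<bar> ^ k * exp (- (0 + sqrt a * \<xi>)\<^sup>2)))
      = (\<lambda>\<xi>. \<bar>\<xi>\<bar> ^ k * exp (- (a * \<xi>\<^sup>2)))"
    using assms by (auto simp: fun_eq_iff power_mult_distrib abs_mult field_simps)
  finally show ?thesis .
qed

lemma gauss_scale:
  assumes "a > 0"
  shows "(LINT \<xi>|lborel. \<bar>\<xi>\<bar> ^ k * exp (- (a * \<xi>\<^sup>2))) = gauss_moment k * a powr (- (real k + 1) / 2)"
proof -
  have "gauss_moment k = sqrt a * (LINT \<xi>|lborel. \<bar>0 + sqrt a * \<xi>\<bar> ^ k * exp (- (0 + sqrt a * \<xi>)\<^sup>2))"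
    unfolding gauss_moment_def using assms by (subst lborel_integral_real_affine[of "sqrt a" _ 0]) auto
  also have "\<dots> = sqrt a * (LINT \<xi>|lborel. sqrt a ^ k * (\<bar>\<xi>\<bar> ^ k * exp (- (a * \<xi>\<^sup>2))))"
    using assms by (simp add: power_mult_distrib abs_mult mult.assoc)
  also have "\<dots> = sqrt a ^ (k + 1) * (LINT \<xi>|lborel. \<bar>\<xi>\<bar> ^ k * exp (- (a * \<xi>\<^sup>2)))" by simp
  also have "sqrt a ^ (k + 1) = a powr ((real k + 1) / 2)"
    using assms by (simp add: powr_half_sqrt[symmetric] powr_powr flip: powr_realpow add: add_divide_distrib powr_add)
  finally have "gauss_moment k = a powr ((real k + 1) / 2) * (LINT \<xi>|lborel. \<bar>\<xi>\<bar> ^ k * exp (- (a * \<xi>\<^sup>2)))" .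
  moreover have "a powr (- (real k + 1) / 2) = inverse (a powr ((real k + 1) / 2))"
    using powr_minus[of a "(real k + 1) / 2"] unfolding minus_divide_left .
  ultimately show ?thesis using assms by simp
qed

lemma gauss_moment_nonneg: "gauss_moment k \<ge> 0"
  unfolding gauss_moment_def by (intro Bochner_Integration.integral_nonneg) auto

text \<open>Real part of the characteristic function of the standard normal distribution.\<close>

lemma gauss_cos_std: "(LINT \<xi>|lborel. std_normal_density \<xi> * cos (t * \<xi>)) = exp (- t\<^sup>2 / 2)"
proof -
  have "Re (char std_normal_distribution t) = exp (- t\<^sup>2 / 2)"
    by (simp add: char_std_normal_distribution)
  also have "char std_normal_distribution t = (CLINT \<xi>|lborel. std_normal_density \<xi> *\<^sub>R iexp (t * \<xi>))"
    unfolding char_def by (subst integral_density) (auto simp: normal_density_nonneg)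
  also have "Re \<dots> = (LINT \<xi>|lborel. Re (std_normal_density \<xi> *\<^sub>R iexp (t * \<xi>)))"
    by (rule integral_Re[symmetric], rule Bochner_Integration.integrable_bound[of _ std_normal_density])
       (auto simp: normal_density_nonneg)
  finally show ?thesis by (simp add: Re_exp)
qed

lemma gauss_cos:
  assumes "a > 0"
  shows "(LINT \<xi>|lborel. exp (- (a * \<xi>\<^sup>2)) * cos (\<xi> * x)) = sqrt (pi / a) * exp (- (x\<^sup>2 / (4 * a)))"
proof -
  \<comment> \<open>Rescaling \<xi> by \<open>c\<close> turns exp(-\<xi>^2/2) into exp(-a
    \<xi>^2).\<close>
  define c where "c = sqrt (2 * a)"
  have c: "c > 0" "c\<^sup>2 = 2 * a" using assms by (auto simp: c_def)
  have "exp (- (x / c)\<^sup>2 / 2) = (LINT \<xi>|lborel. std_normal_density \<xi> * cos (x / c * \<xi>))"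
    by (rule gauss_cos_std[symmetric])
  also have "\<dots> = c * (LINT \<xi>|lborel. std_normal_density (0 + c * \<xi>) * cos (x / c * (0 + c * \<xi>)))"
    using c by (subst lborel_integral_real_affine[of c _ 0]) auto
  also have "\<dots> = c * (LINT \<xi>|lborel. 1 / sqrt (2 * pi) * (exp (- (a * \<xi>\<^sup>2)) * cos (\<xi> * x)))"
    using c by (simp add: std_normal_density_def power_mult_distrib mult.commute)
  also have "\<dots> = c / sqrt (2 * pi) * (LINT \<xi>|lborel. exp (- (a * \<xi>\<^sup>2)) * cos (\<xi> * x))" by simp
  finally have "(LINT \<xi>|lborel. exp (- (a * \<xi>\<^sup>2)) * cos (\<xi> * x)) = sqrt (2 * pi) / c * exp (- (x / c)\<^sup>2 / 2)"
    using c by (simp add: field_simps)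
  also have "sqrt (2 * pi) / c = sqrt (pi / a)"
    unfolding c_def by (simp flip: real_sqrt_divide)
  also have "- (x / c)\<^sup>2 / 2 = - (x\<^sup>2 / (4 * a))" using c by (simp add: power_divide)
  finally show ?thesis .
qed

lemma gauss_mult_int:
  fixes g :: "real \<Rightarrow> real"
  assumes "a > 0" and [measurable]: "g \<in> borel_measurable borel" and "\<And>\<xi>. \<bar>g \<xi>\<bar> \<le> C * \<bar>\<xi>\<bar> ^ k"
  shows "integrable lborel (\<lambda>\<xi>. exp (- (a * \<xi>\<^sup>2)) * g \<xi>)"
proof (rule Bochner_Integration.integrable_bound[OF integrable_mult_right[OF gauss_integrable[OF assms(1), of k], of C]])
  show "AE \<xi> in lborel. norm (exp (- (a * \<xi>\<^sup>2)) * g \<xi>) \<le> norm (C * (\<bar>\<xi>\<bar> ^ k * exp (- (a * \<xi>\<^sup>2))))"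
  proof (rule AE_I2)
    fix \<xi>
    have "C * \<bar>\<xi>\<bar> ^ k \<le> \<bar>C\<bar> * \<bar>\<xi>\<bar> ^ k" by (intro mult_right_mono) auto
    with assms(3) have "\<bar>g \<xi>\<bar> \<le> \<bar>C\<bar> * \<bar>\<xi>\<bar> ^ k" by (rule order_trans)
    then have "\<bar>g \<xi>\<bar> * exp (- (a * \<xi>\<^sup>2)) \<le> (\<bar>C\<bar> * \<bar>\<xi>\<bar> ^ k) * exp (- (a * \<xi>\<^sup>2))"
      by (intro mult_right_mono) auto
    then show "norm (exp (- (a * \<xi>\<^sup>2)) * g \<xi>) \<le> norm (C * (\<bar>\<xi>\<bar> ^ k * exp (- (a * \<xi>\<^sup>2))))"
      by (simp add: abs_mult mult_ac)
  qed
qed measurable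

text \<open>The x-derivative of \<open>gauss_cos\<close>, up to sign. Differentiation under the
  integral is done by hand: \<open>abs_cos_add_le\<close> bounds the first-order remainder in the
  increment \<open>h\<close>, and the second Gaussian moment makes the bound integrable.\<close>

lemma gauss_sin:
  assumes a: "a > 0"
  shows "(LINT \<xi>|lborel. exp (- (a * \<xi>\<^sup>2)) * (\<xi> * sin (\<xi> * x))) = x / (2 * a) * (sqrt (pi / a) * exp (- (x\<^sup>2 / (4 * a))))"
proof -
  define G where "G x = (LINT \<xi>|lborel. exp (- (a * \<xi>\<^sup>2)) * cos (\<xi> * x))" for x
  define S where "S = (LINT \<xi>|lborel. exp (- (a * \<xi>\<^sup>2)) * (\<xi> * sin (\<xi> * x)))"
  define M where "M = (LINT \<xi>|lborel. \<bar>\<xi>\<bar>\<^sup>2 * exp (- (a * \<xi>\<^sup>2)))"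
  have c: "integrable lborel (\<lambda>\<xi>. exp (- (a * \<xi>\<^sup>2)) * cos (\<xi> * x))" for x
    by (rule gauss_mult_int[OF a, where C=1 and k=0]) auto
  have s: "integrable lborel (\<lambda>\<xi>. exp (- (a * \<xi>\<^sup>2)) * (\<xi> * sin (\<xi> * x)))"
    by (rule gauss_mult_int[OF a, where C=1 and k=1]) (auto simp: abs_mult mult_left_le)
  have bound: "\<bar>G (x + h) - G x + h * S\<bar> \<le> 2 * M * h\<^sup>2" for h
  proof -
    have eq: "G (x + h) - G x + h * S =
      (LINT \<xi>|lborel. exp (- (a * \<xi>\<^sup>2)) * (cos (\<xi> * x + \<xi> * h) - cos (\<xi> * x) + (\<xi> * h) * sin (\<xi> * x)))"
    proof -
      have "(LINT \<xi>|lborel. exp (- (a * \<xi>\<^sup>2)) * (cos (\<xi> * x + \<xi> * h) - cos (\<xi> * x) + (\<xi> * h) * sin (\<xi> * x)))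
        = (LINT \<xi>|lborel. (exp (- (a * \<xi>\<^sup>2)) * cos (\<xi> * (x + h)) - exp (- (a * \<xi>\<^sup>2)) * cos (\<xi> * x))
            + h * (exp (- (a * \<xi>\<^sup>2)) * (\<xi> * sin (\<xi> * x))))"
        by (intro Bochner_Integration.integral_cong refl) (simp add: algebra_simps)
      also have "\<dots> = G (x + h) - G x + h * S"
        unfolding G_def S_def
        by (subst Bochner_Integration.integral_add, rule Bochner_Integration.integrable_diff[OF c c], rule integrable_mult_right[OF s],
            subst Bochner_Integration.integral_diff[OF c c], subst integral_mult_right_zero, rule refl)
      finally show ?thesis by (rule sym)
    qed
    have "\<bar>G (x + h) - G x + h * S\<bar> \<le> (LINT \<xi>|lborel. 2 * h\<^sup>2 * (\<bar>\<xi>\<bar>\<^sup>2 * exp (- (a * \<xi>\<^sup>2))))"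
      unfolding eq
    proof (rule order_trans[OF integral_abs_bound integral_mono_AE'])
      show "integrable lborel (\<lambda>\<xi>. 2 * h\<^sup>2 * (\<bar>\<xi>\<bar>\<^sup>2 * exp (- (a * \<xi>\<^sup>2))))"
        by (intro integrable_mult_right gauss_integrable a)
      show "AE \<xi> in lborel. \<bar>exp (- (a * \<xi>\<^sup>2)) * (cos (\<xi> * x + \<xi> * h) - cos (\<xi> * x) + (\<xi> * h) * sin (\<xi> * x))\<bar>
          \<le> 2 * h\<^sup>2 * (\<bar>\<xi>\<bar>\<^sup>2 * exp (- (a * \<xi>\<^sup>2)))"
      proof (rule AE_I2)
        fix \<xi>
        have "exp (- (a * \<xi>\<^sup>2)) * \<bar>cos (\<xi> * x + \<xi> * h) - cos (\<xi> * x) + (\<xi> * h) * sin (\<xi> * x)\<bar>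
            \<le> exp (- (a * \<xi>\<^sup>2)) * (2 * (\<xi> * h)\<^sup>2)"
          by (intro mult_left_mono abs_cos_add_le) auto
        then show "\<bar>exp (- (a * \<xi>\<^sup>2)) * (cos (\<xi> * x + \<xi> * h) - cos (\<xi> * x) + (\<xi> * h) * sin (\<xi> * x))\<bar>
          \<le> 2 * h\<^sup>2 * (\<bar>\<xi>\<bar>\<^sup>2 * exp (- (a * \<xi>\<^sup>2)))"
          by (simp add: abs_mult power_mult_distrib mult_ac)
      qed
    qed auto
    also have "\<dots> = 2 * M * h\<^sup>2" by (simp add: M_def)
    finally show ?thesis .
  qed
  have "(G has_real_derivative - S) (at x)"
    unfolding DERIV_def
  proof (rule Lim_null_comparison[where g = "\<lambda>h. 2 * M * \<bar>h\<bar>", THEN LIM_zero_cancel])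
    show "\<forall>\<^sub>F h in at 0. norm ((G (x + h) - G x) / h - - S) \<le> 2 * M * \<bar>h\<bar>"
      unfolding eventually_at_filter
    proof (rule always_eventually, intro allI impI)
      fix h :: real assume h: "h \<noteq> 0"
      have "\<bar>(G (x + h) - G x) / h - - S\<bar> = \<bar>G (x + h) - G x + h * S\<bar> / \<bar>h\<bar>"
        using h by (simp add: field_simps flip: abs_divide)
      also have "\<dots> \<le> 2 * M * h\<^sup>2 / \<bar>h\<bar>" by (intro divide_right_mono bound) auto
      also have "\<dots> = 2 * M * \<bar>h\<bar>" using h by (cases "h > 0") (auto simp: power2_eq_square)
      finally show "norm ((G (x + h) - G x) / h - - S) \<le> 2 * M * \<bar>h\<bar>" by simp
    qed
    show "((\<lambda>h. 2 * M * \<bar>h\<bar>) \<longlongrightarrow> 0) (at 0)" by (auto intro!: tendsto_eq_intros)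
  qed
  moreover have "(G has_real_derivative sqrt (pi / a) * (exp (- (x\<^sup>2 / (4 * a))) * (- (x / (2 * a))))) (at x)"
    unfolding G_def gauss_cos[OF a] using a
    by (auto intro!: derivative_eq_intros simp: field_simps)
  ultimately have "- S = sqrt (pi / a) * (exp (- (x\<^sup>2 / (4 * a))) * (- (x / (2 * a))))"
    by (rule DERIV_unique)
  then show ?thesis unfolding S_def by (simp add: algebra_simps)
qed

lemma integrable_Cauchy_density: "integrable lborel (\<lambda>x::real. inverse (1 + x\<^sup>2))"
  using integrable_inverse_1_plus_square by (simp add: set_integrable_def einterval_def)

section \<open>Spectral gap and Fourier inversion for the kernel\<close>

context kernel begin

definition q :: real where "q = (LINT z|lborel. J z * z\<^sup>2) / 2"

lemma one_minus_Jh: "1 - Jh \<xi> = (LINT z|lborel. J z * (1 - cos (\<xi> * z)))"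
  using J_int J_cos_int[of \<xi>] by (simp add: Jh_def right_diff_distrib J_int1)

text \<open>The error is of fourth order since the cosine has no cubic term; on the diffusive scale
  \<xi> ~ s^(-1/2) this makes s times the error of order 1/s.\<close>

lemma Jh_taylor: "\<bar>Jh \<xi> - 1 + q * \<xi>\<^sup>2\<bar> \<le> (LINT z|lborel. J z * z ^ 4) * \<xi> ^ 4"
proof -
  have eq1: "Jh \<xi> - 1 + q * \<xi>\<^sup>2 = (LINT z|lborel. (J z * cos (\<xi> * z) - J z) + \<xi>\<^sup>2 / 2 * (J z * z\<^sup>2))"
    using J_int J_cos_int[of \<xi>] J_pow_int[of 2] by (simp add: Jh_def J_int1 q_def)
  have eq2: "\<dots> = (LINT z|lborel. J z * (cos (\<xi> * z) - 1 + (\<xi> * z)\<^sup>2 / 2))"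
    by (intro Bochner_Integration.integral_cong refl) (simp add: algebra_simps)
  have "\<bar>Jh \<xi> - 1 + q * \<xi>\<^sup>2\<bar> \<le> (LINT z|lborel. \<xi> ^ 4 * (J z * z ^ 4))"
    unfolding eq1 eq2
  proof (rule order_trans[OF integral_abs_bound integral_mono_AE'])
    show "AE z in lborel. \<bar>J z * (cos (\<xi> * z) - 1 + (\<xi> * z)\<^sup>2 / 2)\<bar> \<le> \<xi> ^ 4 * (J z * z ^ 4)"
    proof (rule AE_I2)
      fix z
      have "J z * \<bar>cos (\<xi> * z) - 1 + (\<xi> * z)\<^sup>2 / 2\<bar> \<le> J z * (\<xi> * z) ^ 4"
        by (intro mult_left_mono abs_cos_taylor_le J_nonneg)
      then show "\<bar>J z * (cos (\<xi> * z) - 1 + (\<xi> * z)\<^sup>2 / 2)\<bar> \<le> \<xi> ^ 4 * (J z * z ^ 4)"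
        using J_nonneg[of z] by (simp add: abs_mult power_mult_distrib mult_ac)
    qed
  qed (use J_nonneg in \<open>auto intro!: J_pow_int\<close>)
  then show ?thesis by (simp add: mult.commute)
qed

text \<open>Integrates 1 - cos(2 \<theta>) = 2 (1 - cos \<theta>)(1 + cos \<theta>) <= 4 (1 - cos
  \<theta>) against the nonnegative \<open>J\<close>.\<close>

lemma Jh_double: "1 - Jh (2 * \<xi>) \<le> 4 * (1 - Jh \<xi>)"
proof -
  have "1 - Jh (2 * \<xi>) \<le> (LINT z|lborel. 4 * (J z * (1 - cos (\<xi> * z))))"
    unfolding one_minus_Jh
  proof (rule integral_mono)
    fix z
    have "1 - cos (2 * \<xi> * z) = 2 * (1 - cos (\<xi> * z)) * (1 + cos (\<xi> * z))"
      using cos_double_cos[of "\<xi> * z"] by (simp add: algebra_simps power2_eq_square)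
    also have "\<dots> \<le> 2 * (1 - cos (\<xi> * z)) * 2"
      by (intro mult_left_mono) auto
    finally have "J z * (1 - cos (2 * \<xi> * z)) \<le> J z * (4 * (1 - cos (\<xi> * z)))"
      by (intro mult_left_mono J_nonneg) simp
    then show "J z * (1 - cos (2 * \<xi> * z)) \<le> 4 * (J z * (1 - cos (\<xi> * z)))"
      by (simp only: mult.left_commute[of 4])
  qed (use J_int J_cos_int in \<open>auto simp: right_diff_distrib\<close>)
  then show ?thesis by (simp add: one_minus_Jh)
qed

lemma Jh_double_iter: "1 - Jh (2 ^ n * \<xi>) \<le> 4 ^ n * (1 - Jh \<xi>)"
proof (induction n)
  case (Suc n)
  have "1 - Jh (2 ^ Suc n * \<xi>) \<le> 4 * (1 - Jh (2 ^ n * \<xi>))"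
    using Jh_double[of "2 ^ n * \<xi>"] by (simp add: mult.assoc)
  also have "\<dots> \<le> 4 * (4 ^ n * (1 - Jh \<xi>))" using Suc by simp
  finally show ?case by simp
qed simp

text \<open>The decay of \<open>Jh\<close> gives the gap for large frequencies; doubling the frequency carries it
  down to small ones.\<close>

lemma Jh_gap:
  assumes "\<xi>0 > 0" obtains c where "c > 0" "c \<le> 1" "\<And>\<xi>. \<bar>\<xi>\<bar> \<ge> \<xi>0 \<Longrightarrow> Jh \<xi> \<le> 1 - c"
proof -
  obtain A where A: "A \<ge> 0" "\<And>\<xi>. \<xi>^4 * \<bar>Jh \<xi>\<bar> \<le> A" using Jh_decay by blast
  \<comment> \<open>With this \<open>X\<close>, a value |Jh| > 1/2 beyond \<open>X\<close> would
    give X/2 <= \<xi>^4 |Jh| <= A < X/2. The summand 1 also ensures X <= X^4.\<close>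
  define X where "X = 1 + 2 * A"
  have large: "1 - Jh \<xi> \<ge> 1/2" if "\<bar>\<xi>\<bar> \<ge> X" for \<xi>
  proof (rule ccontr)
    assume "\<not> 1 - Jh \<xi> \<ge> 1/2"
    then have "\<bar>Jh \<xi>\<bar> > 1/2" by linarith
    moreover have "\<xi>^4 \<ge> X"
    proof -
      have "X \<ge> 1" using A by (simp add: X_def)
      have "X \<le> X ^ 4" using \<open>X \<ge> 1\<close> self_le_power[of X 4] by simp
      also have "\<dots> \<le> \<bar>\<xi>\<bar> ^ 4" using that \<open>X \<ge> 1\<close> by (intro power_mono) auto
      finally show ?thesis by simp
    qed
    ultimately have "X * (1/2) \<le> \<xi>^4 * \<bar>Jh \<xi>\<bar>" using A by (intro mult_mono) auto
    also have "\<dots> \<le> A" by (rule A)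
    finally show False by (simp add: X_def)
  qed
  \<comment> \<open>\<open>n\<close> doublings push every frequency beyond \<open>\<xi>0\<close>
    past \<open>X\<close>; the price is the factor 4^n in the gap.\<close>
  obtain n where n: "X / \<xi>0 < 2 ^ n" using real_arch_pow[of 2] by auto
  show thesis
  proof (rule that[of "1 / (2 * 4 ^ n)"])
    fix \<xi> assume xi: "\<bar>\<xi>\<bar> \<ge> \<xi>0"
    have "X \<le> 2 ^ n * \<xi>0" using n assms by (simp add: field_simps)
    also have "\<dots> \<le> 2 ^ n * \<bar>\<xi>\<bar>" using xi by simp
    finally have "1/2 \<le> 1 - Jh (2 ^ n * \<xi>)" by (intro large) (simp add: abs_mult)
    also have "\<dots> \<le> 4 ^ n * (1 - Jh \<xi>)" by (rule Jh_double_iter)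
    finally show "Jh \<xi> \<le> 1 - 1 / (2 * 4 ^ n)" by (simp add: field_simps)
  next
    have "(1::real) \<le> 2 * 4 ^ n" using one_le_power[of "4::real" n] by linarith
    then show "1 / (2 * 4 ^ n) \<le> (1::real)" by (simp add: divide_le_eq)
  qed simp
qed

text \<open>The gap at frequency 1 is positive and at most \<open>q\<close>, because 1 - cos z <=
  z^2/2. This replaces a measure-theoretic argument that \<open>J\<close> has mass away from
  0.\<close>

lemma q_pos: "q > 0"
proof -
  obtain c where c: "c > 0" "Jh 1 \<le> 1 - c" using Jh_gap[of 1] by (metis abs_1 order_refl zero_less_one)
  have "1 - Jh 1 \<le> (LINT z|lborel. J z * z\<^sup>2 / 2)"
    unfolding one_minus_Jh
  proof (rule integral_mono)
    fix z
    have "J z * (1 - cos (1 * z)) \<le> J z * (z\<^sup>2 / 2)"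
      using abs_cos_minus1_le[of z] by (intro mult_left_mono J_nonneg) auto
    then show "J z * (1 - cos (1 * z)) \<le> J z * z\<^sup>2 / 2" by simp
  qed (use J_int J_cos_int[of 1] J_pow_int[of 2] in \<open>auto simp: right_diff_distrib\<close>)
  then show ?thesis using c by (simp add: q_def)
qed

lemma Jh_near:
  obtains \<xi>0 where "\<xi>0 > 0" "\<And>\<xi>. \<bar>\<xi>\<bar> \<le> \<xi>0 \<Longrightarrow> Jh \<xi> - 1 \<le> - (q / 2 * \<xi>\<^sup>2)"
proof -
  \<comment> \<open>The added 1 makes \<open>C\<close> a legitimate divisor; the radius
    \<open>sqrt (q / (2 * C))\<close> is where the quartic error reaches half of the quadratic
    term.\<close>
  define C where "C = (LINT z|lborel. J z * z ^ 4) + 1"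
  have "(LINT z|lborel. J z * z ^ 4) \<ge> 0"
    using J_nonneg by (intro Bochner_Integration.integral_nonneg) auto
  then have C: "C > 0" by (simp add: C_def)
  show thesis
  proof (rule that[of "sqrt (q / (2 * C))"])
    fix \<xi> assume "\<bar>\<xi>\<bar> \<le> sqrt (q / (2 * C))"
    then have "\<xi>\<^sup>2 \<le> q / (2 * C)" using C q_pos by (metis abs_le_square_iff abs_of_nonneg real_sqrt_ge_0_iff real_sqrt_pow2 less_imp_le divide_nonneg_pos mult_pos_pos zero_less_numeral)
    then have "C * \<xi>\<^sup>2 \<le> q / 2" using C by (simp add: field_simps)
    then have "C * \<xi>\<^sup>2 * \<xi>\<^sup>2 \<le> q / 2 * \<xi>\<^sup>2" by (intro mult_right_mono) auto
    moreover have "(LINT z|lborel. J z * z ^ 4) * \<xi> ^ 4 \<le> C * \<xi> ^ 4"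
      by (intro mult_right_mono) (auto simp: C_def)
    then have "\<bar>Jh \<xi> - 1 + q * \<xi>\<^sup>2\<bar> \<le> C * \<xi> ^ 4"
      using Jh_taylor[of \<xi>] by (rule order_trans[rotated])
    ultimately show "Jh \<xi> - 1 \<le> - (q / 2 * \<xi>\<^sup>2)"
      by (simp add: power4_eq_xxxx power2_eq_square algebra_simps)
  qed (use C q_pos in simp)
qed

text \<open>By \<open>Jh_decay\<close>, |Jh| (1 + \<xi>^2)^2 is bounded by 2 + 2A, so a quadratic
  factor still leaves a multiple of the integrable 1/(1 + \<xi>^2).\<close>

lemma Jh_mult_int:
  fixes g :: "real \<Rightarrow> real"
  assumes [measurable]: "g \<in> borel_measurable borel" and g: "\<And>\<xi>. \<bar>g \<xi>\<bar> \<le> C * (1 + \<xi>\<^sup>2)"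
  shows "integrable lborel (\<lambda>\<xi>. Jh \<xi> * g \<xi>)"
proof -
  obtain A where A: "A \<ge> 0" "\<And>\<xi>. \<xi>^4 * \<bar>Jh \<xi>\<bar> \<le> A" using Jh_decay by blast
  have C: "C \<ge> 0" using g[of 0] by simp
  show ?thesis
  proof (rule Bochner_Integration.integrable_bound[OF integrable_mult_right[OF integrable_Cauchy_density, of "C * (2 + 2 * A)"]])
    show "AE \<xi> in lborel. norm (Jh \<xi> * g \<xi>) \<le> norm (C * (2 + 2 * A) * inverse (1 + \<xi>\<^sup>2))"
    proof (rule AE_I2)
      fix \<xi> :: real
      have pos: "1 + \<xi>\<^sup>2 > 0" using zero_le_power2[of \<xi>] by linarith
      have "2 * \<xi>\<^sup>2 \<le> 1 + \<xi> ^ 4"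
        using zero_le_power2[of "\<xi>\<^sup>2 - 1"] by (simp add: power2_eq_square power4_eq_xxxx algebra_simps)
      then have "(1 + \<xi>\<^sup>2) * (1 + \<xi>\<^sup>2) \<le> 2 + 2 * \<xi> ^ 4"
        by (simp add: algebra_simps power4_eq_xxxx power2_eq_square)
      then have "\<bar>Jh \<xi>\<bar> * ((1 + \<xi>\<^sup>2) * (1 + \<xi>\<^sup>2)) \<le> \<bar>Jh \<xi>\<bar> * (2 + 2 * \<xi> ^ 4)"
        by (intro mult_left_mono) auto
      also have "\<dots> \<le> 2 + 2 * A" using A(2)[of \<xi>] Jh_le1[of \<xi>] by (simp add: algebra_simps)
      finally have "\<bar>Jh \<xi>\<bar> * (1 + \<xi>\<^sup>2) \<le> (2 + 2 * A) * inverse (1 + \<xi>\<^sup>2)"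
        using pos by (simp add: field_simps)
      then have "C * (\<bar>Jh \<xi>\<bar> * (1 + \<xi>\<^sup>2)) \<le> C * ((2 + 2 * A) * inverse (1 + \<xi>\<^sup>2))"
        using C by (intro mult_left_mono)
      moreover have "\<bar>Jh \<xi>\<bar> * \<bar>g \<xi>\<bar> \<le> \<bar>Jh \<xi>\<bar> * (C * (1 + \<xi>\<^sup>2))"
        by (intro mult_left_mono g) auto
      ultimately have "\<bar>Jh \<xi> * g \<xi>\<bar> \<le> C * (2 + 2 * A) * inverse (1 + \<xi>\<^sup>2)"
        by (simp add: abs_mult mult_ac)
      then show "norm (Jh \<xi> * g \<xi>) \<le> norm (C * (2 + 2 * A) * inverse (1 + \<xi>\<^sup>2))"
        by (simp only: real_norm_def)
    qed
  qed measurable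
qed

lemma Jh_cos_int: "integrable lborel (\<lambda>\<xi>. Jh \<xi> * cos (\<xi> * x))"
  by (rule Jh_mult_int[where C=1]) (auto intro: order_trans[OF abs_cos_le_one])

lemma J_bound: "\<bar>J x\<bar> \<le> J 0"
  using J_nonneg[of x] J_antimono_abs[of 0 x] by simp

text \<open>Fourier inversion: Gaussian damping of the frequency integral smooths \<open>J\<close> by a
  Gaussian of vanishing width.\<close>

lemma J_damped:
  assumes e: "e > 0"
  shows "(LINT \<xi>|lborel. exp (- (e * \<xi>\<^sup>2)) * (Jh \<xi> * cos (\<xi> * x)))
    = 2 * sqrt pi * (LINT v|lborel. J (x - 2 * sqrt e * v) * exp (- v\<^sup>2))"
proof -
  have ei: "integrable lborel (\<lambda>\<xi>. exp (- (e * \<xi>\<^sup>2)))"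
    using gauss_integrable[OF e, of 0] by simp
  have "(LINT \<xi>|lborel. exp (- (e * \<xi>\<^sup>2)) * (Jh \<xi> * cos (\<xi> * x)))
    = (LINT \<xi>|lborel. LINT w|lborel. exp (- (e * \<xi>\<^sup>2)) * (J w * cos (\<xi> * (x - w))))"
    by (simp add: J_shift_cos)
  also have "\<dots> = (LINT w|lborel. LINT \<xi>|lborel. exp (- (e * \<xi>\<^sup>2)) * (J w * cos (\<xi> * (x - w))))"
    by (rule lborel_Fubini_bound[where a = J and b = "\<lambda>\<xi>. exp (- (e * \<xi>\<^sup>2))"])
       (use J_nonneg in \<open>auto simp: J_int ei abs_mult mult_left_le mult.commute\<close>)
  also have "\<dots> = (LINT w|lborel. J w * (LINT \<xi>|lborel. exp (- (e * \<xi>\<^sup>2)) * cos (\<xi> * (x - w))))"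
    by (simp add: mult.left_commute)
  also have "\<dots> = (LINT w|lborel. J w * (sqrt (pi / e) * exp (- ((x - w)\<^sup>2 / (4 * e)))))"
    by (simp add: gauss_cos[OF e])
  \<comment> \<open>The substitution w = x - 2 sqrt(e) v moves the small parameter into the argument
    of \<open>J\<close> and leaves a Gaussian of fixed width, ready for the limit e -> 0.\<close>
  also have "\<dots> = \<bar>- 2 * sqrt e\<bar> *\<^sub>R (LINT v|lborel. J (x + (- 2 * sqrt e) * v) *
      (sqrt (pi / e) * exp (- ((x - (x + (- 2 * sqrt e) * v))\<^sup>2 / (4 * e)))))"
    using e by (subst lborel_integral_real_affine[of "- 2 * sqrt e" _ x]) auto
  also have "\<dots> = 2 * sqrt e * (LINT v|lborel. sqrt (pi / e) * (J (x - 2 * sqrt e * v) * exp (- v\<^sup>2)))"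
    using e by (simp add: power_mult_distrib algebra_simps)
  also have "\<dots> = 2 * sqrt pi * (LINT v|lborel. J (x - 2 * sqrt e * v) * exp (- v\<^sup>2))"
    using e by (simp add: real_sqrt_divide)
  finally show ?thesis .
qed

text \<open>The limit of \<open>J_damped\<close> along e = 1/(n+1), by dominated convergence on both
  sides: integrability of \<open>Jh\<close> on the left, boundedness and continuity of
  \<open>J\<close> on the right. The identity therefore holds at every point.\<close>

lemma J_inversion: "(LINT \<xi>|lborel. Jh \<xi> * cos (\<xi> * x)) = 2 * pi * J x"
proof -
  define e where "e n = inverse (real (Suc n))" for n
  have e: "e n > 0" "e \<longlonglongrightarrow> 0" for n
    unfolding e_def using LIMSEQ_inverse_real_of_nat by auto
  have "(\<lambda>n. LINT \<xi>|lborel. exp (- (e n * \<xi>\<^sup>2)) * (Jh \<xi> * cos (\<xi> * x)))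
    \<longlonglongrightarrow> (LINT \<xi>|lborel. exp (- (0 * \<xi>\<^sup>2)) * (Jh \<xi> * cos (\<xi> * x)))"
  proof (rule integral_dominated_convergence[where w = "\<lambda>\<xi>. \<bar>Jh \<xi> * cos (\<xi> * x)\<bar>"])
    show "integrable lborel (\<lambda>\<xi>. \<bar>Jh \<xi> * cos (\<xi> * x)\<bar>)" by (intro integrable_abs Jh_cos_int)
    show "AE \<xi> in lborel. (\<lambda>n. exp (- (e n * \<xi>\<^sup>2)) * (Jh \<xi> * cos (\<xi> * x)))
        \<longlonglongrightarrow> exp (- (0 * \<xi>\<^sup>2)) * (Jh \<xi> * cos (\<xi> * x))"
      by (intro AE_I2 tendsto_intros e)
    fix n show "AE \<xi> in lborel. norm (exp (- (e n * \<xi>\<^sup>2)) * (Jh \<xi> * cos (\<xi> * x))) \<le> \<bar>Jh \<xi> * cos (\<xi> * x)\<bar>"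
      using e(1)[of n] by (intro AE_I2) (simp add: abs_mult mult_left_le_one_le)
  qed measurable
  moreover have "(\<lambda>n. 2 * sqrt pi * (LINT v|lborel. J (x - 2 * sqrt (e n) * v) * exp (- v\<^sup>2)))
    \<longlonglongrightarrow> 2 * sqrt pi * (LINT v|lborel. J (x - 2 * sqrt 0 * v) * exp (- v\<^sup>2))"
  proof (intro tendsto_mult tendsto_const integral_dominated_convergence[where w = "\<lambda>v. J 0 * exp (- v\<^sup>2)"])
    show "integrable lborel (\<lambda>v. J 0 * exp (- v\<^sup>2))"
      using gauss_integrable1[of 0] by simp
    show "AE v in lborel. (\<lambda>n. J (x - 2 * sqrt (e n) * v) * exp (- v\<^sup>2)) \<longlonglongrightarrow> J (x - 2 * sqrt 0 * v) * exp (- v\<^sup>2)"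
      by (intro AE_I2 tendsto_intros continuous_on_tendsto_compose[OF J_cont] e) auto
    fix n show "AE v in lborel. norm (J (x - 2 * sqrt (e n) * v) * exp (- v\<^sup>2)) \<le> J 0 * exp (- v\<^sup>2)"
      by (intro AE_I2) (simp add: abs_mult J_bound)
  qed measurable
  ultimately have "(LINT \<xi>|lborel. exp (- (0 * \<xi>\<^sup>2)) * (Jh \<xi> * cos (\<xi> * x)))
    = 2 * sqrt pi * (LINT v|lborel. J (x - 2 * sqrt 0 * v) * exp (- v\<^sup>2))"
    unfolding J_damped[OF e(1)] by (rule LIMSEQ_unique)
  also have "(LINT v|lborel. J (x - 2 * sqrt 0 * v) * exp (- v\<^sup>2)) = J x * sqrt pi"
    using gauss_cos[of 1 0] by simp
  finally show ?thesis by (simp add: mult_ac)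
qed

text \<open>The product-to-sum formula applied to \<open>J_inversion\<close>; it diagonalises the
  odd kernel by sines.\<close>

lemma J_odd_kernel:
  "J (x - y) - J (x + y) = (LINT \<xi>|lborel. Jh \<xi> * (sin (\<xi> * x) * sin (\<xi> * y))) / pi"
proof -
  have "2 * pi * (J (x - y) - J (x + y))
      = (LINT \<xi>|lborel. Jh \<xi> * cos (\<xi> * (x - y)) - Jh \<xi> * cos (\<xi> * (x + y)))"
    using Jh_cos_int[of "x - y"] Jh_cos_int[of "x + y"] by (simp add: J_inversion right_diff_distrib[of "2 * pi"])
  also have "\<dots> = (LINT \<xi>|lborel. 2 * (Jh \<xi> * (sin (\<xi> * x) * sin (\<xi> * y))))"
    by (simp add: distrib_left right_diff_distrib cos_add cos_diff algebra_simps)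
  finally show ?thesis by (simp add: field_simps)
qed

end

subsection \<open>The symbol for large times\<close>

text \<open>The mean value inequality: \<open>exp m\<close> bounds the derivative between the two
  arguments.\<close>

lemma abs_exp_diff_le:
  fixes a b m :: real assumes "a \<le> m" "b \<le> m" shows "\<bar>exp a - exp b\<bar> \<le> \<bar>a - b\<bar> * exp m"
proof -
  have le: "exp x - exp y \<le> (x - y) * exp m" if "y \<le> x" "x \<le> m" for x y
  proof -
    have "1 - exp (y - x) \<le> x - y" using exp_ge_add_one_self[of "y - x"] by linarith
    then have "(1 - exp (y - x)) * exp x \<le> (x - y) * exp x" by (intro mult_right_mono) auto
    also have "\<dots> \<le> (x - y) * exp m" using that by (intro mult_left_mono) auto
    finally show ?thesis by (simp add: algebra_simps exp_diff)
  qed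
  show ?thesis
  proof (cases "b \<le> a")
    case True then show ?thesis using le[of b a] assms by simp
  next
    case False then show ?thesis using le[of a b] assms by simp
  qed
qed

context kernel begin

text \<open>Fourier symbol of \<open>e\<^bsup>s(J* - 1)\<^esup>\<close> without its singular part \<open>e\<^bsup>-s\<^esup>\<close>.\<close>

definition rsym :: "real \<Rightarrow> real \<Rightarrow> real" where
  "rsym s \<xi> = exp (s * (Jh \<xi> - 1)) - exp (- s)"

text \<open>The factor \<open>\<xi>\<^sup>2\<close> is what the odd evolution produces: one \<xi>
  from \<open>sin (\<xi> * x)\<close>, with coefficient x, and one from the sine transform of the
  datum, with its first moment as coefficient. The Gaussian integral with this factor is of order
  s^(-3/2).\<close>

definition sym_norm :: "real \<Rightarrow> real" where
  "sym_norm s = (LINT \<xi>|lborel. \<xi>\<^sup>2 * \<bar>rsym s \<xi>\<bar>)"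

definition sym_err :: "real \<Rightarrow> real" where
  "sym_err s = (LINT \<xi>|lborel. \<xi>\<^sup>2 * \<bar>rsym s \<xi> - exp (- (q * s * \<xi>\<^sup>2))\<bar>)"

lemma rsym_meas [measurable]: "rsym s \<in> borel_measurable borel"
  unfolding rsym_def by measurable

text \<open>The two exponents in \<open>rsym\<close> differ by exactly \<open>s * Jh \<xi>\<close>,
  so removing \<open>exp (- s)\<close> transfers the decay of \<open>Jh\<close> to the symbol. The
  case c = 0 gives integrability; a spectral gap gives exponential smallness in s.\<close>

lemma rsym_bound_gen:
  assumes "s \<ge> 0" "Jh \<xi> \<le> 1 - c" "c \<le> 1" shows "\<bar>rsym s \<xi>\<bar> \<le> s * \<bar>Jh \<xi>\<bar> * exp (- (c * s))"
proof -
  have "s * Jh \<xi> \<le> s * (1 - c)" using assms by (intro mult_left_mono)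
  then have 1: "s * (Jh \<xi> - 1) \<le> - (c * s)" by (simp add: algebra_simps)
  have 2: "- s \<le> - (c * s)" using assms mult_right_mono[of c 1 s] by simp
  have "\<bar>rsym s \<xi>\<bar> \<le> \<bar>s * (Jh \<xi> - 1) - (- s)\<bar> * exp (- (c * s))"
    unfolding rsym_def by (rule abs_exp_diff_le[OF 1 2])
  also have "s * (Jh \<xi> - 1) - (- s) = s * Jh \<xi>" by (simp add: algebra_simps)
  finally show ?thesis using assms by (simp add: abs_mult)
qed

lemma rsym_bound: assumes "s \<ge> 0" shows "\<bar>rsym s \<xi>\<bar> \<le> s * \<bar>Jh \<xi>\<bar>"
  using rsym_bound_gen[OF assms, of \<xi> 0] Jh_le1[of \<xi>] by simp

lemma Jh_sq_int: "integrable lborel (\<lambda>\<xi>. \<xi>\<^sup>2 * \<bar>Jh \<xi>\<bar>)"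
  using integrable_abs[OF Jh_mult_int[of "\<lambda>\<xi>. \<xi>\<^sup>2" 1]] by (simp add: abs_mult mult.commute)

lemma rsym_mult_int:
  fixes g :: "real \<Rightarrow> real"
  assumes s: "s \<ge> 0" and [measurable]: "g \<in> borel_measurable borel" and g: "\<And>\<xi>. \<bar>g \<xi>\<bar> \<le> C * (1 + \<xi>\<^sup>2)"
  shows "integrable lborel (\<lambda>\<xi>. rsym s \<xi> * g \<xi>)"
proof (rule Bochner_Integration.integrable_bound[OF integrable_mult_right[OF Jh_mult_int[OF assms(2) g], of s]])
  show "AE \<xi> in lborel. norm (rsym s \<xi> * g \<xi>) \<le> norm (s * (Jh \<xi> * g \<xi>))"
  proof (rule AE_I2)
    fix \<xi>
    have "\<bar>rsym s \<xi>\<bar> * \<bar>g \<xi>\<bar> \<le> s * \<bar>Jh \<xi>\<bar> * \<bar>g \<xi>\<bar>"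
      by (intro mult_right_mono rsym_bound s) auto
    then show "norm (rsym s \<xi> * g \<xi>) \<le> norm (s * (Jh \<xi> * g \<xi>))" using s by (simp add: abs_mult mult.assoc)
  qed
qed measurable

lemma rsym_sq_int:
  assumes "s \<ge> 0" shows "integrable lborel (\<lambda>\<xi>. \<xi>\<^sup>2 * \<bar>rsym s \<xi>\<bar>)"
  using integrable_abs[OF rsym_mult_int[OF assms, of "\<lambda>\<xi>. \<xi>\<^sup>2" 1]] by (simp add: abs_mult mult.commute)

lemma gauss_q_int:
  assumes "s > 0" shows "integrable lborel (\<lambda>\<xi>. \<bar>\<xi>\<bar> ^ k * exp (- (q * s * \<xi>\<^sup>2)))"
  using assms q_pos by (intro gauss_integrable) auto

lemma gauss_q_sq_int:
  assumes "s > 0" shows "integrable lborel (\<lambda>\<xi>. \<xi>\<^sup>2 * exp (- (q * s * \<xi>\<^sup>2)))"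
  using gauss_q_int[OF assms, of 2] by simp

lemma sym_err_int:
  assumes "s > 0" shows "integrable lborel (\<lambda>\<xi>. \<xi>\<^sup>2 * \<bar>rsym s \<xi> - exp (- (q * s * \<xi>\<^sup>2))\<bar>)"
proof (rule Bochner_Integration.integrable_bound[OF Bochner_Integration.integrable_add[OF rsym_sq_int gauss_q_sq_int[OF assms]]])
  show "AE \<xi> in lborel. norm (\<xi>\<^sup>2 * \<bar>rsym s \<xi> - exp (- (q * s * \<xi>\<^sup>2))\<bar>)
      \<le> norm (\<xi>\<^sup>2 * \<bar>rsym s \<xi>\<bar> + \<xi>\<^sup>2 * exp (- (q * s * \<xi>\<^sup>2)))"
  proof (rule AE_I2)
    fix \<xi>
    have "\<bar>rsym s \<xi> - exp (- (q * s * \<xi>\<^sup>2))\<bar> \<le> \<bar>rsym s \<xi>\<bar> + exp (- (q * s * \<xi>\<^sup>2))"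
      using abs_triangle_ineq4[of "rsym s \<xi>" "exp (- (q * s * \<xi>\<^sup>2))"] by simp
    then have "\<xi>\<^sup>2 * \<bar>rsym s \<xi> - exp (- (q * s * \<xi>\<^sup>2))\<bar> \<le> \<xi>\<^sup>2 * (\<bar>rsym s \<xi>\<bar> + exp (- (q * s * \<xi>\<^sup>2)))"
      by (intro mult_left_mono) auto
    then show "norm (\<xi>\<^sup>2 * \<bar>rsym s \<xi> - exp (- (q * s * \<xi>\<^sup>2))\<bar>)
      \<le> norm (\<xi>\<^sup>2 * \<bar>rsym s \<xi>\<bar> + \<xi>\<^sup>2 * exp (- (q * s * \<xi>\<^sup>2)))"
      by (simp add: abs_mult distrib_left)
  qed
qed (use assms in auto)

lemma sym_norm_nonneg: "sym_norm s \<ge> 0" and sym_err_nonneg: "sym_err s \<ge> 0"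
  unfolding sym_norm_def sym_err_def by (auto intro!: Bochner_Integration.integral_nonneg)

text \<open>For small frequencies the two exponents differ by \<open>O(s\<xi>\<^sup>4)\<close>; large frequencies contribute an
  exponentially small amount.\<close>

lemma sym_err_pointwise:
  obtains C c \<xi>0 where "C \<ge> 0" "c > 0" "\<xi>0 > 0"
    "\<And>s \<xi>. s > 0 \<Longrightarrow> \<xi>\<^sup>2 * \<bar>rsym s \<xi> - exp (- (q * s * \<xi>\<^sup>2))\<bar>
      \<le> C * s * (\<bar>\<xi>\<bar> ^ 6 * exp (- (q / 2 * s * \<xi>\<^sup>2))) + exp (\<xi>0\<^sup>2 - s) * (\<bar>\<xi>\<bar> ^ 2 * exp (- \<xi>\<^sup>2))
        + s * exp (- (c * s)) * (\<xi>\<^sup>2 * \<bar>Jh \<xi>\<bar>)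
        + exp (- (q / 2 * s * \<xi>0\<^sup>2)) * (\<bar>\<xi>\<bar> ^ 2 * exp (- (q / 2 * s * \<xi>\<^sup>2)))"
proof -
  define C where "C = (LINT z|lborel. J z * z ^ 4)"
  have C: "C \<ge> 0" unfolding C_def
    using J_nonneg by (intro Bochner_Integration.integral_nonneg) auto
  obtain \<xi>0 where x0: "\<xi>0 > 0" "\<And>\<xi>. \<bar>\<xi>\<bar> \<le> \<xi>0 \<Longrightarrow> Jh \<xi> - 1 \<le> - (q / 2 * \<xi>\<^sup>2)" by (rule Jh_near, rule that)
  obtain c where c: "c > 0" "c \<le> 1" "\<And>\<xi>. \<bar>\<xi>\<bar> \<ge> \<xi>0 \<Longrightarrow> Jh \<xi> \<le> 1 - c" using Jh_gap[OF x0(1)] by blast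
  show thesis
  proof (rule that[OF C c(1) x0(1)])
    fix s \<xi> :: real assume s: "s > 0"
    let ?A = "C * s * (\<bar>\<xi>\<bar> ^ 6 * exp (- (q / 2 * s * \<xi>\<^sup>2)))"
    let ?B = "exp (\<xi>0\<^sup>2 - s) * (\<bar>\<xi>\<bar> ^ 2 * exp (- \<xi>\<^sup>2))"
    let ?C = "s * exp (- (c * s)) * (\<xi>\<^sup>2 * \<bar>Jh \<xi>\<bar>)"
    let ?D = "exp (- (q / 2 * s * \<xi>0\<^sup>2)) * (\<bar>\<xi>\<bar> ^ 2 * exp (- (q / 2 * s * \<xi>\<^sup>2)))"
    have nn: "?A \<ge> 0" "?B \<ge> 0" "?C \<ge> 0" "?D \<ge> 0" using C s by auto
    show "\<xi>\<^sup>2 * \<bar>rsym s \<xi> - exp (- (q * s * \<xi>\<^sup>2))\<bar> \<le> ?A + ?B + ?C + ?D"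
    proof (cases "\<bar>\<xi>\<bar> \<le> \<xi>0")
      case True
      have "s * (Jh \<xi> - 1) \<le> s * (- (q / 2 * \<xi>\<^sup>2))" using x0(2)[OF True] s by (intro mult_left_mono) auto
      then have 1: "s * (Jh \<xi> - 1) \<le> - (q / 2 * s * \<xi>\<^sup>2)" by (simp add: algebra_simps)
      have 2: "- (q * s * \<xi>\<^sup>2) \<le> - (q / 2 * s * \<xi>\<^sup>2)" using s q_pos by (simp add: mult_right_mono)
      have "\<bar>exp (s * (Jh \<xi> - 1)) - exp (- (q * s * \<xi>\<^sup>2))\<bar>
          \<le> \<bar>s * (Jh \<xi> - 1) - (- (q * s * \<xi>\<^sup>2))\<bar> * exp (- (q / 2 * s * \<xi>\<^sup>2))"
        by (rule abs_exp_diff_le[OF 1 2])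
      also have "s * (Jh \<xi> - 1) - (- (q * s * \<xi>\<^sup>2)) = s * (Jh \<xi> - 1 + q * \<xi>\<^sup>2)" by (simp add: algebra_simps)
      also have "\<bar>\<dots>\<bar> * exp (- (q / 2 * s * \<xi>\<^sup>2)) \<le> s * (C * \<xi> ^ 4) * exp (- (q / 2 * s * \<xi>\<^sup>2))"
        using Jh_taylor[of \<xi>] s by (intro mult_right_mono) (auto simp: abs_mult C_def)
      finally have a: "\<bar>exp (s * (Jh \<xi> - 1)) - exp (- (q * s * \<xi>\<^sup>2))\<bar> \<le> s * (C * \<xi> ^ 4) * exp (- (q / 2 * s * \<xi>\<^sup>2))" .
      have "\<xi>\<^sup>2 \<le> \<xi>0\<^sup>2" using True x0(1) by (simp add: abs_le_square_iff[symmetric])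
      \<comment> \<open>A Gaussian factor, compensated by \<open>exp (\<xi>0\<^sup>2)\<close> on
        this range, makes the bound integrable over the whole line without an indicator.\<close>
      then have b: "exp (- s) \<le> exp (\<xi>0\<^sup>2 - s) * exp (- \<xi>\<^sup>2)" by (simp flip: exp_add)
      have "\<bar>rsym s \<xi> - exp (- (q * s * \<xi>\<^sup>2))\<bar> \<le> s * (C * \<xi> ^ 4) * exp (- (q / 2 * s * \<xi>\<^sup>2)) + exp (\<xi>0\<^sup>2 - s) * exp (- \<xi>\<^sup>2)"
        using a b exp_gt_zero[of "- s"] unfolding rsym_def by linarith
      then have "\<xi>\<^sup>2 * \<bar>rsym s \<xi> - exp (- (q * s * \<xi>\<^sup>2))\<bar>
          \<le> \<xi>\<^sup>2 * (s * (C * \<xi> ^ 4) * exp (- (q / 2 * s * \<xi>\<^sup>2)) + exp (\<xi>0\<^sup>2 - s) * exp (- \<xi>\<^sup>2))"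
        by (intro mult_left_mono) auto
      also have "\<dots> = ?A + ?B" by (simp add: algebra_simps power_even_abs flip: power_add)
      finally show ?thesis using nn by linarith
    next
      case False
      have a: "\<bar>rsym s \<xi>\<bar> \<le> s * \<bar>Jh \<xi>\<bar> * exp (- (c * s))"
        using False s c by (intro rsym_bound_gen) auto
      have "\<xi>0\<^sup>2 \<le> \<xi>\<^sup>2" using False x0(1) by (simp add: abs_le_square_iff[symmetric])
      \<comment> \<open>Half of the Gaussian exponent is spent on the exponentially small prefactor,
        the other half keeps the bound integrable.\<close>
      then have "q / 2 * s * \<xi>0\<^sup>2 \<le> q / 2 * s * \<xi>\<^sup>2" using s q_pos by (intro mult_left_mono) auto
      then have b: "exp (- (q * s * \<xi>\<^sup>2)) \<le> exp (- (q / 2 * s * \<xi>0\<^sup>2)) * exp (- (q / 2 * s * \<xi>\<^sup>2))"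
        by (simp flip: exp_add)
      have "\<bar>rsym s \<xi> - exp (- (q * s * \<xi>\<^sup>2))\<bar> \<le> s * \<bar>Jh \<xi>\<bar> * exp (- (c * s))
          + exp (- (q / 2 * s * \<xi>0\<^sup>2)) * exp (- (q / 2 * s * \<xi>\<^sup>2))"
        using a b exp_gt_zero[of "- (q * s * \<xi>\<^sup>2)"] by linarith
      then have "\<xi>\<^sup>2 * \<bar>rsym s \<xi> - exp (- (q * s * \<xi>\<^sup>2))\<bar>
          \<le> \<xi>\<^sup>2 * (s * \<bar>Jh \<xi>\<bar> * exp (- (c * s)) + exp (- (q / 2 * s * \<xi>0\<^sup>2)) * exp (- (q / 2 * s * \<xi>\<^sup>2)))"
        by (intro mult_left_mono) auto
      also have "\<dots> = ?C + ?D" by (simp add: algebra_simps)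
      finally show ?thesis using nn by linarith
    qed
  qed
qed

text \<open>The leading term is \<open>s\<close> times a sixth Gaussian moment, of order s *
  s^(-7/2) = s^(-5/2), a full power better than needed; the other three terms of \<open>U\<close>
  are exponentially small.\<close>

lemma sym_err_asymp: "((\<lambda>s. s powr (3/2) * sym_err s) \<longlongrightarrow> 0) at_top"
proof -
  obtain C c \<xi>0 where C: "C \<ge> 0" and c: "c > 0" and x0: "\<xi>0 > 0"
    and bd: "\<And>s \<xi>. s > 0 \<Longrightarrow> \<xi>\<^sup>2 * \<bar>rsym s \<xi> - exp (- (q * s * \<xi>\<^sup>2))\<bar>
      \<le> C * s * (\<bar>\<xi>\<bar> ^ 6 * exp (- (q / 2 * s * \<xi>\<^sup>2))) + exp (\<xi>0\<^sup>2 - s) * (\<bar>\<xi>\<bar> ^ 2 * exp (- \<xi>\<^sup>2))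
        + s * exp (- (c * s)) * (\<xi>\<^sup>2 * \<bar>Jh \<xi>\<bar>)
        + exp (- (q / 2 * s * \<xi>0\<^sup>2)) * (\<bar>\<xi>\<bar> ^ 2 * exp (- (q / 2 * s * \<xi>\<^sup>2)))"
    by (rule sym_err_pointwise, rule that)
  define B where "B = (LINT \<xi>|lborel. \<xi>\<^sup>2 * \<bar>Jh \<xi>\<bar>)"
  define h where "h = q / 2"
  define l where "l = h * \<xi>0\<^sup>2"
  have h: "h > 0" and l: "l > 0" using q_pos x0 by (auto simp: h_def l_def)
  define U where "U s = C * s * (gauss_moment 6 * (h * s) powr (- (7 / 2))) + exp (\<xi>0\<^sup>2 - s) * gauss_moment 2
        + s * exp (- (c * s)) * B + exp (- (l * s)) * (gauss_moment 2 * (h * s) powr (- (3 / 2)))" for s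
  have le: "sym_err s \<le> U s" if s: "s > 0" for s
  proof -
    have hs: "h * s > 0" using h s by simp
    have i: "integrable lborel (\<lambda>\<xi>. C * s * (\<bar>\<xi>\<bar> ^ 6 * exp (- (h * s * \<xi>\<^sup>2))))"
      "integrable lborel (\<lambda>\<xi>::real. exp (\<xi>0\<^sup>2 - s) * (\<bar>\<xi>\<bar> ^ 2 * exp (- \<xi>\<^sup>2)))"
      "integrable lborel (\<lambda>\<xi>. s * exp (- (c * s)) * (\<xi>\<^sup>2 * \<bar>Jh \<xi>\<bar>))"
      "integrable lborel (\<lambda>\<xi>. exp (- (l * s)) * (\<bar>\<xi>\<bar> ^ 2 * exp (- (h * s * \<xi>\<^sup>2))))"
      by (intro integrable_mult_right gauss_integrable hs gauss_integrable1 Jh_sq_int)+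
    have "sym_err s \<le> (LINT \<xi>|lborel. C * s * (\<bar>\<xi>\<bar> ^ 6 * exp (- (h * s * \<xi>\<^sup>2)))
        + exp (\<xi>0\<^sup>2 - s) * (\<bar>\<xi>\<bar> ^ 2 * exp (- \<xi>\<^sup>2))
        + s * exp (- (c * s)) * (\<xi>\<^sup>2 * \<bar>Jh \<xi>\<bar>)
        + exp (- (l * s)) * (\<bar>\<xi>\<bar> ^ 2 * exp (- (h * s * \<xi>\<^sup>2))))"
      unfolding sym_err_def
    proof (rule integral_mono)
      fix \<xi>
      show "\<xi>\<^sup>2 * \<bar>rsym s \<xi> - exp (- (q * s * \<xi>\<^sup>2))\<bar> \<le> C * s * (\<bar>\<xi>\<bar> ^ 6 * exp (- (h * s * \<xi>\<^sup>2)))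
        + exp (\<xi>0\<^sup>2 - s) * (\<bar>\<xi>\<bar> ^ 2 * exp (- \<xi>\<^sup>2))
        + s * exp (- (c * s)) * (\<xi>\<^sup>2 * \<bar>Jh \<xi>\<bar>)
        + exp (- (l * s)) * (\<bar>\<xi>\<bar> ^ 2 * exp (- (h * s * \<xi>\<^sup>2)))"
        using bd[OF s, of \<xi>] by (simp add: h_def l_def mult_ac)
    qed (intro Bochner_Integration.integrable_add i sym_err_int s)+
    also have "\<dots> = U s"
      unfolding U_def B_def
      apply (subst Bochner_Integration.integral_add, (intro Bochner_Integration.integrable_add i)+)+
      apply (simp only: integral_mult_right_zero gauss_scale[OF hs] gauss_moment_def[symmetric])
      apply simp
      done
    finally show ?thesis .
  qed
  have "((\<lambda>s. s powr (3/2) * U s) \<longlongrightarrow> 0) at_top"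
    unfolding U_def using h l c by real_asymp
  then show ?thesis
  proof (rule tendsto_sandwich[OF _ _ tendsto_const, rotated 2])
    show "\<forall>\<^sub>F s in at_top. 0 \<le> s powr (3/2) * sym_err s"
      by (intro always_eventually allI mult_nonneg_nonneg sym_err_nonneg) auto
    show "\<forall>\<^sub>F s in at_top. s powr (3/2) * sym_err s \<le> s powr (3/2) * U s"
      using eventually_gt_at_top[of 0] by eventually_elim (intro mult_left_mono le, auto)
  qed
qed

lemma gauss_q_sq:
  assumes "s > 0"
  shows "(LINT \<xi>|lborel. \<xi>\<^sup>2 * exp (- (q * s * \<xi>\<^sup>2))) = gauss_moment 2 * (q * s) powr (- (3/2))"
  using gauss_scale[of "q * s" 2] assms q_pos by simp

lemma gauss_q_cube:
  assumes "s > 0"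
  shows "(LINT \<xi>|lborel. \<bar>\<xi>\<bar> ^ 3 * exp (- (q * s * \<xi>\<^sup>2))) = gauss_moment 3 * (q * s) powr (- 2)"
  using gauss_scale[of "q * s" 3] assms q_pos by simp

text \<open>The Gaussian part has second moment of order s^(-3/2) and the error is smaller. This is
  the source of the decay rate in the pointwise bounds below.\<close>

lemma sym_norm_asymp:
  obtains C T where "C > 0" "T > 0" "\<And>s. s \<ge> T \<Longrightarrow> sym_norm s \<le> C * s powr (- (3/2))"
proof -
  have "\<forall>\<^sub>F s in at_top. s powr (3/2) * sym_err s < 1"
    using order_tendstoD(2)[OF sym_err_asymp] by simp
  then obtain T where T: "\<And>s. s \<ge> T \<Longrightarrow> s powr (3/2) * sym_err s < 1"
    unfolding eventually_at_top_linorder by blast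
  define K where "K = gauss_moment 2 * q powr (- (3/2))"
  have K: "K \<ge> 0" by (simp add: K_def gauss_moment_nonneg)
  show thesis
  proof (rule that[of "1 + K" "max T 1"])
    fix s assume s: "s \<ge> max T 1"
    have "sym_norm s \<le> (LINT \<xi>|lborel. \<xi>\<^sup>2 * \<bar>rsym s \<xi> - exp (- (q * s * \<xi>\<^sup>2))\<bar> + \<xi>\<^sup>2 * exp (- (q * s * \<xi>\<^sup>2)))"
      unfolding sym_norm_def
    proof (rule integral_mono)
      fix \<xi>
      have "\<bar>rsym s \<xi>\<bar> \<le> \<bar>rsym s \<xi> - exp (- (q * s * \<xi>\<^sup>2))\<bar> + exp (- (q * s * \<xi>\<^sup>2))"
        using abs_triangle_ineq[of "rsym s \<xi> - exp (- (q * s * \<xi>\<^sup>2))" "exp (- (q * s * \<xi>\<^sup>2))"] by simp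
      then have "\<xi>\<^sup>2 * \<bar>rsym s \<xi>\<bar> \<le> \<xi>\<^sup>2 * (\<bar>rsym s \<xi> - exp (- (q * s * \<xi>\<^sup>2))\<bar> + exp (- (q * s * \<xi>\<^sup>2)))"
        by (intro mult_left_mono) auto
      then show "\<xi>\<^sup>2 * \<bar>rsym s \<xi>\<bar> \<le> \<xi>\<^sup>2 * \<bar>rsym s \<xi> - exp (- (q * s * \<xi>\<^sup>2))\<bar> + \<xi>\<^sup>2 * exp (- (q * s * \<xi>\<^sup>2))"
        by (simp add: distrib_left)
    qed (use s in \<open>auto intro!: Bochner_Integration.integrable_add rsym_sq_int sym_err_int gauss_q_sq_int\<close>)
    also have "\<dots> = sym_err s + gauss_moment 2 * (q * s) powr (- (3/2))"
      unfolding sym_err_def using s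
      by (subst Bochner_Integration.integral_add) (auto intro!: sym_err_int gauss_q_sq_int simp: gauss_q_sq)
    also have "gauss_moment 2 * (q * s) powr (- (3/2)) = K * s powr (- (3/2))"
      using q_pos s by (simp add: K_def powr_mult)
    also have "sym_err s \<le> 1 * s powr (- (3/2))"
      using T[of s] s by (simp add: powr_minus field_simps)
    finally show "sym_norm s \<le> (1 + K) * s powr (- (3/2))" by (simp add: distrib_right)
  qed (use K in auto)
qed

end

subsection \<open>Odd reflection\<close>

definition poisson_weight :: "real \<Rightarrow> nat \<Rightarrow> real" where
  "poisson_weight t n = exp (- t) * t ^ n / fact n"

lemma poisson_weight_nonneg: "t \<ge> 0 \<Longrightarrow> poisson_weight t n \<ge> 0"
  by (simp add: poisson_weight_def)

lemma poisson_weight_power_sums: "(\<lambda>n. poisson_weight t n * r ^ n) sums exp (t * (r - 1))"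
proof -
  have "(\<lambda>n. exp (- t) * ((t * r) ^ n / fact n)) sums (exp (- t) * exp (t * r))"
    using exp_converges[of "t * r"] by (intro sums_mult) (simp add: divide_inverse mult.commute)
  then show ?thesis
    by (simp add: poisson_weight_def power_mult_distrib mult_ac algebra_simps flip: exp_add)
qed

lemma poisson_weight_sums: "poisson_weight t sums 1"
  using poisson_weight_power_sums[of t 1] by simp

definition sin_transform :: "(real \<Rightarrow> real) \<Rightarrow> real \<Rightarrow> real" where
  "sin_transform f \<xi> = (LINT y|lborel. sin (\<xi> * y) * f y)"

lemma sin_transform_meas [measurable]:
  assumes [measurable]: "f \<in> borel_measurable borel"
  shows "sin_transform f \<in> borel_measurable borel"
  unfolding sin_transform_def by measurable

lemma sin_mult_integrable:
  assumes "integrable lborel (f :: real \<Rightarrow> real)" shows "integrable lborel (\<lambda>y. sin (\<xi> * y) * f y)"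
  by (rule Bochner_Integration.integrable_bound[OF assms])
     (use borel_measurable_integrable[OF assms] in \<open>auto simp: abs_mult intro!: mult_left_le_one_le\<close>)

lemma sin_transform_bound:
  assumes f: "integrable lborel f" shows "\<bar>sin_transform f \<xi>\<bar> \<le> (LINT y|lborel. \<bar>f y\<bar>)"
proof -
  have "\<bar>sin_transform f \<xi>\<bar> \<le> (LINT y|lborel. \<bar>sin (\<xi> * y) * f y\<bar>)"
    unfolding sin_transform_def by (rule integral_abs_bound)
  also have "\<dots> \<le> (LINT y|lborel. \<bar>f y\<bar>)"
    by (intro integral_mono integrable_abs sin_mult_integrable f) (auto simp: abs_mult mult_left_le_one_le)
  finally show ?thesis .
qed

lemma sin_transform_bound1:
  assumes f: "integrable lborel f" and yf: "integrable lborel (\<lambda>y. y * f y)"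
    and z: "\<And>y. y < 0 \<Longrightarrow> f y = 0"
  shows "\<bar>sin_transform f \<xi>\<bar> \<le> \<bar>\<xi>\<bar> * (LINT y|lborel. y * \<bar>f y\<bar>)"
proof -
  have i: "integrable lborel (\<lambda>y. y * \<bar>f y\<bar>)"
  proof -
    have "(\<lambda>y. y * \<bar>f y\<bar>) = (\<lambda>y. \<bar>y * f y\<bar>)"
    proof
      fix y show "y * \<bar>f y\<bar> = \<bar>y * f y\<bar>" using z[of y] by (cases "y < 0") (auto simp: abs_mult)
    qed
    then show ?thesis using integrable_abs[OF yf] by simp
  qed
  have "\<bar>sin_transform f \<xi>\<bar> \<le> (LINT y|lborel. \<bar>sin (\<xi> * y) * f y\<bar>)"
    unfolding sin_transform_def by (rule integral_abs_bound)
  also have "\<dots> \<le> (LINT y|lborel. \<bar>\<xi>\<bar> * (y * \<bar>f y\<bar>))"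
  proof (intro integral_mono integrable_abs sin_mult_integrable f integrable_mult_right i)
    fix y
    show "\<bar>sin (\<xi> * y) * f y\<bar> \<le> \<bar>\<xi>\<bar> * (y * \<bar>f y\<bar>)"
    proof (cases "y < 0")
      case False
      have "\<bar>sin (\<xi> * y)\<bar> * \<bar>f y\<bar> \<le> \<bar>\<xi> * y\<bar> * \<bar>f y\<bar>" by (intro mult_right_mono abs_sin_x_le_abs_x) auto
      then show ?thesis using False by (simp add: abs_mult mult.assoc)
    qed (simp add: z)
  qed
  finally show ?thesis by simp
qed

text \<open>The remainder of the sine is taken quadratic, not cubic, because only second moments of
  the data are available.\<close>

lemma sin_transform_bound2:
  assumes f: "integrable lborel f" and yf: "integrable lborel (\<lambda>y. y * f y)"
    and yyf: "integrable lborel (\<lambda>y. y\<^sup>2 * f y)"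
  shows "\<bar>sin_transform f \<xi> - \<xi> * (LINT y|lborel. y * f y)\<bar> \<le> \<xi>\<^sup>2 * (LINT y|lborel. y\<^sup>2 * \<bar>f y\<bar>)"
proof -
  have i: "integrable lborel (\<lambda>y. y\<^sup>2 * \<bar>f y\<bar>)"
    using integrable_abs[OF yyf] by (simp add: abs_mult)
  have eq: "sin_transform f \<xi> - \<xi> * (LINT y|lborel. y * f y) = (LINT y|lborel. sin (\<xi> * y) * f y - \<xi> * (y * f y))"
    unfolding sin_transform_def using sin_mult_integrable[OF f] yf by simp
  have "\<bar>sin_transform f \<xi> - \<xi> * (LINT y|lborel. y * f y)\<bar> \<le> (LINT y|lborel. \<bar>sin (\<xi> * y) * f y - \<xi> * (y * f y)\<bar>)"
    unfolding eq by (rule integral_abs_bound)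
  also have "\<dots> \<le> (LINT y|lborel. \<xi>\<^sup>2 * (y\<^sup>2 * \<bar>f y\<bar>))"
  proof (intro integral_mono integrable_abs Bochner_Integration.integrable_diff sin_mult_integrable f integrable_mult_right yf i)
    fix y
    have "\<bar>sin (\<xi> * y) - \<xi> * y\<bar> * \<bar>f y\<bar> \<le> (\<xi> * y)\<^sup>2 * \<bar>f y\<bar>"
      by (intro mult_right_mono abs_sin_minus_le) auto
    then show "\<bar>sin (\<xi> * y) * f y - \<xi> * (y * f y)\<bar> \<le> \<xi>\<^sup>2 * (y\<^sup>2 * \<bar>f y\<bar>)"
      by (simp add: power_mult_distrib mult.assoc left_diff_distrib flip: abs_mult)
  qed
  finally show ?thesis by simp
qed

context kernel begin

definition K :: "(real \<Rightarrow> real) \<Rightarrow> real \<Rightarrow> real" where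
  "K f x = (if x < 0 then 0 else (LINT y|lborel. J (x - y) * f y))"

text \<open>Acting on functions supported in the half line, \<open>K_odd\<close> is convolution of the odd
  extension with \<open>J\<close>.\<close>

definition K_odd :: "(real \<Rightarrow> real) \<Rightarrow> real \<Rightarrow> real" where
  "K_odd f x = (if x < 0 then 0 else (LINT y|lborel. (J (x - y) - J (x + y)) * f y))"

lemma J_reflect_int: "integrable lborel (\<lambda>y. J (x - y))" and J_shift_int: "integrable lborel (\<lambda>y. J (x + y))"
  using lborel_integrable_reflect[OF J_int, of x] lborel_integrable_shift[OF J_int, of x] by (simp_all add: add.commute)

text \<open>Substituting -y in the part with J(x + y) turns it into the missing integral over
  negative y, its sign being absorbed by the odd sine; \<open>J_shift_sin\<close> then
  applies.\<close>

lemma J_half_sin: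
  "(LINT y|lborel. indicator {0..} y * (J (x - y) - J (x + y)) * sin (\<xi> * y)) = Jh \<xi> * sin (\<xi> * x)"
proof -
  have i1: "integrable lborel (\<lambda>y. indicator {0..} y * J (x - y) * sin (\<xi> * y))"
    by (rule Bochner_Integration.integrable_bound[OF J_reflect_int[of x]])
       (use J_nonneg in \<open>auto simp: abs_mult indicator_def mult_left_le\<close>)
  have i3: "integrable lborel (\<lambda>y. indicator {..0} y * J (x - y) * sin (\<xi> * y))"
    by (rule Bochner_Integration.integrable_bound[OF J_reflect_int[of x]])
       (use J_nonneg in \<open>auto simp: abs_mult indicator_def mult_left_le\<close>)
  have i2: "integrable lborel (\<lambda>y. indicator {0..} y * J (x + y) * sin (\<xi> * y))"
    by (rule Bochner_Integration.integrable_bound[OF J_shift_int[of x]])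
       (use J_nonneg in \<open>auto simp: abs_mult indicator_def mult_left_le\<close>)
  have "(LINT y|lborel. indicator {0..} y * J (x + y) * sin (\<xi> * y))
      = (LINT y|lborel. indicator {0..} (0 - y) * J (x + (0 - y)) * sin (\<xi> * (0 - y)))"
    by (rule lborel_integral_reflect[symmetric])
  also have "\<dots> = - (LINT y|lborel. indicator {..0} y * J (x - y) * sin (\<xi> * y))"
    by (simp add: indicator_def flip: integral_minus)
  finally have r: "(LINT y|lborel. indicator {0..} y * J (x + y) * sin (\<xi> * y))
    = - (LINT y|lborel. indicator {..0} y * J (x - y) * sin (\<xi> * y))" .
  have "(LINT y|lborel. indicator {0..} y * (J (x - y) - J (x + y)) * sin (\<xi> * y))
      = (LINT y|lborel. indicator {0..} y * J (x - y) * sin (\<xi> * y) - indicator {0..} y * J (x + y) * sin (\<xi> * y))"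
    by (simp add: algebra_simps)
  also have "\<dots> = (LINT y|lborel. indicator {0..} y * J (x - y) * sin (\<xi> * y))
      + (LINT y|lborel. indicator {..0} y * J (x - y) * sin (\<xi> * y))"
    using i1 i2 by (simp add: r)
  also have "\<dots> = (LINT y|lborel. indicator {0..} y * J (x - y) * sin (\<xi> * y) + indicator {..0} y * J (x - y) * sin (\<xi> * y))"
    using i1 i3 by simp
  also have "\<dots> = (LINT y|lborel. J (x - y) * sin (\<xi> * y))"
    by (intro Bochner_Integration.integral_cong refl) (auto simp: indicator_def)
  finally show ?thesis by (simp add: J_shift_sin)
qed

lemma Jh_abs_int: "integrable lborel (\<lambda>\<xi>. \<bar>Jh \<xi>\<bar>)"
  using integrable_abs[OF Jh_mult_int[of "\<lambda>\<xi>. 1" 1]] by simp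

text \<open>Only positive powers have this form: at least one factor \<open>Jh\<close> is needed for
  the frequency integral to converge absolutely, whereas the zeroth power would be sine inversion of
  an arbitrary integrable datum.\<close>

lemma K_odd_pow:
  assumes f: "integrable lborel f" and z: "\<And>y. y < 0 \<Longrightarrow> f y = 0" and x: "x \<ge> 0"
  shows "(K_odd ^^ Suc n) f x = (LINT \<xi>|lborel. Jh \<xi> ^ Suc n * (sin (\<xi> * x) * sin_transform f \<xi>)) / pi"
  using x
proof (induction n arbitrary: x)
  have [measurable]: "f \<in> borel_measurable borel" using borel_measurable_integrable[OF f] by simp
  case 0
  have "(K_odd ^^ Suc 0) f x = (LINT y|lborel. LINT \<xi>|lborel. Jh \<xi> * (sin (\<xi> * x) * sin (\<xi> * y)) * f y) / pi"
    using 0 by (simp add: K_odd_def J_odd_kernel)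
  also have "(LINT y|lborel. LINT \<xi>|lborel. Jh \<xi> * (sin (\<xi> * x) * sin (\<xi> * y)) * f y)
      = (LINT \<xi>|lborel. LINT y|lborel. Jh \<xi> * (sin (\<xi> * x) * sin (\<xi> * y)) * f y)"
  proof (rule lborel_Fubini_bound[OF _ Jh_abs_int integrable_abs[OF f]])
    fix \<xi> y
    have "\<bar>sin (\<xi> * x)\<bar> * \<bar>sin (\<xi> * y)\<bar> \<le> 1" by (intro mult_le_one) auto
    then have "\<bar>Jh \<xi>\<bar> * (\<bar>sin (\<xi> * x)\<bar> * \<bar>sin (\<xi> * y)\<bar>) * \<bar>f y\<bar> \<le> \<bar>Jh \<xi>\<bar> * 1 * \<bar>f y\<bar>"
      by (intro mult_right_mono mult_left_mono) auto
    then show "\<bar>Jh \<xi> * (sin (\<xi> * x) * sin (\<xi> * y)) * f y\<bar> \<le> \<bar>Jh \<xi>\<bar> * \<bar>f y\<bar>" by (simp add: abs_mult)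
  qed measurable
  finally show ?case by (simp add: sin_transform_def mult.assoc)
next
  have [measurable]: "f \<in> borel_measurable borel" using borel_measurable_integrable[OF f] by simp
  case (Suc n)
  define N where "N = (LINT y|lborel. \<bar>f y\<bar>)"
  let ?F = "sin_transform f"
  \<comment> \<open>The induction hypothesis holds only for nonnegative arguments; the indicator
    records that the previous iterate vanishes elsewhere, so that its sine formula can be inserted
    for every y.\<close>
  let ?k = "\<lambda>y. indicator {0..} y * (J (x - y) - J (x + y))"
  have g0: "(K_odd ^^ Suc n) f y = 0" if "y < 0" for y using that by (simp add: K_odd_def)
  have "(K_odd ^^ Suc (Suc n)) f x = (LINT y|lborel. (J (x - y) - J (x + y)) * (K_odd ^^ Suc n) f y)"
    using Suc.prems by (simp add: K_odd_def)
  also have "\<dots> = (LINT y|lborel. LINT \<xi>|lborel. ?k y * (Jh \<xi> ^ Suc n * (sin (\<xi> * y) * ?F \<xi>)) / pi)"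
    by (intro Bochner_Integration.integral_cong refl)
       (auto simp: Suc.IH g0 indicator_def not_le simp del: funpow.simps power_Suc)
  also have "\<dots> = (LINT \<xi>|lborel. LINT y|lborel. ?k y * (Jh \<xi> ^ Suc n * (sin (\<xi> * y) * ?F \<xi>)) / pi)"
  proof (rule lborel_Fubini_bound[where a = "\<lambda>\<xi>. N / pi * \<bar>Jh \<xi>\<bar>" and b = "\<lambda>y. J (x - y) + J (x + y)"])
    fix \<xi> y
    have a1: "\<bar>?k y\<bar> \<le> J (x - y) + J (x + y)"
      using J_nonneg[of "x - y"] J_nonneg[of "x + y"] by (auto simp: indicator_def)
    have a2: "\<bar>Jh \<xi> ^ Suc n\<bar> \<le> \<bar>Jh \<xi>\<bar>"
      using Jh_le1[of \<xi>] power_le_one[of "\<bar>Jh \<xi>\<bar>" n] by (simp add: abs_mult power_abs mult_left_le)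
    have a3: "\<bar>sin (\<xi> * y)\<bar> * \<bar>?F \<xi>\<bar> \<le> 1 * N"
      unfolding N_def by (intro mult_mono sin_transform_bound f) auto
    have "\<bar>Jh \<xi> ^ Suc n\<bar> * (\<bar>sin (\<xi> * y)\<bar> * \<bar>?F \<xi>\<bar>) \<le> \<bar>Jh \<xi>\<bar> * (1 * N)"
      by (rule mult_mono[OF a2 a3]) auto
    then have "\<bar>?k y\<bar> * (\<bar>Jh \<xi> ^ Suc n\<bar> * (\<bar>sin (\<xi> * y)\<bar> * \<bar>?F \<xi>\<bar>)) \<le> (J (x - y) + J (x + y)) * (\<bar>Jh \<xi>\<bar> * (1 * N))"
      by (rule mult_mono[OF a1]) (auto intro!: add_nonneg_nonneg J_nonneg)
    then have "\<bar>?k y\<bar> * (\<bar>Jh \<xi> ^ Suc n\<bar> * (\<bar>sin (\<xi> * y)\<bar> * \<bar>?F \<xi>\<bar>)) / pi \<le> (J (x - y) + J (x + y)) * (\<bar>Jh \<xi>\<bar> * (1 * N)) / pi"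
      by (intro divide_right_mono) auto
    then show "\<bar>?k y * (Jh \<xi> ^ Suc n * (sin (\<xi> * y) * ?F \<xi>)) / pi\<bar> \<le> N / pi * \<bar>Jh \<xi>\<bar> * (J (x - y) + J (x + y))"
      by (simp only: abs_mult abs_divide) (simp add: mult_ac)
  next
    show "integrable lborel (\<lambda>y. J (x - y) + J (x + y))"
      by (intro Bochner_Integration.integrable_add J_reflect_int J_shift_int)
    show "integrable lborel (\<lambda>\<xi>. N / pi * \<bar>Jh \<xi>\<bar>)" by (intro integrable_mult_right Jh_abs_int)
  qed measurable
  also have "\<dots> = (LINT \<xi>|lborel. Jh \<xi> ^ Suc n * ?F \<xi> / pi * (LINT y|lborel. ?k y * sin (\<xi> * y)))"
    by (intro Bochner_Integration.integral_cong refl)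
       (simp add: mult_ac flip: integral_mult_right_zero)
  also have "\<dots> = (LINT \<xi>|lborel. Jh \<xi> ^ Suc (Suc n) * (sin (\<xi> * x) * ?F \<xi>) / pi)"
    unfolding J_half_sin by (simp add: mult_ac)
  finally show ?case by simp
qed

text \<open>The zeroth term is kept as \<open>exp (- t) * f x\<close>; the positive powers of
  \<open>Jh\<close> sum to exp(t (Jh - 1)) - exp(-t), which is \<open>rsym\<close>. Domination by
  |Jh| times Poisson weights permits summation under the integral.\<close>

lemma K_odd_exp_sums:
  assumes f: "integrable lborel f" and z: "\<And>y. y < 0 \<Longrightarrow> f y = 0" and x: "x \<ge> 0" and t: "t \<ge> 0"
  shows "(\<lambda>n. poisson_weight t n * (K_odd ^^ n) f x) sums
    (exp (- t) * f x + (LINT \<xi>|lborel. rsym t \<xi> * (sin (\<xi> * x) * sin_transform f \<xi>)) / pi)"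
proof -
  have [measurable]: "f \<in> borel_measurable borel" using borel_measurable_integrable[OF f] by simp
  let ?F = "sin_transform f"
  define N where "N = (LINT y|lborel. \<bar>f y\<bar>)"
  let ?h = "\<lambda>n \<xi>. poisson_weight t (Suc n) * (Jh \<xi> ^ Suc n * (sin (\<xi> * x) * ?F \<xi>)) / pi"
  have sn: "\<bar>sin (\<xi> * x) * ?F \<xi>\<bar> \<le> N" for \<xi>
  proof -
    have "\<bar>sin (\<xi> * x)\<bar> * \<bar>?F \<xi>\<bar> \<le> 1 * N" unfolding N_def by (intro mult_mono sin_transform_bound f) auto
    then show ?thesis by (simp add: abs_mult)
  qed
  have N: "N \<ge> 0" using sn[of 0] by simp
  have pow: "\<bar>Jh \<xi> ^ Suc n\<bar> \<le> \<bar>Jh \<xi>\<bar>" for n \<xi>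
    using Jh_le1[of \<xi>] power_le_one[of "\<bar>Jh \<xi>\<bar>" n] by (simp add: abs_mult power_abs mult_left_le)
  have hb: "norm (?h n \<xi>) \<le> poisson_weight t (Suc n) * (\<bar>Jh \<xi>\<bar> * N / pi)" for n \<xi>
  proof -
    have "\<bar>Jh \<xi> ^ Suc n\<bar> * \<bar>sin (\<xi> * x) * ?F \<xi>\<bar> \<le> \<bar>Jh \<xi>\<bar> * N"
      by (intro mult_mono pow sn) auto
    then have "poisson_weight t (Suc n) * (\<bar>Jh \<xi> ^ Suc n\<bar> * \<bar>sin (\<xi> * x) * ?F \<xi>\<bar>) / pi \<le> poisson_weight t (Suc n) * (\<bar>Jh \<xi>\<bar> * N) / pi"
      using poisson_weight_nonneg[OF t] by (intro divide_right_mono mult_left_mono) auto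
    then show ?thesis using poisson_weight_nonneg[OF t, of "Suc n"] by (simp only: real_norm_def abs_mult abs_divide) (simp add: mult_ac)
  qed
  have sp: "summable (\<lambda>n. poisson_weight t (Suc n))"
    using poisson_weight_sums[of t] by (subst summable_Suc_iff) (rule sums_summable)
  have bi: "integrable lborel (\<lambda>\<xi>. \<bar>Jh \<xi>\<bar> * N / pi)"
    using integrable_mult_right[OF Jh_abs_int, of "N / pi"] by (simp add: mult.commute)
  have hi: "integrable lborel (?h n)" for n
    by (rule Bochner_Integration.integrable_bound[OF integrable_mult_right[OF bi, of "poisson_weight t (Suc n)"]])
       (use hb[of n] N poisson_weight_nonneg[OF t, of "Suc n"] in \<open>auto simp: abs_mult\<close>)
  have "(\<lambda>n. integral\<^sup>L lborel (?h n)) sums (LINT \<xi>|lborel. (\<Sum>n. ?h n \<xi>))"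
  proof (rule sums_integral[OF hi])
    show "AE \<xi> in lborel. summable (\<lambda>n. norm (?h n \<xi>))"
    proof (rule AE_I2, rule summable_comparison_test')
      fix \<xi> show "summable (\<lambda>n. poisson_weight t (Suc n) * (\<bar>Jh \<xi>\<bar> * N / pi))" by (intro summable_mult2 sp)
      fix n show "norm (norm (?h n \<xi>)) \<le> poisson_weight t (Suc n) * (\<bar>Jh \<xi>\<bar> * N / pi)"
        using hb[of n \<xi>] by simp
    qed
    show "summable (\<lambda>n. LINT \<xi>|lborel. norm (?h n \<xi>))"
    proof (rule summable_comparison_test'[OF summable_mult2[OF sp, of "LINT \<xi>|lborel. \<bar>Jh \<xi>\<bar> * N / pi"]])
      fix n
      have "(LINT \<xi>|lborel. norm (?h n \<xi>)) \<le> (LINT \<xi>|lborel. poisson_weight t (Suc n) * (\<bar>Jh \<xi>\<bar> * N / pi))"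
        by (intro integral_mono integrable_norm hi integrable_mult_right bi hb)
      then show "norm (LINT \<xi>|lborel. norm (?h n \<xi>)) \<le> poisson_weight t (Suc n) * (LINT \<xi>|lborel. \<bar>Jh \<xi>\<bar> * N / pi)"
        by (simp only: integral_mult_right_zero real_norm_def) (simp add: abs_of_nonneg)
    qed
  qed
  also have "(\<lambda>n. integral\<^sup>L lborel (?h n)) = (\<lambda>n. poisson_weight t (Suc n) * (K_odd ^^ Suc n) f x)"
    by (rule ext, subst K_odd_pow[OF f z x]) (simp_all add: mult.assoc del: power_Suc funpow.simps)
  also have "(LINT \<xi>|lborel. (\<Sum>n. ?h n \<xi>)) = (LINT \<xi>|lborel. rsym t \<xi> * (sin (\<xi> * x) * ?F \<xi>) / pi)"
  proof (intro Bochner_Integration.integral_cong refl)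
    fix \<xi>
    have "(\<lambda>n. poisson_weight t (Suc n) * Jh \<xi> ^ Suc n) sums (exp (t * (Jh \<xi> - 1)) - poisson_weight t 0 * Jh \<xi> ^ 0)"
      using poisson_weight_power_sums[of t "Jh \<xi>"] by (subst sums_Suc_iff) simp
    then have "(\<lambda>n. poisson_weight t (Suc n) * Jh \<xi> ^ Suc n) sums rsym t \<xi>"
      by (simp add: rsym_def poisson_weight_def)
    then have "(\<lambda>n. poisson_weight t (Suc n) * Jh \<xi> ^ Suc n * (sin (\<xi> * x) * ?F \<xi> / pi)) sums (rsym t \<xi> * (sin (\<xi> * x) * ?F \<xi> / pi))"
      by (rule sums_mult2)
    then show "(\<Sum>n. ?h n \<xi>) = rsym t \<xi> * (sin (\<xi> * x) * ?F \<xi>) / pi"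
      by (simp add: mult.assoc sums_iff del: power_Suc)
  qed
  finally have "(\<lambda>n. poisson_weight t (Suc n) * (K_odd ^^ Suc n) f x) sums ((LINT \<xi>|lborel. rsym t \<xi> * (sin (\<xi> * x) * ?F \<xi>)) / pi)"
    by (simp del: funpow.simps)
  then have "(\<lambda>n. poisson_weight t n * (K_odd ^^ n) f x) sums ((LINT \<xi>|lborel. rsym t \<xi> * (sin (\<xi> * x) * ?F \<xi>)) / pi + poisson_weight t 0 * (K_odd ^^ 0) f x)"
    by (rule sums_Suc)
  then show ?thesis by (simp add: poisson_weight_def add.commute)
qed

text \<open>\<open>W x s\<close> is \<open>-2 D\<^sub>q(x,s)\<close>, see \<open>dipole_eq_W\<close> below.\<close>

definition W :: "real \<Rightarrow> real \<Rightarrow> real" where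
  "W x s = (LINT \<xi>|lborel. exp (- (q * s * \<xi>\<^sup>2)) * (\<xi> * sin (\<xi> * x))) / pi"

lemma W_eq:
  assumes "s > 0"
  shows "W x s = x / (2 * (q * s)) * (sqrt (pi / (q * s)) * exp (- (x\<^sup>2 / (4 * (q * s))))) / pi"
  unfolding W_def using assms q_pos by (subst gauss_sin) auto

lemma W_int: assumes "s > 0" shows "integrable lborel (\<lambda>\<xi>. exp (- (q * s * \<xi>\<^sup>2)) * (\<xi> * sin (\<xi> * x)))"
  by (rule gauss_mult_int[where C=1 and k=1]) (use assms q_pos in \<open>auto simp: abs_mult mult_left_le\<close>)

lemma sin_le_mult: "(x::real) \<ge> 0 \<Longrightarrow> \<bar>sin (\<xi> * x)\<bar> \<le> \<bar>\<xi>\<bar> * x"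
  using abs_sin_x_le_abs_x[of "\<xi> * x"] by (simp add: abs_mult)

lemma rsym_sin_int:
  assumes f: "integrable lborel f" and s: "s \<ge> 0"
  shows "integrable lborel (\<lambda>\<xi>. rsym s \<xi> * (sin (\<xi> * x) * sin_transform f \<xi>))"
proof (rule rsym_mult_int[OF s, where C = "LINT y|lborel. \<bar>f y\<bar>"])
  have [measurable]: "f \<in> borel_measurable borel" using borel_measurable_integrable[OF f] by simp
  show "(\<lambda>\<xi>. sin (\<xi> * x) * sin_transform f \<xi>) \<in> borel_measurable borel" by measurable
  fix \<xi>
  have "\<bar>sin (\<xi> * x)\<bar> * \<bar>sin_transform f \<xi>\<bar> \<le> 1 * (LINT y|lborel. \<bar>f y\<bar>)"
    by (intro mult_mono sin_transform_bound f) auto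
  also have "\<dots> \<le> (LINT y|lborel. \<bar>f y\<bar>) * (1 + \<xi>\<^sup>2)"
    using mult_left_mono[of 1 "1 + \<xi>\<^sup>2" "LINT y|lborel. \<bar>f y\<bar>"] by simp
  finally show "\<bar>sin (\<xi> * x) * sin_transform f \<xi>\<bar> \<le> (LINT y|lborel. \<bar>f y\<bar>) * (1 + \<xi>\<^sup>2)" by (simp add: abs_mult)
qed

lemma odd_evolution_bound:
  assumes f: "integrable lborel f" "integrable lborel (\<lambda>y. y * f y)" "\<And>y. y < 0 \<Longrightarrow> f y = 0"
    and s: "s > 0" and x: "x \<ge> 0"
  shows "\<bar>(LINT \<xi>|lborel. rsym s \<xi> * (sin (\<xi> * x) * sin_transform f \<xi>)) / pi\<bar>
    \<le> x * (LINT y|lborel. y * \<bar>f y\<bar>) * sym_norm s / pi"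
proof -
  let ?m = "LINT y|lborel. y * \<bar>f y\<bar>"
  have "\<bar>LINT \<xi>|lborel. rsym s \<xi> * (sin (\<xi> * x) * sin_transform f \<xi>)\<bar>
      \<le> (LINT \<xi>|lborel. \<bar>rsym s \<xi> * (sin (\<xi> * x) * sin_transform f \<xi>)\<bar>)" by (rule integral_abs_bound)
  also have "\<dots> \<le> (LINT \<xi>|lborel. x * ?m * (\<xi>\<^sup>2 * \<bar>rsym s \<xi>\<bar>))"
  proof (intro integral_mono integrable_abs rsym_sin_int f integrable_mult_right rsym_sq_int)
    fix \<xi>
    have "\<bar>rsym s \<xi>\<bar> * (\<bar>sin (\<xi> * x)\<bar> * \<bar>sin_transform f \<xi>\<bar>) \<le> \<bar>rsym s \<xi>\<bar> * ((\<bar>\<xi>\<bar> * x) * (\<bar>\<xi>\<bar> * ?m))"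
      by (intro mult_left_mono mult_mono sin_le_mult sin_transform_bound1 f x) (use x in auto)
    also have "\<dots> = x * ?m * (\<bar>\<xi>\<bar>\<^sup>2 * \<bar>rsym s \<xi>\<bar>)" unfolding power2_eq_square by (simp only: mult_ac)
    finally show "\<bar>rsym s \<xi> * (sin (\<xi> * x) * sin_transform f \<xi>)\<bar> \<le> x * ?m * (\<xi>\<^sup>2 * \<bar>rsym s \<xi>\<bar>)"
      by (simp add: abs_mult)
  qed (use s in auto)
  also have "\<dots> = x * ?m * sym_norm s" by (simp add: sym_norm_def)
  finally have "\<bar>LINT \<xi>|lborel. rsym s \<xi> * (sin (\<xi> * x) * sin_transform f \<xi>)\<bar> / pi \<le> x * ?m * sym_norm s / pi"
    by (intro divide_right_mono) auto
  then show ?thesis by (simp add: abs_divide)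
qed

text \<open>Two replacements: the symbol by the Gaussian, measured by \<open>sym_err\<close>, and
  the sine transform by its linear part, which costs x |\<xi>| times \<xi>^2 and hence a third
  Gaussian moment of order s^(-2). Both are o(s^(-3/2)).\<close>

lemma odd_evolution_asymp:
  assumes f: "integrable lborel f" "integrable lborel (\<lambda>y. y * f y)" "integrable lborel (\<lambda>y. y\<^sup>2 * f y)"
      "\<And>y. y < 0 \<Longrightarrow> f y = 0"
    and s: "s > 0" and x: "x \<ge> 0"
  shows "\<bar>(LINT \<xi>|lborel. rsym s \<xi> * (sin (\<xi> * x) * sin_transform f \<xi>)) / pi - W x s * (LINT y|lborel. y * f y)\<bar>
    \<le> x * ((LINT y|lborel. y * \<bar>f y\<bar>) * sym_err s + (LINT y|lborel. y\<^sup>2 * \<bar>f y\<bar>) * (gauss_moment 3 * (q * s) powr (- 2))) / pi"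
proof -
  let ?m = "LINT y|lborel. y * \<bar>f y\<bar>" and ?m2 = "LINT y|lborel. y\<^sup>2 * \<bar>f y\<bar>" and ?m1 = "LINT y|lborel. y * f y"
  let ?e = "\<lambda>\<xi>. exp (- (q * s * \<xi>\<^sup>2))"
  let ?F = "sin_transform f"
  let ?D = "\<lambda>\<xi>. rsym s \<xi> * (sin (\<xi> * x) * ?F \<xi>) - ?m1 * (?e \<xi> * (\<xi> * sin (\<xi> * x)))"
  have i: "integrable lborel (\<lambda>\<xi>. rsym s \<xi> * (sin (\<xi> * x) * ?F \<xi>))"
    "integrable lborel (\<lambda>\<xi>. ?m1 * (?e \<xi> * (\<xi> * sin (\<xi> * x))))"
    using s by (auto intro!: rsym_sin_int f W_int)
  have D: "(LINT \<xi>|lborel. rsym s \<xi> * (sin (\<xi> * x) * ?F \<xi>)) - pi * W x s * ?m1 = (LINT \<xi>|lborel. ?D \<xi>)"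
    using i by (simp add: W_def)
  have "\<bar>LINT \<xi>|lborel. ?D \<xi>\<bar> \<le> (LINT \<xi>|lborel. \<bar>?D \<xi>\<bar>)" by (rule integral_abs_bound)
  also have "\<dots> \<le> (LINT \<xi>|lborel. x * ?m * (\<xi>\<^sup>2 * \<bar>rsym s \<xi> - ?e \<xi>\<bar>) + x * ?m2 * (\<bar>\<xi>\<bar> ^ 3 * ?e \<xi>))"
  proof (intro integral_mono integrable_abs Bochner_Integration.integrable_diff i Bochner_Integration.integrable_add
      integrable_mult_right sym_err_int gauss_q_int s)
    fix \<xi>
    have eq: "?D \<xi> = (rsym s \<xi> - ?e \<xi>) * (sin (\<xi> * x) * ?F \<xi>) + ?e \<xi> * (sin (\<xi> * x) * (?F \<xi> - \<xi> * ?m1))"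
      by (simp add: algebra_simps)
    have "\<bar>?D \<xi>\<bar> \<le> \<bar>rsym s \<xi> - ?e \<xi>\<bar> * (\<bar>sin (\<xi> * x)\<bar> * \<bar>?F \<xi>\<bar>) + ?e \<xi> * (\<bar>sin (\<xi> * x)\<bar> * \<bar>?F \<xi> - \<xi> * ?m1\<bar>)"
      unfolding eq by (rule order_trans[OF abs_triangle_ineq]) (simp add: abs_mult)
    also have "\<dots> \<le> \<bar>rsym s \<xi> - ?e \<xi>\<bar> * ((\<bar>\<xi>\<bar> * x) * (\<bar>\<xi>\<bar> * ?m)) + ?e \<xi> * ((\<bar>\<xi>\<bar> * x) * (\<xi>\<^sup>2 * ?m2))"
      by (intro add_mono mult_left_mono mult_mono sin_le_mult sin_transform_bound1 sin_transform_bound2 f x) (use x in auto)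
    also have "\<dots> = x * ?m * (\<bar>\<xi>\<bar>\<^sup>2 * \<bar>rsym s \<xi> - ?e \<xi>\<bar>) + x * ?m2 * (\<bar>\<xi>\<bar> * \<bar>\<xi>\<bar>\<^sup>2 * ?e \<xi>)"
      unfolding power2_eq_square by (simp add: mult_ac)
    finally show "\<bar>?D \<xi>\<bar> \<le> x * ?m * (\<xi>\<^sup>2 * \<bar>rsym s \<xi> - ?e \<xi>\<bar>) + x * ?m2 * (\<bar>\<xi>\<bar> ^ 3 * ?e \<xi>)"
      by (simp add: power3_eq_cube power2_eq_square mult.assoc)
  qed
  also have "\<dots> = x * ?m * sym_err s + x * ?m2 * (gauss_moment 3 * (q * s) powr (- 2))"
    using s by (subst Bochner_Integration.integral_add)
      (auto intro!: sym_err_int gauss_q_int integrable_mult_right simp: sym_err_def gauss_q_cube)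
  finally have "\<bar>LINT \<xi>|lborel. ?D \<xi>\<bar> / pi \<le> x * (?m * sym_err s + ?m2 * (gauss_moment 3 * (q * s) powr (- 2))) / pi"
    by (intro divide_right_mono) (auto simp: algebra_simps)
  moreover have "(LINT \<xi>|lborel. rsym s \<xi> * (sin (\<xi> * x) * ?F \<xi>)) / pi - W x s * ?m1 = (LINT \<xi>|lborel. ?D \<xi>) / pi"
    using D by (simp add: field_simps)
  ultimately show ?thesis by (simp only: abs_divide) simp
qed

end

subsection \<open>The half-line operator in weighted spaces\<close>

text \<open>Vanishing is required at every negative point and measurability is Borel, so that the
  kernel comparisons below are pointwise inequalities free of null sets.\<close>

definition half_line_fun :: "(real \<Rightarrow> real) \<Rightarrow> bool" where
  "half_line_fun f \<longleftrightarrow> f \<in> borel_measurable borel \<and> (\<forall>x<0. f x = 0)"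

lemma half_line_fun_meas: "half_line_fun f \<Longrightarrow> f \<in> borel_measurable borel"
  and half_line_fun_neg: "half_line_fun f \<Longrightarrow> x < 0 \<Longrightarrow> f x = 0"
  by (auto simp: half_line_fun_def)

context kernel begin

lemma K_meas [measurable]:
  assumes [measurable]: "f \<in> borel_measurable borel" shows "K f \<in> borel_measurable borel"
  unfolding K_def by measurable

lemma K_odd_meas [measurable]:
  assumes [measurable]: "f \<in> borel_measurable borel" shows "K_odd f \<in> borel_measurable borel"
  unfolding K_odd_def by measurable

lemma K_half_line: "half_line_fun f \<Longrightarrow> half_line_fun (K f)"
  and K_odd_half_line: "half_line_fun f \<Longrightarrow> half_line_fun (K_odd f)"
  by (auto simp: half_line_fun_def K_meas K_odd_meas) (simp_all add: K_def K_odd_def)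

lemma K_pow_half_line: "half_line_fun f \<Longrightarrow> half_line_fun ((K ^^ n) f)"
  and K_odd_pow_half_line: "half_line_fun f \<Longrightarrow> half_line_fun ((K_odd ^^ n) f)"
  by (induction n) (auto intro: K_half_line K_odd_half_line)

lemma J_reflect_mult_int:
  assumes [measurable]: "f \<in> borel_measurable borel" and b: "\<And>x. \<bar>f x\<bar> \<le> C"
  shows "integrable lborel (\<lambda>y. J (x - y) * f y)"
proof (rule Bochner_Integration.integrable_bound[OF integrable_mult_right[OF J_reflect_int[of x], of C]])
  show "AE y in lborel. norm (J (x - y) * f y) \<le> norm (C * J (x - y))"
  proof (rule AE_I2)
    fix y
    have "\<bar>f y\<bar> * J (x - y) \<le> \<bar>C\<bar> * J (x - y)"
      by (intro mult_right_mono order_trans[OF b abs_ge_self] J_nonneg)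
    then show "norm (J (x - y) * f y) \<le> norm (C * J (x - y))"
      using J_nonneg by (simp add: abs_mult mult.commute)
  qed
qed measurable

lemma J_shift_mult_int:
  assumes [measurable]: "f \<in> borel_measurable borel" and b: "\<And>x. \<bar>f x\<bar> \<le> C"
  shows "integrable lborel (\<lambda>y. J (x + y) * f y)"
proof (rule Bochner_Integration.integrable_bound[OF integrable_mult_right[OF J_shift_int[of x], of C]])
  show "AE y in lborel. norm (J (x + y) * f y) \<le> norm (C * J (x + y))"
  proof (rule AE_I2)
    fix y
    have "\<bar>f y\<bar> * J (x + y) \<le> \<bar>C\<bar> * J (x + y)"
      by (intro mult_right_mono order_trans[OF b abs_ge_self] J_nonneg)
    then show "norm (J (x + y) * f y) \<le> norm (C * J (x + y))"
      using J_nonneg by (simp add: abs_mult mult.commute)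
  qed
qed measurable

lemma J_odd_mult_int:
  assumes "f \<in> borel_measurable borel" and "\<And>x. \<bar>f x\<bar> \<le> C"
  shows "integrable lborel (\<lambda>y. (J (x - y) - J (x + y)) * f y)"
  using J_reflect_mult_int[OF assms, of x] J_shift_mult_int[OF assms, of x] by (simp add: left_diff_distrib)

lemma J_reflect_int1: "(LINT y|lborel. J (x - y)) = 1"
  using lborel_integral_reflect[of J x] by (simp add: J_int1)

lemma K_bdd:
  assumes f: "f \<in> borel_measurable borel" and b: "\<And>x. \<bar>f x\<bar> \<le> C" shows "\<bar>K f x\<bar> \<le> C"
proof (cases "x < 0")
  case True then show ?thesis using order_trans[OF abs_ge_zero b] by (simp add: K_def)
next
  case False
  have "\<bar>LINT y|lborel. J (x - y) * f y\<bar> \<le> (LINT y|lborel. \<bar>J (x - y) * f y\<bar>)" by (rule integral_abs_bound)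
  also have "\<dots> \<le> (LINT y|lborel. C * J (x - y))"
  proof (intro integral_mono integrable_abs J_reflect_mult_int[OF f b] integrable_mult_right J_reflect_int)
    fix y
    have "\<bar>f y\<bar> * J (x - y) \<le> C * J (x - y)" by (intro mult_right_mono b J_nonneg)
    then show "\<bar>J (x - y) * f y\<bar> \<le> C * J (x - y)"
      using J_nonneg by (simp add: abs_mult mult.commute)
  qed
  finally show ?thesis using False by (simp add: K_def J_reflect_int1)
qed

lemma K_pow_bdd:
  assumes f: "half_line_fun f" and b: "\<And>x. \<bar>f x\<bar> \<le> C" shows "\<bar>(K ^^ n) f x\<bar> \<le> C"
proof (induction n arbitrary: x)
  case (Suc n)
  show ?case using K_bdd[OF half_line_fun_meas[OF K_pow_half_line[OF f]] Suc] by simp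
qed (simp add: b)

lemma K_mono:
  assumes "f \<in> borel_measurable borel" "\<And>x. \<bar>f x\<bar> \<le> C" "g \<in> borel_measurable borel" "\<And>x. \<bar>g x\<bar> \<le> C'"
    and le: "\<And>x. f x \<le> g x"
  shows "K f x \<le> K g x"
  unfolding K_def
  by (auto intro!: integral_mono J_reflect_mult_int[OF assms(1,2)] J_reflect_mult_int[OF assms(3,4)] mult_left_mono le J_nonneg)

lemma K_pow_abs:
  assumes f: "half_line_fun f" and b: "\<And>x. \<bar>f x\<bar> \<le> C"
  shows "\<bar>(K ^^ n) f x\<bar> \<le> (K ^^ n) (\<lambda>x. \<bar>f x\<bar>) x"
proof (induction n arbitrary: x)
  case (Suc n)
  have af: "half_line_fun (\<lambda>x. \<bar>f x\<bar>)" using f by (auto simp: half_line_fun_def)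
  have ab: "\<And>x. \<bar>\<bar>f x\<bar>\<bar> \<le> C" using b by simp
  have m: "(K ^^ n) f \<in> borel_measurable borel" "(\<lambda>x. \<bar>(K ^^ n) f x\<bar>) \<in> borel_measurable borel"
    "(K ^^ n) (\<lambda>x. \<bar>f x\<bar>) \<in> borel_measurable borel"
    using half_line_fun_meas[OF K_pow_half_line[OF f]] half_line_fun_meas[OF K_pow_half_line[OF af]] by auto
  have "\<bar>K ((K ^^ n) f) x\<bar> \<le> K (\<lambda>x. \<bar>(K ^^ n) f x\<bar>) x"
    unfolding K_def using J_nonneg
    by (auto simp: abs_mult intro!: order_trans[OF integral_abs_bound])
  also have "\<dots> \<le> K ((K ^^ n) (\<lambda>x. \<bar>f x\<bar>)) x"
    by (rule K_mono[OF m(2) _ m(3) K_pow_bdd[OF af ab]]) (use K_pow_bdd[OF f b] Suc in auto)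
  finally show ?case by simp
qed simp

text \<open>For x, y >= 0 monotonicity of \<open>J\<close> gives 0 <= J(x - y) - J(x + y) <= J(x -
  y). Nonnegativity of the iterates is carried through the induction, since dropping the reflected
  term increases the integral only for nonnegative functions.\<close>

lemma K_odd_pow_le:
  assumes f: "half_line_fun f" and b: "\<And>x. \<bar>f x\<bar> \<le> C" and nn: "\<And>x. f x \<ge> 0"
  shows "0 \<le> (K_odd ^^ n) f x \<and> (K_odd ^^ n) f x \<le> (K ^^ n) f x"
proof (induction n arbitrary: x)
  case (Suc n)
  let ?g = "(K_odd ^^ n) f"
  have m: "?g \<in> borel_measurable borel" "(K ^^ n) f \<in> borel_measurable borel"
    using half_line_fun_meas[OF K_odd_pow_half_line[OF f]] half_line_fun_meas[OF K_pow_half_line[OF f]] by auto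
  have neg: "?g y = 0" if "y < 0" for y using half_line_fun_neg[OF K_odd_pow_half_line[OF f] that] .
  have bd: "\<bar>?g y\<bar> \<le> C" for y using Suc[of y] K_pow_bdd[OF f b, of n y] by auto
  show ?case
  proof (cases "x < 0")
    case False
    have 1: "0 \<le> (J (x - y) - J (x + y)) * ?g y" for y
      using Suc[of y] neg[of y] J_antimono_abs[of "x - y" "x + y"] False
      by (cases "y < 0") (auto intro!: mult_nonneg_nonneg)
    have 2: "(J (x - y) - J (x + y)) * ?g y \<le> J (x - y) * (K ^^ n) f y" for y
    proof -
      have "(J (x - y) - J (x + y)) * ?g y \<le> J (x - y) * ?g y"
        using Suc[of y] J_nonneg by (intro mult_right_mono) auto
      also have "\<dots> \<le> J (x - y) * (K ^^ n) f y" using Suc[of y] J_nonneg by (intro mult_left_mono) auto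
      finally show ?thesis .
    qed
    have "0 \<le> (LINT y|lborel. (J (x - y) - J (x + y)) * ?g y)"
      by (intro Bochner_Integration.integral_nonneg 1)
    moreover have "(LINT y|lborel. (J (x - y) - J (x + y)) * ?g y) \<le> (LINT y|lborel. J (x - y) * (K ^^ n) f y)"
      by (intro integral_mono J_odd_mult_int[OF m(1) bd] J_reflect_mult_int[OF m(2) K_pow_bdd[OF f b]] 2)
    ultimately show ?thesis using False by (simp add: K_def[of "(K ^^ n) f" x] K_odd_def[of ?g x])
  qed (simp add: K_def K_odd_def)
qed (simp add: nn)

text \<open>Reflecting oddly about \<open>-d\<close> instead of \<open>0\<close> yields a supersolution: it is nonnegative
  on \<open>(-d,0)\<close>, and for \<open>x \<ge> 0\<close> the kernel does not see beyond \<open>-d\<close>.\<close>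

lemma K_pow_le_K_odd_shift:
  assumes f: "half_line_fun f" and b: "\<And>x. \<bar>f x\<bar> \<le> C" and nn: "\<And>x. f x \<ge> 0"
  shows "(K ^^ n) f x \<le> (K_odd ^^ n) (\<lambda>z. f (z - d)) (x + d)"
proof (induction n arbitrary: x)
  case (Suc n)
  let ?fd = "\<lambda>z. f (z - d)"
  have fm [measurable]: "f \<in> borel_measurable borel" by (rule half_line_fun_meas[OF f])
  have fd: "half_line_fun ?fd" using half_line_fun_neg[OF f] d_pos by (auto simp: half_line_fun_def)
  have fdb: "\<bar>?fd x\<bar> \<le> C" "?fd x \<ge> 0" for x using b[of "x - d"] nn[of "x - d"] by auto
  let ?g = "(K_odd ^^ n) ?fd"
  have m: "?g \<in> borel_measurable borel" "(K ^^ n) f \<in> borel_measurable borel"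
    using half_line_fun_meas[OF K_odd_pow_half_line[OF fd]] half_line_fun_meas[OF K_pow_half_line[OF f]] by auto
  have neg: "?g y = 0" if "y < 0" for y using half_line_fun_neg[OF K_odd_pow_half_line[OF fd] that] .
  have bd: "\<bar>?g y\<bar> \<le> C" for y
    using K_odd_pow_le[OF fd fdb, of n y] K_pow_bdd[OF fd fdb(1), of n y] by auto
  show ?case
  proof (cases "x < 0")
    case True
    then show ?thesis using K_odd_pow_le[OF fd fdb, of "Suc n" "x + d"] by (simp add: K_def[of "(K ^^ n) f" x])
  next
    case False
    have "(LINT y|lborel. J (x - y) * (K ^^ n) f y) \<le> (LINT y|lborel. J (x - y) * ?g (y + d))"
      using m bd by (intro integral_mono J_reflect_mult_int[OF m(2) K_pow_bdd[OF f b]] J_reflect_mult_int[where C=C] mult_left_mono Suc J_nonneg) auto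
    also have "\<dots> = (LINT z|lborel. J (x + d - z) * ?g z)"
      using lborel_integral_shift[of "\<lambda>z. J (x + d - z) * ?g z" d] by (simp add: algebra_simps)
    also have "\<dots> = (LINT z|lborel. (J (x + d - z) - J (x + d + z)) * ?g z)"
    proof (intro Bochner_Integration.integral_cong refl)
      fix z
      show "J (x + d - z) * ?g z = (J (x + d - z) - J (x + d + z)) * ?g z"
        using neg[of z] J_supp[of "x + d + z"] False d_pos by (cases "z < 0") auto
    qed
    finally show ?thesis using False d_pos by (simp add: K_def[of "(K ^^ n) f" x] K_odd_def[of ?g "x + d"])
  qed
qed simp

text \<open>A supersolution condition: by symmetry of \<open>J\<close> the integral is
  \<open>K\<close> applied to the weight cut to the half line. It makes \<open>K\<close> bounded
  with constant \<open>c\<close> on the weighted L1 space.\<close>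

definition weight :: "(real \<Rightarrow> real) \<Rightarrow> real \<Rightarrow> bool" where
  "weight w c \<longleftrightarrow> continuous_on UNIV w \<and> (\<forall>x. w x \<ge> 0) \<and> c \<ge> 0 \<and>
    (\<forall>y\<ge>0. (LINT x|lborel. indicator {0..} x * (w x * J (x - y))) \<le> c * w y)"

lemma J_translate_int:
  assumes "continuous_on UNIV w" shows "integrable lborel (\<lambda>x. w x * J (x - y))"
proof (rule integrable_compact_support[of _ "\<bar>y\<bar> + d"])
  show "continuous_on UNIV (\<lambda>x. w x * J (x - y))"
    by (intro continuous_intros assms continuous_on_compose2[OF J_cont]) auto
  show "w z * J (z - y) = 0" if "\<bar>z\<bar> > \<bar>y\<bar> + d" for z using J_supp[of "z - y"] that by auto
qed

lemma J_translate_ind_int: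
  assumes "continuous_on UNIV w" shows "integrable lborel (\<lambda>x. indicator {0..} x * (w x * J (x - y)))"
  by (rule Bochner_Integration.integrable_bound[OF J_translate_int[OF assms]])
     (use borel_measurable_continuous_onI[OF assms] in \<open>auto simp: indicator_def\<close>)

text \<open>An even kernel of mass 1 reproduces affine functions, and for y >= 0 the function x + d
  is nonnegative wherever \<open>J (x - y)\<close> does not vanish, so cutting off x < 0 only
  decreases the integral. The shift by \<open>d\<close> is what gives exactly the constant
  1.\<close>

lemma weight_half_space: "weight (\<lambda>x. \<bar>x\<bar> + d) 1"
  unfolding weight_def
proof (intro conjI allI impI)
  show c: "continuous_on UNIV (\<lambda>x. \<bar>x\<bar> + d)" by (intro continuous_intros)
  fix y :: real assume y: "y \<ge> 0"
  have i: "integrable lborel (\<lambda>x. (x + d) * J (x - y))" by (intro J_translate_int continuous_intros)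
  have "(LINT x|lborel. indicator {0..} x * ((\<bar>x\<bar> + d) * J (x - y))) \<le> (LINT x|lborel. (x + d) * J (x - y))"
  proof (intro integral_mono i J_translate_ind_int c)
    fix x
    show "indicator {0..} x * ((\<bar>x\<bar> + d) * J (x - y)) \<le> (x + d) * J (x - y)"
      using J_nonneg[of "x - y"] J_supp[of "x - y"] y
      by (cases "x \<le> - d") (auto simp: indicator_def)
  qed
  also have "\<dots> = (LINT z|lborel. (z + y + d) * J z)"
    using lborel_integral_shift[of "\<lambda>x. (x + d) * J (x - y)" y] by simp
  also have "\<dots> = (LINT z|lborel. J z * z ^ 1 + (y + d) * J z)" by (simp add: algebra_simps)
  also have "\<dots> = (LINT z|lborel. J z * z) + (y + d)"
    using J_pow_int[of 1] J_int by (simp add: J_int1)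
  also have "(LINT z|lborel. J z * z) = 0"
    using lborel_integral_reflect[of "\<lambda>z. J z * z" 0] by (simp add: J_even)
  finally show "(LINT x|lborel. indicator {0..} x * ((\<bar>x\<bar> + d) * J (x - y))) \<le> 1 * (\<bar>y\<bar> + d)" using y by simp
qed (use d_pos in auto)

lemma J_quadratic: "(LINT x|lborel. (a + x\<^sup>2) * J (x - y)) = a + y\<^sup>2 + 2 * q"
proof -
  have "(LINT x|lborel. (a + x\<^sup>2) * J (x - y)) = (LINT z|lborel. (a + (z + y)\<^sup>2) * J z)"
    using lborel_integral_shift[of "\<lambda>x. (a + x\<^sup>2) * J (x - y)" y] by simp
  also have "\<dots> = (LINT z|lborel. J z * z ^ 2 + 2 * y * (J z * z ^ 1) + (a + y\<^sup>2) * J z)"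
    by (simp add: algebra_simps power2_eq_square)
  also have "\<dots> = (LINT z|lborel. J z * z ^ 2) + 2 * y * (LINT z|lborel. J z * z) + (a + y\<^sup>2)"
    using J_pow_int[of 1] J_pow_int[of 2] J_int by (simp add: J_int1)
  also have "(LINT z|lborel. J z * z) = 0"
    using lborel_integral_reflect[of "\<lambda>z. J z * z" 0] by (simp add: J_even)
  finally show ?thesis by (simp add: q_def)
qed

text \<open>Here the constant exceeds 1, so this norm may grow in time. It is used only at fixed
  times, to keep second moments finite, where the Poisson series with ratio \<open>1 + 2 * q\<close>
  still converges.\<close>

lemma weight_quadratic: "weight (\<lambda>x. 1 + x\<^sup>2) (1 + 2 * q)"
  unfolding weight_def
proof (intro conjI allI impI)
  show c: "continuous_on UNIV (\<lambda>x::real. 1 + x\<^sup>2)" by (intro continuous_intros)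
  fix y :: real assume y: "y \<ge> 0"
  have "(LINT x|lborel. indicator {0..} x * ((1 + x\<^sup>2) * J (x - y))) \<le> (LINT x|lborel. (1 + x\<^sup>2) * J (x - y))"
    by (intro integral_mono J_translate_int J_translate_ind_int c) (auto simp: indicator_def J_nonneg)
  also have "\<dots> = 1 + y\<^sup>2 + 2 * q" by (rule J_quadratic)
  also have "\<dots> \<le> (1 + 2 * q) * (1 + y\<^sup>2)" using q_pos by (simp add: algebra_simps)
  finally show "(LINT x|lborel. indicator {0..} x * ((1 + x\<^sup>2) * J (x - y))) \<le> (1 + 2 * q) * (1 + y\<^sup>2)" .
qed (use q_pos in auto)

text \<open>Tonelli with the inner integral in x, where the weight inequality applies; the order (y,
  x) of the product is chosen for this.\<close>

lemma K_product_integrable: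
  assumes w: "weight w c" and f: "half_line_fun f" and wf: "integrable lborel (\<lambda>y. w y * f y)"
    and [measurable]: "g \<in> borel_measurable borel" and g: "\<And>x. x \<ge> 0 \<Longrightarrow> \<bar>g x\<bar> \<le> C * w x" and C: "C \<ge> 0"
  shows "integrable (lborel \<Otimes>\<^sub>M lborel) (\<lambda>(y, x). indicator {0..} x * (g x * J (x - y)) * f y)"
    and "(LINT y|lborel. LINT x|lborel. \<bar>indicator {0..} x * (g x * J (x - y)) * f y\<bar>) \<le> C * c * (LINT y|lborel. w y * \<bar>f y\<bar>)"
proof -
  have wc: "continuous_on UNIV w" and wnn: "w x \<ge> 0" and cnn: "c \<ge> 0"
    and wy: "y \<ge> 0 \<Longrightarrow> (LINT x|lborel. indicator {0..} x * (w x * J (x - y))) \<le> c * w y" for x y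
    using w by (auto simp: weight_def)
  have [measurable]: "f \<in> borel_measurable borel" "w \<in> borel_measurable borel"
    using half_line_fun_meas[OF f] borel_measurable_continuous_onI[OF wc] by auto
  let ?h = "\<lambda>y x. indicator {0..} x * (g x * J (x - y)) * f y"
  have hb: "\<bar>?h y x\<bar> \<le> C * \<bar>f y\<bar> * (indicator {0..} x * (w x * J (x - y)))" for x y
  proof (cases "x \<ge> 0")
    case True
    have "\<bar>g x\<bar> * J (x - y) * \<bar>f y\<bar> \<le> C * w x * J (x - y) * \<bar>f y\<bar>"
      by (intro mult_right_mono g True J_nonneg) auto
    then show ?thesis using True J_nonneg[of "x - y"] by (simp add: abs_mult mult_ac)
  qed simp
  have ii: "integrable lborel (\<lambda>x. C * \<bar>f y\<bar> * (indicator {0..} x * (w x * J (x - y))))" for y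
    by (intro integrable_mult_right J_translate_ind_int wc)
  have hi: "integrable lborel (?h y)" for y
    by (rule Bochner_Integration.integrable_bound[OF ii[of y]])
       (use hb in \<open>auto intro!: AE_I2 order_trans[OF hb]\<close>)
  have hle: "(LINT x|lborel. \<bar>?h y x\<bar>) \<le> C * c * (w y * \<bar>f y\<bar>)" for y
  proof (cases "y < 0")
    case False
    have "(LINT x|lborel. \<bar>?h y x\<bar>) \<le> (LINT x|lborel. C * \<bar>f y\<bar> * (indicator {0..} x * (w x * J (x - y))))"
      by (intro integral_mono integrable_abs hi ii hb)
    also have "\<dots> \<le> C * \<bar>f y\<bar> * (c * w y)"
      using wy[of y] False C by (simp only: integral_mult_right_zero) (intro mult_left_mono, auto)
    finally show ?thesis by (simp add: mult_ac)
  qed (simp add: half_line_fun_neg[OF f])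
  have wfa: "integrable lborel (\<lambda>y. w y * \<bar>f y\<bar>)"
    using integrable_abs[OF wf] wnn by (simp add: abs_mult)
  have oi: "integrable lborel (\<lambda>y. LINT x|lborel. \<bar>?h y x\<bar>)"
    by (rule Bochner_Integration.integrable_bound[OF integrable_mult_right[OF wfa, of "C * c"]])
       (use hle C cnn wnn in \<open>auto intro!: AE_I2 simp: abs_mult abs_of_nonneg\<close>)
  show "integrable (lborel \<Otimes>\<^sub>M lborel) (\<lambda>(y, x). ?h y x)"
    by (rule lborel_pair.Fubini_integrable) (use oi hi in auto)
  have "(LINT y|lborel. LINT x|lborel. \<bar>?h y x\<bar>) \<le> (LINT y|lborel. C * c * (w y * \<bar>f y\<bar>))"
    by (intro integral_mono oi hle integrable_mult_right wfa)
  then show "(LINT y|lborel. LINT x|lborel. \<bar>?h y x\<bar>) \<le> C * c * (LINT y|lborel. w y * \<bar>f y\<bar>)" by simp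
qed

text \<open>\<open>K\<close> is symmetric because \<open>J\<close> is even and both arguments are
  confined to the half line. Allowing \<open>g\<close> to grow like the weight covers the stationary
  solution, which is unbounded.\<close>

lemma K_weighted_pairing:
  assumes w: "weight w c" and f: "half_line_fun f" and wf: "integrable lborel (\<lambda>y. w y * f y)"
    and g: "half_line_fun g" "\<And>x. x \<ge> 0 \<Longrightarrow> \<bar>g x\<bar> \<le> C * w x" "C \<ge> 0"
  shows "integrable lborel (\<lambda>x. g x * K f x)"
    and "(LINT x|lborel. g x * K f x) = (LINT y|lborel. K g y * f y)"
    and "(LINT x|lborel. \<bar>g x * K f x\<bar>) \<le> C * c * (LINT y|lborel. w y * \<bar>f y\<bar>)"
proof -
  have [measurable]: "f \<in> borel_measurable borel" "g \<in> borel_measurable borel"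
    using half_line_fun_meas[OF f] half_line_fun_meas[OF g(1)] by auto
  let ?h = "\<lambda>y x. indicator {0..} x * (g x * J (x - y)) * f y"
  note P = K_product_integrable[OF w f wf half_line_fun_meas[OF g(1)] g(2,3)]
  have gK: "g x * K f x = (LINT y|lborel. ?h y x)" for x
    using half_line_fun_neg[OF g(1), of x] by (cases "x < 0") (auto simp: K_def mult.assoc)
  show "integrable lborel (\<lambda>x. g x * K f x)"
    unfolding gK by (rule lborel_pair.integrable_snd[OF P(1)])
  have "(LINT x|lborel. g x * K f x) = (LINT y|lborel. LINT x|lborel. ?h y x)"
    unfolding gK by (rule lborel_pair.Fubini_integral[OF P(1)])
  also have "\<dots> = (LINT y|lborel. K g y * f y)"
  proof (intro Bochner_Integration.integral_cong refl)
    fix y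
    show "(LINT x|lborel. ?h y x) = K g y * f y"
    proof (cases "y < 0")
      case False
      have "(LINT x|lborel. ?h y x) = (LINT x|lborel. J (y - x) * g x * f y)"
      proof (intro Bochner_Integration.integral_cong refl)
        fix x show "?h y x = J (y - x) * g x * f y"
          using half_line_fun_neg[OF g(1), of x] J_even[of "x - y"] by (cases "x < 0") (auto simp: mult_ac)
      qed
      then show ?thesis using False by (simp add: K_def)
    qed (simp add: half_line_fun_neg[OF f])
  qed
  finally show "(LINT x|lborel. g x * K f x) = (LINT y|lborel. K g y * f y)" .
  have ai: "integrable (lborel \<Otimes>\<^sub>M lborel) (\<lambda>(y, x). \<bar>?h y x\<bar>)"
    using integrable_abs[OF P(1)] by (simp add: case_prod_unfold)
  have "(LINT x|lborel. \<bar>g x * K f x\<bar>) \<le> (LINT x|lborel. LINT y|lborel. \<bar>?h y x\<bar>)"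
    unfolding gK
    by (intro integral_mono integrable_abs lborel_pair.integrable_snd[OF P(1)] lborel_pair.integrable_snd[OF ai] integral_abs_bound)
  also have "\<dots> = (LINT y|lborel. LINT x|lborel. \<bar>?h y x\<bar>)"
    by (rule lborel_pair.Fubini_integral[OF ai])
  also have "\<dots> \<le> C * c * (LINT y|lborel. w y * \<bar>f y\<bar>)" by (rule P(2))
  finally show "(LINT x|lborel. \<bar>g x * K f x\<bar>) \<le> C * c * (LINT y|lborel. w y * \<bar>f y\<bar>)" .
qed

lemma K_weighted:
  assumes w: "weight w c" and f: "half_line_fun f" and wf: "integrable lborel (\<lambda>y. w y * f y)"
  shows "integrable lborel (\<lambda>x. w x * K f x)"
    and "(LINT x|lborel. w x * \<bar>K f x\<bar>) \<le> c * (LINT y|lborel. w y * \<bar>f y\<bar>)"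
proof -
  have wm [measurable]: "w \<in> borel_measurable borel" and wnn: "\<And>x. w x \<ge> 0"
    using w borel_measurable_continuous_onI by (auto simp: weight_def)
  \<comment> \<open>The weight itself serves as the test function; it is cut only where
    \<open>K f\<close> vanishes.\<close>
  let ?g = "\<lambda>x. indicator {0..} x * w x"
  have g: "half_line_fun ?g" "\<And>x. x \<ge> 0 \<Longrightarrow> \<bar>?g x\<bar> \<le> 1 * w x" using wnn by (auto simp: half_line_fun_def)
  have eq: "?g x * K f x = w x * K f x" for x by (simp add: indicator_def K_def)
  show "integrable lborel (\<lambda>x. w x * K f x)"
    using K_weighted_pairing(1)[OF w f wf g] unfolding eq by simp
  show "(LINT x|lborel. w x * \<bar>K f x\<bar>) \<le> c * (LINT y|lborel. w y * \<bar>f y\<bar>)"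
    using K_weighted_pairing(3)[OF w f wf g] wnn unfolding eq by (simp add: abs_mult)
qed

lemma K_pow_weighted:
  assumes w: "weight w c" and f: "half_line_fun f" and wf: "integrable lborel (\<lambda>y. w y * f y)"
  shows "integrable lborel (\<lambda>x. w x * (K ^^ n) f x) \<and>
    (LINT x|lborel. w x * \<bar>(K ^^ n) f x\<bar>) \<le> c ^ n * (LINT y|lborel. w y * \<bar>f y\<bar>)"
proof (induction n)
  case (Suc n)
  have "(LINT x|lborel. w x * \<bar>K ((K ^^ n) f) x\<bar>) \<le> c * (LINT x|lborel. w x * \<bar>(K ^^ n) f x\<bar>)"
    using Suc by (intro K_weighted[OF w K_pow_half_line[OF f]]) auto
  also have "\<dots> \<le> c * (c ^ n * (LINT y|lborel. w y * \<bar>f y\<bar>))"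
    using Suc w by (intro mult_left_mono) (auto simp: weight_def)
  finally show ?case using K_weighted(1)[OF w K_pow_half_line[OF f]] Suc by (simp add: mult.assoc)
qed (use wf in auto)

end

section \<open>Moments and deviation of the Poisson weights\<close>

lemma poisson_weight_Suc: "t > 0 \<Longrightarrow> poisson_weight t (Suc n) * (real (Suc n) / t) = poisson_weight t n"
  by (simp add: poisson_weight_def fact_Suc field_simps del: of_nat_Suc)

text \<open>This and the second moment follow from \<open>poisson_weight_Suc\<close> by an index
  shift, the term n = 0 being zero.\<close>

lemma poisson_mean_sums: assumes t: "t > 0" shows "(\<lambda>n. poisson_weight t n * (real n / t)) sums 1"
proof -
  have "(\<lambda>n. poisson_weight t (Suc n) * (real (Suc n) / t)) sums 1"
    unfolding poisson_weight_Suc[OF t] by (rule poisson_weight_sums)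
  from sums_Suc[OF this] show ?thesis by simp
qed

lemma poisson_square_sums:
  assumes t: "t > 0" shows "(\<lambda>n. poisson_weight t n * (real n / t)\<^sup>2) sums (1 + 1 / t)"
proof -
  have eq: "poisson_weight t (Suc n) * (real (Suc n) / t)\<^sup>2 = poisson_weight t n * (real n / t) + poisson_weight t n * (1 / t)" for n
  proof -
    have "poisson_weight t (Suc n) * (real (Suc n) / t)\<^sup>2 = (poisson_weight t (Suc n) * (real (Suc n) / t)) * (real (Suc n) / t)"
      by (simp only: power2_eq_square mult.assoc)
    also have "\<dots> = poisson_weight t n * (real n / t + 1 / t)"
      unfolding poisson_weight_Suc[OF t] by (simp add: add_divide_distrib)
    finally show ?thesis by (simp only: distrib_left)
  qed
  have "(\<lambda>n. poisson_weight t n * (real n / t) + poisson_weight t n * (1 / t)) sums (1 + 1 * (1 / t))"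
    by (intro sums_add sums_mult2 poisson_mean_sums t poisson_weight_sums)
  then have "(\<lambda>n. poisson_weight t (Suc n) * (real (Suc n) / t)\<^sup>2) sums (1 + 1 / t)"
    unfolding eq by simp
  from sums_Suc[OF this] show ?thesis by simp
qed

text \<open>The square (r z - 1)^2 expanded. It replaces the Cauchy-Schwarz inequality for the
  Poisson sum by a termwise bound.\<close>

lemma le_half_square_plus:
  fixes r z :: real assumes "r > 0" shows "z \<le> z\<^sup>2 * (r / 2) + 1 / (2 * r)"
  using assms zero_le_power2[of "r * z - 1"] by (simp add: field_simps power2_eq_square)

text \<open>Since \<open>p(n-1) - p(n) = p(n)(n/t - 1)\<close> for the Poisson weights, the sum below is their total
  variation; it is bounded by the relative standard deviation.\<close>

lemma poisson_deviation:
  assumes t: "t > 0"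
  shows "summable (\<lambda>n. \<bar>poisson_weight t n * (real n / t - 1)\<bar>)"
    and "(\<Sum>n. \<bar>poisson_weight t n * (real n / t - 1)\<bar>) \<le> 1 / sqrt t"
proof -
  let ?p = "poisson_weight t"
  \<comment> \<open>The choice r = sqrt t balances the two parts: the variance 1/t and the total
    mass 1 each contribute 1/(2 sqrt t).\<close>
  let ?b = "\<lambda>n. ?p n * (real n / t - 1)\<^sup>2 * (sqrt t / 2) + ?p n * (1 / (2 * sqrt t))"
  have p: "?p n \<ge> 0" for n using poisson_weight_nonneg t by simp
  have "(\<lambda>n. ?p n * (real n / t)\<^sup>2 - 2 * (?p n * (real n / t)) + ?p n) sums (1 + 1 / t - 2 * 1 + 1)"
    by (intro sums_add sums_diff sums_mult poisson_square_sums poisson_mean_sums poisson_weight_sums t)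
  then have v: "(\<lambda>n. ?p n * (real n / t - 1)\<^sup>2) sums (1 / t)"
    by (simp add: power2_diff algebra_simps)
  have bs: "?b sums (1 / t * (sqrt t / 2) + 1 * (1 / (2 * sqrt t)))"
    by (intro sums_add sums_mult2 v poisson_weight_sums)
  have le: "\<bar>?p n * (real n / t - 1)\<bar> \<le> ?b n" for n
  proof -
    let ?z = "\<bar>real n / t - 1\<bar>"
    have "?z \<le> ?z\<^sup>2 * (sqrt t / 2) + 1 / (2 * sqrt t)" using t by (intro le_half_square_plus) auto
    then have "?p n * ?z \<le> ?p n * (?z\<^sup>2 * (sqrt t / 2) + 1 / (2 * sqrt t))" by (intro mult_left_mono p)
    then show ?thesis using p[of n] by (simp add: abs_mult distrib_left mult.assoc)
  qed
  show s: "summable (\<lambda>n. \<bar>?p n * (real n / t - 1)\<bar>)"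
    by (rule summable_comparison_test'[OF sums_summable[OF bs]]) (use le in simp)
  have "(\<Sum>n. \<bar>?p n * (real n / t - 1)\<bar>) \<le> 1 / t * (sqrt t / 2) + 1 * (1 / (2 * sqrt t))"
    using suminf_le[OF le s sums_summable[OF bs]] sums_unique[OF bs] by simp
  also have "\<dots> = 1 / sqrt t" using t by (simp add: field_simps)
  finally show "(\<Sum>n. \<bar>?p n * (real n / t - 1)\<bar>) \<le> 1 / sqrt t" .
qed

section \<open>Power series in the half-line operator\<close>

context kernel begin

text \<open>General coefficients, since two families occur: the Poisson weights, giving the
  semigroup, and their signed multiples by n/t - 1, giving its time derivative.\<close>

definition K_series :: "(nat \<Rightarrow> real) \<Rightarrow> (real \<Rightarrow> real) \<Rightarrow> real \<Rightarrow> real" where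
  "K_series a f x = (\<Sum>n. a n * (K ^^ n) f x)"

lemma K_series_summable:
  assumes f: "half_line_fun f" and b: "\<And>x. \<bar>f x\<bar> \<le> C" and a: "summable (\<lambda>n. \<bar>a n\<bar>)"
  shows "summable (\<lambda>n. \<bar>a n * (K ^^ n) f x\<bar>)"
proof (rule summable_comparison_test'[OF summable_mult2[OF a, of C]])
  fix n show "norm \<bar>a n * (K ^^ n) f x\<bar> \<le> \<bar>a n\<bar> * C"
    using mult_left_mono[OF K_pow_bdd[OF f b, of n x], of "\<bar>a n\<bar>"] by (simp add: abs_mult)
qed

lemma K_series_half_line: assumes f: "half_line_fun f" shows "half_line_fun (K_series a f)"
proof -
  have [measurable]: "(K ^^ n) f \<in> borel_measurable borel" for n
    by (rule half_line_fun_meas[OF K_pow_half_line[OF f]])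
  show ?thesis
    unfolding half_line_fun_def K_series_def using half_line_fun_neg[OF K_pow_half_line[OF f]] by auto
qed

lemma K_series_bdd:
  assumes f: "half_line_fun f" and b: "\<And>x. \<bar>f x\<bar> \<le> C" and a: "summable (\<lambda>n. \<bar>a n\<bar>)"
  shows "\<bar>K_series a f x\<bar> \<le> (\<Sum>n. \<bar>a n\<bar>) * C"
proof -
  have "\<bar>K_series a f x\<bar> \<le> (\<Sum>n. \<bar>a n * (K ^^ n) f x\<bar>)"
    unfolding K_series_def by (rule summable_rabs[OF K_series_summable[OF f b a]])
  also have "\<dots> \<le> (\<Sum>n. \<bar>a n\<bar> * C)"
    by (rule suminf_le[OF _ K_series_summable[OF f b a] summable_mult2[OF a]])
       (simp add: abs_mult mult_left_mono K_pow_bdd[OF f b])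
  also have "\<dots> = (\<Sum>n. \<bar>a n\<bar>) * C" by (rule suminf_mult2[symmetric, OF a])
  finally show ?thesis .
qed

text \<open>The n-th power of \<open>K\<close> costs at most \<open>c ^ n\<close> in the weighted
  norm, so the summability in \<open>ac\<close> is what exchanges sum and integral; the one in
  \<open>a\<close> gives pointwise convergence for bounded data.\<close>

lemma K_series_pairing:
  assumes w: "weight w c" and f: "half_line_fun f" and b: "\<And>x. \<bar>f x\<bar> \<le> C"
    and wf: "integrable lborel (\<lambda>y. w y * f y)"
    and a: "summable (\<lambda>n. \<bar>a n\<bar>)" and ac: "summable (\<lambda>n. \<bar>a n\<bar> * c ^ n)"
    and [measurable]: "g \<in> borel_measurable borel" and g: "\<And>x. x \<ge> 0 \<Longrightarrow> \<bar>g x\<bar> \<le> D * w x"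
  shows "integrable lborel (\<lambda>x. g x * K_series a f x)"
    and "(\<lambda>n. a n * (LINT x|lborel. g x * (K ^^ n) f x)) sums (LINT x|lborel. g x * K_series a f x)"
    and "(LINT x|lborel. \<bar>g x * K_series a f x\<bar>) \<le> D * ((\<Sum>n. \<bar>a n\<bar> * c ^ n) * (LINT y|lborel. w y * \<bar>f y\<bar>))"
proof -
  have Km [measurable]: "(K ^^ n) f \<in> borel_measurable borel" for n
    by (rule half_line_fun_meas[OF K_pow_half_line[OF f]])
  have wnn: "w x \<ge> 0" for x using w by (auto simp: weight_def)
  let ?N = "LINT y|lborel. w y * \<bar>f y\<bar>"
  let ?h = "\<lambda>n x. g x * (a n * (K ^^ n) f x)"
  have hb: "\<bar>?h n x\<bar> \<le> (D * \<bar>a n\<bar>) * \<bar>w x * (K ^^ n) f x\<bar>" for n x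
  proof (cases "x < 0")
    case False
    have "\<bar>g x\<bar> * (\<bar>a n\<bar> * \<bar>(K ^^ n) f x\<bar>) \<le> D * w x * (\<bar>a n\<bar> * \<bar>(K ^^ n) f x\<bar>)"
      using False by (intro mult_right_mono g) auto
    then show ?thesis using wnn[of x] by (simp add: abs_mult mult_ac)
  qed (simp add: half_line_fun_neg[OF K_pow_half_line[OF f]])
  note Kw = K_pow_weighted[OF w f wf]
  have bi: "integrable lborel (\<lambda>x. (D * \<bar>a n\<bar>) * \<bar>w x * (K ^^ n) f x\<bar>)" for n
    using Kw by (intro integrable_mult_right integrable_abs) auto
  have hi: "integrable lborel (?h n)" for n
    by (rule Bochner_Integration.integrable_bound[OF bi[of n]])
       (use hb in \<open>auto intro!: AE_I2 order_trans[OF hb]\<close>)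
  have D: "D * w 0 \<ge> 0" using order_trans[OF abs_ge_zero g[of 0]] by simp
  have hn: "(LINT x|lborel. norm (?h n x)) \<le> D * (\<bar>a n\<bar> * c ^ n * ?N)" for n
  proof -
    have "(LINT x|lborel. norm (?h n x)) \<le> (LINT x|lborel. (D * \<bar>a n\<bar>) * \<bar>w x * (K ^^ n) f x\<bar>)"
      by (intro integral_mono integrable_norm hi bi) (simp only: real_norm_def hb)
    also have "\<dots> = \<bar>a n\<bar> * (D * (LINT x|lborel. w x * \<bar>(K ^^ n) f x\<bar>))"
      using wnn by (simp add: abs_mult)
    also have "\<dots> \<le> \<bar>a n\<bar> * (D * (c ^ n * ?N))"
    proof (cases "D \<ge> 0")
      case True then show ?thesis using Kw by (intro mult_left_mono) auto
    next
      \<comment> \<open>No sign of \<open>D\<close> is assumed; a negative one forces the weight to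
        vanish on the half line through the bound on \<open>g\<close>, and both sides are then
        zero.\<close>
      case False
      have z: "w x * \<bar>k\<bar> = 0" if "x \<ge> 0" for x k
      proof -
        have "D * w x \<ge> 0" using order_trans[OF abs_ge_zero g[OF that]] .
        then have "w x \<le> 0" using False by (simp add: zero_le_mult_iff)
        then show ?thesis using wnn[of x] by simp
      qed
      have 1: "w x * \<bar>f x\<bar> = 0" "w x * \<bar>(K ^^ n) f x\<bar> = 0" for x
        using z[of x] half_line_fun_neg[OF K_pow_half_line[OF f], of x n] half_line_fun_neg[OF f, of x]
        by (cases "x < 0"; auto)+
      show ?thesis by (simp only: 1) simp
    qed
    finally show ?thesis by (simp add: mult_ac)
  qed
  have s1: "AE x in lborel. summable (\<lambda>n. norm (?h n x))"
  proof (rule AE_I2)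
    fix x show "summable (\<lambda>n. norm (?h n x))"
      using summable_mult[OF K_series_summable[OF f b a, of x], of "\<bar>g x\<bar>"] by (simp add: abs_mult mult_ac)
  qed
  have s3: "summable (\<lambda>n. D * (\<bar>a n\<bar> * c ^ n * ?N))" by (intro summable_mult summable_mult2 ac)
  have s2: "summable (\<lambda>n. LINT x|lborel. norm (?h n x))"
    by (rule summable_comparison_test'[OF s3]) (use hn in simp)
  have eq: "(\<Sum>n. ?h n x) = g x * K_series a f x" for x
    unfolding K_series_def by (rule suminf_mult[OF summable_rabs_cancel[OF K_series_summable[OF f b a]]])
  show i: "integrable lborel (\<lambda>x. g x * K_series a f x)"
    using integrable_suminf[OF hi s1 s2] unfolding eq .
  show "(\<lambda>n. a n * (LINT x|lborel. g x * (K ^^ n) f x)) sums (LINT x|lborel. g x * K_series a f x)"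
    using sums_integral[OF hi s1 s2] unfolding eq by (simp add: mult.left_commute)
  have ni: "integrable lborel (\<lambda>x. norm (?h n x))" for n by (intro integrable_norm hi)
  have s1': "AE x in lborel. summable (\<lambda>n. norm (norm (?h n x)))" and s2': "summable (\<lambda>n. LINT x|lborel. norm (norm (?h n x)))"
    using s1 s2 by simp_all
  have "(LINT x|lborel. \<bar>g x * K_series a f x\<bar>) \<le> (LINT x|lborel. (\<Sum>n. norm (?h n x)))"
  proof (intro integral_mono_AE integrable_abs i integrable_suminf[OF ni s1' s2'])
    show "AE x in lborel. \<bar>g x * K_series a f x\<bar> \<le> (\<Sum>n. norm (?h n x))"
      using s1 by eventually_elim (simp only: eq[symmetric] summable_norm real_norm_def[symmetric])
  qed
  also have "\<dots> = (\<Sum>n. LINT x|lborel. norm (?h n x))" by (rule integral_suminf[OF ni s1' s2'])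
  also have "\<dots> \<le> (\<Sum>n. D * (\<bar>a n\<bar> * c ^ n * ?N))" by (rule suminf_le[OF hn s2 s3])
  also have "\<dots> = D * ((\<Sum>n. \<bar>a n\<bar> * c ^ n) * ?N)"
    by (subst suminf_mult, intro summable_mult2 ac, subst suminf_mult2[OF ac], rule refl)
  finally show "(LINT x|lborel. \<bar>g x * K_series a f x\<bar>) \<le> D * ((\<Sum>n. \<bar>a n\<bar> * c ^ n) * ?N)" .
qed

lemma K_series_weighted:
  assumes w: "weight w c" and f: "half_line_fun f" and b: "\<And>x. \<bar>f x\<bar> \<le> C"
    and wf: "integrable lborel (\<lambda>y. w y * f y)"
    and a: "summable (\<lambda>n. \<bar>a n\<bar>)" and ac: "summable (\<lambda>n. \<bar>a n\<bar> * c ^ n)"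
  shows "integrable lborel (\<lambda>x. w x * K_series a f x)"
    and "(LINT x|lborel. w x * \<bar>K_series a f x\<bar>) \<le> (\<Sum>n. \<bar>a n\<bar> * c ^ n) * (LINT y|lborel. w y * \<bar>f y\<bar>)"
proof -
  have wm: "w \<in> borel_measurable borel" and wnn: "\<And>x. w x \<ge> 0"
    using w borel_measurable_continuous_onI by (auto simp: weight_def)
  have g: "\<And>x. x \<ge> 0 \<Longrightarrow> \<bar>w x\<bar> \<le> 1 * w x" using wnn by simp
  note P = K_series_pairing[OF w f b wf a ac wm g]
  show "integrable lborel (\<lambda>x. w x * K_series a f x)" by (rule P(1))
  show "(LINT x|lborel. w x * \<bar>K_series a f x\<bar>) \<le> (\<Sum>n. \<bar>a n\<bar> * c ^ n) * (LINT y|lborel. w y * \<bar>f y\<bar>)"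
    using P(3) wnn by (simp add: abs_mult)
qed

lemma K_commutes_K_series:
  assumes f: "half_line_fun f" and b: "\<And>x. \<bar>f x\<bar> \<le> C" and a: "summable (\<lambda>n. \<bar>a n\<bar>)"
  shows "K (K_series a f) x = K_series a (K f) x" and "(\<lambda>n. a n * (K ^^ Suc n) f x) sums K (K_series a f) x"
proof -
  have Km [measurable]: "(K ^^ n) f \<in> borel_measurable borel" for n
    by (rule half_line_fun_meas[OF K_pow_half_line[OF f]])
  have "(\<lambda>n. a n * K ((K ^^ n) f) x) sums K (K_series a f) x"
  proof (cases "x < 0")
    case False
    let ?h = "\<lambda>n y. J (x - y) * (a n * (K ^^ n) f y)"
    have bi: "integrable lborel (\<lambda>y. \<bar>a n\<bar> * C * J (x - y))" for n by (intro integrable_mult_right J_reflect_int)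
    have hb: "\<bar>?h n y\<bar> \<le> \<bar>a n\<bar> * C * J (x - y)" for n y
    proof -
      have "\<bar>a n\<bar> * \<bar>(K ^^ n) f y\<bar> * J (x - y) \<le> \<bar>a n\<bar> * C * J (x - y)"
        by (intro mult_right_mono mult_left_mono K_pow_bdd[OF f b] J_nonneg) auto
      then show ?thesis using J_nonneg[of "x - y"] by (simp add: abs_mult mult_ac)
    qed
    have hi: "integrable lborel (?h n)" for n
      by (rule Bochner_Integration.integrable_bound[OF bi[of n]])
         (use hb in \<open>auto intro!: AE_I2 order_trans[OF hb]\<close>)
    have s1: "AE y in lborel. summable (\<lambda>n. norm (?h n y))"
    proof (rule AE_I2)
      fix y show "summable (\<lambda>n. norm (?h n y))"
        using summable_mult[OF K_series_summable[OF f b a, of y], of "\<bar>J (x - y)\<bar>"] by (simp add: abs_mult mult_ac)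
    qed
    have s2: "summable (\<lambda>n. LINT y|lborel. norm (?h n y))"
    proof (rule summable_comparison_test'[OF summable_mult2[OF a, of C]])
      fix n
      have "(LINT y|lborel. norm (?h n y)) \<le> (LINT y|lborel. \<bar>a n\<bar> * C * J (x - y))"
        by (intro integral_mono integrable_norm hi bi) (simp only: real_norm_def hb)
      then show "norm (LINT y|lborel. norm (?h n y)) \<le> \<bar>a n\<bar> * C" by (simp add: J_reflect_int1)
    qed
    have eq: "(\<Sum>n. ?h n y) = J (x - y) * K_series a f y" for y
      unfolding K_series_def by (rule suminf_mult[OF summable_rabs_cancel[OF K_series_summable[OF f b a]]])
    show ?thesis
      using sums_integral[OF hi s1 s2] False unfolding eq by (simp add: K_def mult.left_commute[of "J _"])
  qed (simp add: K_def)
  then show s: "(\<lambda>n. a n * (K ^^ Suc n) f x) sums K (K_series a f) x" by simp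
  show "K (K_series a f) x = K_series a (K f) x"
    using sums_unique[OF s] by (simp add: K_series_def funpow_swap1)
qed

lemma K_diff:
  assumes "f \<in> borel_measurable borel" "\<And>x. \<bar>f x\<bar> \<le> C" "g \<in> borel_measurable borel" "\<And>x. \<bar>g x\<bar> \<le> C'"
  shows "K (\<lambda>x. f x - g x) x = K f x - K g x"
  using J_reflect_mult_int[OF assms(1,2)] J_reflect_mult_int[OF assms(3,4)]
  by (simp add: K_def right_diff_distrib)

lemma K_pow_diff:
  assumes f: "half_line_fun f" "\<And>x. \<bar>f x\<bar> \<le> C" and g: "half_line_fun g" "\<And>x. \<bar>g x\<bar> \<le> C'"
  shows "(K ^^ n) (\<lambda>x. f x - g x) x = (K ^^ n) f x - (K ^^ n) g x"
proof (induction n arbitrary: x)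
  case (Suc n)
  have "(K ^^ n) (\<lambda>x. f x - g x) = (\<lambda>x. (K ^^ n) f x - (K ^^ n) g x)" by (rule ext) (rule Suc)
  then have "(K ^^ Suc n) (\<lambda>x. f x - g x) x = K (\<lambda>x. (K ^^ n) f x - (K ^^ n) g x) x" by simp
  also have "\<dots> = K ((K ^^ n) f) x - K ((K ^^ n) g) x"
    by (rule K_diff[OF half_line_fun_meas[OF K_pow_half_line[OF f(1)]] K_pow_bdd[OF f] half_line_fun_meas[OF K_pow_half_line[OF g(1)]] K_pow_bdd[OF g]])
  finally show ?case by simp
qed simp

lemma K_series_diff:
  assumes f: "half_line_fun f" "\<And>x. \<bar>f x\<bar> \<le> C" and g: "half_line_fun g" "\<And>x. \<bar>g x\<bar> \<le> C'"
    and a: "summable (\<lambda>n. \<bar>a n\<bar>)"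
  shows "K_series a (\<lambda>x. f x - g x) x = K_series a f x - K_series a g x"
  unfolding K_series_def K_pow_diff[OF f g]
  using suminf_diff[OF summable_rabs_cancel[OF K_series_summable[OF f a]] summable_rabs_cancel[OF K_series_summable[OF g a]]]
  by (simp add: right_diff_distrib)

definition S :: "real \<Rightarrow> (real \<Rightarrow> real) \<Rightarrow> real \<Rightarrow> real" where
  "S t = K_series (poisson_weight t)"

lemma poisson_abs_summable: "t \<ge> 0 \<Longrightarrow> summable (\<lambda>n. \<bar>poisson_weight t n\<bar>)"
  using sums_summable[OF poisson_weight_sums[of t]] poisson_weight_nonneg[of t] by simp

lemma poisson_abs_suminf: "t \<ge> 0 \<Longrightarrow> (\<Sum>n. \<bar>poisson_weight t n\<bar>) = 1"
  using sums_unique[OF poisson_weight_sums[of t]] poisson_weight_nonneg[of t] by simp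

lemma poisson_power_summable: "t \<ge> 0 \<Longrightarrow> summable (\<lambda>n. \<bar>poisson_weight t n\<bar> * c ^ n)"
  using sums_summable[OF poisson_weight_power_sums[of t c]] poisson_weight_nonneg[of t] by simp

lemma S_half_line: "half_line_fun f \<Longrightarrow> half_line_fun (S t f)"
  by (simp add: S_def K_series_half_line)

lemma S_bdd:
  assumes "half_line_fun f" "\<And>x. \<bar>f x\<bar> \<le> C" "t \<ge> 0" shows "\<bar>S t f x\<bar> \<le> C"
  using K_series_bdd[OF assms(1,2) poisson_abs_summable[OF assms(3)]] poisson_abs_suminf[OF assms(3)] by (simp add: S_def)

lemma S_sums:
  assumes "half_line_fun f" "\<And>x. \<bar>f x\<bar> \<le> C" "t \<ge> 0"
  shows "(\<lambda>n. poisson_weight t n * (K ^^ n) f x) sums S t f x"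
  unfolding S_def K_series_def
  by (rule summable_sums[OF summable_rabs_cancel[OF K_series_summable[OF assms(1,2) poisson_abs_summable[OF assms(3)]]]])

text \<open>The time derivative of \<open>S t f\<close> decays in the weighted norm because \<open>K\<close> is a
  contraction there and consecutive Poisson weights differ little.\<close>

lemma S_generator:
  assumes f: "half_line_fun f" "\<And>x. \<bar>f x\<bar> \<le> C" and t: "t > 0"
    and wf: "integrable lborel (\<lambda>y. (\<bar>y\<bar> + d) * f y)"
  shows "(LINT x|lborel. (\<bar>x\<bar> + d) * \<bar>K (S t f) x - S t f x\<bar>) \<le> 1 / sqrt t * (LINT y|lborel. (\<bar>y\<bar> + d) * \<bar>f y\<bar>)"
proof -
  let ?p = "poisson_weight t"
  let ?a = "\<lambda>n. ?p n * (real n / t - 1)"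
  have eq: "K (S t f) x - S t f x = K_series ?a f x" for x
  proof -
    have "(\<lambda>n. ?p n * (K ^^ Suc n) f x) sums K (S t f) x"
      unfolding S_def using K_commutes_K_series(2)[OF f poisson_abs_summable] t by simp
    \<comment> \<open>Applying \<open>K\<close> raises the power by one; the Poisson recursion
      rewrites this as a shifted index, and the restored term n = 0 is zero. The generator thus has
      the coefficients \<open>?p n * (real n / t - 1)\<close>.\<close>
    then have "(\<lambda>n. ?p (Suc n) * (real (Suc n) / t) * (K ^^ Suc n) f x) sums K (S t f) x"
      unfolding poisson_weight_Suc[OF t] .
    from sums_Suc[OF this] have "(\<lambda>n. ?p n * (real n / t) * (K ^^ n) f x) sums K (S t f) x" by simp
    from sums_diff[OF this S_sums[OF f, of t x]] t
    have "(\<lambda>n. ?a n * (K ^^ n) f x) sums (K (S t f) x - S t f x)" by (simp add: algebra_simps)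
    then show ?thesis by (simp add: K_series_def sums_iff)
  qed
  note dev = poisson_deviation[OF t]
  have "(LINT x|lborel. (\<bar>x\<bar> + d) * \<bar>K_series ?a f x\<bar>) \<le> (\<Sum>n. \<bar>?a n\<bar> * 1 ^ n) * (LINT y|lborel. (\<bar>y\<bar> + d) * \<bar>f y\<bar>)"
    by (rule K_series_weighted(2)[OF weight_half_space f wf dev(1)]) (use dev(1) in simp)
  also have "\<dots> \<le> 1 / sqrt t * (LINT y|lborel. (\<bar>y\<bar> + d) * \<bar>f y\<bar>)"
    using dev(2) d_pos by (intro mult_right_mono Bochner_Integration.integral_nonneg) auto
  finally show ?thesis unfolding eq .
qed

end

subsection \<open>Comparison with odd reflections\<close>

lemma abs_sin_diff_le: "\<bar>sin a - sin b\<bar> \<le> \<bar>a - b\<bar>" for a b :: real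
proof -
  have "\<bar>sin a - sin b\<bar> = 2 * (\<bar>sin ((a - b) / 2)\<bar> * \<bar>cos ((a + b) / 2)\<bar>)"
    by (simp add: sin_diff_sin abs_mult)
  also have "\<dots> \<le> 2 * (\<bar>(a - b) / 2\<bar> * 1)"
    by (intro mult_left_mono mult_mono abs_sin_x_le_abs_x) auto
  finally show ?thesis by simp
qed

text \<open>Boundedness makes the series converge pointwise; the weight supplies the second moment
  used in the far-field error. The class is stable under \<open>K\<close>, the semigroup, shifts to
  the right and passage to positive and negative parts.\<close>

definition admissible :: "(real \<Rightarrow> real) \<Rightarrow> bool" where
  "admissible f \<longleftrightarrow> half_line_fun f \<and> (\<exists>C. \<forall>x. \<bar>f x\<bar> \<le> C) \<and> integrable lborel (\<lambda>y. (1 + y\<^sup>2) * f y)"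

lemma admissible_half_line: "admissible f \<Longrightarrow> half_line_fun f"
  and admissible_meas: "admissible f \<Longrightarrow> f \<in> borel_measurable borel"
  by (auto simp: admissible_def half_line_fun_def)

lemma admissible_bdd: assumes "admissible f" obtains C where "\<And>x. \<bar>f x\<bar> \<le> C"
  using assms by (auto simp: admissible_def)

lemma admissible_mult_int:
  fixes g :: "real \<Rightarrow> real"
  assumes f: "admissible f" and [measurable]: "g \<in> borel_measurable borel" and g: "\<And>y. \<bar>g y\<bar> \<le> D * (1 + y\<^sup>2)"
  shows "integrable lborel (\<lambda>y. g y * f y)"
proof (rule Bochner_Integration.integrable_bound)
  have [measurable]: "f \<in> borel_measurable borel" by (rule admissible_meas[OF f])
  show "integrable lborel (\<lambda>y. D * ((1 + y\<^sup>2) * f y))"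
    using f by (intro integrable_mult_right) (simp add: admissible_def)
  show "AE y in lborel. norm (g y * f y) \<le> norm (D * ((1 + y\<^sup>2) * f y))"
  proof (rule AE_I2)
    fix y
    have "\<bar>g y\<bar> * \<bar>f y\<bar> \<le> \<bar>D * (1 + y\<^sup>2)\<bar> * \<bar>f y\<bar>"
      by (intro mult_right_mono order_trans[OF g]) auto
    then show "norm (g y * f y) \<le> norm (D * ((1 + y\<^sup>2) * f y))" by (simp add: abs_mult mult.assoc)
  qed
qed (use admissible_meas[OF f] in measurable)

lemma abs_le_one_plus_square: "\<bar>y\<bar> \<le> 1 + y\<^sup>2" for y :: real
proof -
  have "0 \<le> (\<bar>y\<bar> - 1)\<^sup>2" by simp
  also have "\<dots> = y\<^sup>2 + 1 - 2 * \<bar>y\<bar>" by (simp add: power2_diff)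
  finally show ?thesis using zero_le_power2[of y] by linarith
qed

lemma admissible_int: "admissible f \<Longrightarrow> integrable lborel f"
  using admissible_mult_int[of f "\<lambda>_. 1" 1] by simp

lemma admissible_linear_int:
  assumes "admissible f" shows "integrable lborel (\<lambda>y. y * f y)" "integrable lborel (\<lambda>y. \<bar>y\<bar> * f y)" "integrable lborel (\<lambda>y. (\<bar>y\<bar> + c) * f y)" "integrable lborel (\<lambda>y. (y + c) * f y)"
proof -
  show 1: "integrable lborel (\<lambda>y. y * f y)" "integrable lborel (\<lambda>y. \<bar>y\<bar> * f y)"
    using abs_le_one_plus_square by (auto intro!: admissible_mult_int[OF assms, where D=1])
  show "integrable lborel (\<lambda>y. (\<bar>y\<bar> + c) * f y)" "integrable lborel (\<lambda>y. (y + c) * f y)"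
    using 1 admissible_int[OF assms] by (simp_all add: distrib_right)
qed

lemma admissible_quadratic_int:
  assumes "admissible f" shows "integrable lborel (\<lambda>y. y\<^sup>2 * f y)" "integrable lborel (\<lambda>y. (y + c)\<^sup>2 * f y)" "integrable lborel (\<lambda>y. (\<bar>y\<bar> + c)\<^sup>2 * f y)"
proof -
  show 1: "integrable lborel (\<lambda>y. y\<^sup>2 * f y)"
    by (auto intro!: admissible_mult_int[OF assms, where D=1])
  show "integrable lborel (\<lambda>y. (y + c)\<^sup>2 * f y)" "integrable lborel (\<lambda>y. (\<bar>y\<bar> + c)\<^sup>2 * f y)"
  proof -
    have "integrable lborel (\<lambda>y. y\<^sup>2 * f y + 2 * c * (y * f y) + c\<^sup>2 * f y)"
      "integrable lborel (\<lambda>y. y\<^sup>2 * f y + 2 * c * (\<bar>y\<bar> * f y) + c\<^sup>2 * f y)"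
      using 1 admissible_linear_int(1,2)[OF assms] admissible_int[OF assms] by simp_all
    moreover have "(y + c)\<^sup>2 * f y = y\<^sup>2 * f y + 2 * c * (y * f y) + c\<^sup>2 * f y"
      "(\<bar>y\<bar> + c)\<^sup>2 * f y = y\<^sup>2 * f y + 2 * c * (\<bar>y\<bar> * f y) + c\<^sup>2 * f y" for y
      unfolding power2_sum power2_abs by (simp_all add: distrib_right)
    ultimately show "integrable lborel (\<lambda>y. (y + c)\<^sup>2 * f y)" "integrable lborel (\<lambda>y. (\<bar>y\<bar> + c)\<^sup>2 * f y)"
      by (simp_all only:)
  qed
qed

lemma admissible_diff:
  assumes f: "admissible f" and g: "admissible g" shows "admissible (\<lambda>x. f x - g x)"
proof -
  obtain C C' where "\<And>x. \<bar>f x\<bar> \<le> C" "\<And>x. \<bar>g x\<bar> \<le> C'" using admissible_bdd f g by metis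
  then have "\<bar>f x - g x\<bar> \<le> C + C'" for x
    by (rule order_trans[OF abs_triangle_ineq4 add_mono])
  then show ?thesis using f g by (auto simp: admissible_def half_line_fun_def right_diff_distrib)
qed

lemma admissible_abs: "admissible f \<Longrightarrow> admissible (\<lambda>x. \<bar>f x\<bar>)"
  using integrable_abs[of lborel "\<lambda>y. (1 + y\<^sup>2) * f y"]
  by (auto simp: admissible_def half_line_fun_def abs_mult)

lemma
  assumes f: "admissible f"
  shows admissible_pos_part: "admissible (\<lambda>x. max 0 (f x))"
  and admissible_neg_part: "admissible (\<lambda>x. max 0 (- f x))"
proof -
  have [measurable]: "f \<in> borel_measurable borel" by (rule admissible_meas[OF f])
  obtain C where C: "\<And>x. \<bar>f x\<bar> \<le> C" using admissible_bdd f by metis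
  have i: "integrable lborel (\<lambda>y. (1 + y\<^sup>2) * f y)" using f by (simp add: admissible_def)
  have "\<bar>max 0 (f x)\<bar> \<le> C" "\<bar>max 0 (- f x)\<bar> \<le> C" for x using C[of x] by auto
  moreover have "integrable lborel (\<lambda>y. (1 + y\<^sup>2) * max 0 (f y))" "integrable lborel (\<lambda>y. (1 + y\<^sup>2) * max 0 (- f y))"
    by (rule Bochner_Integration.integrable_bound[OF i]; auto simp: abs_mult intro!: mult_left_mono)+
  ultimately show "admissible (\<lambda>x. max 0 (f x))" "admissible (\<lambda>x. max 0 (- f x))"
    using f by (auto simp: admissible_def half_line_fun_def)
qed

lemma admissible_shift: assumes f: "admissible f" and d: "d > 0" shows "admissible (\<lambda>x. f (x - d))"
proof -
  have [measurable]: "f \<in> borel_measurable borel" by (rule admissible_meas[OF f])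
  obtain C where C: "\<And>x. \<bar>f x\<bar> \<le> C" using admissible_bdd f by metis
  have "integrable lborel (\<lambda>y. (y + d)\<^sup>2 * f y + f y)"
    by (intro Bochner_Integration.integrable_add admissible_quadratic_int admissible_int f)
  from lborel_integrable_shift[OF this, of "- d"]
  have "integrable lborel (\<lambda>y. (1 + y\<^sup>2) * f (y - d))" by (simp add: algebra_simps)
  then show ?thesis using f C d by (auto simp: admissible_def half_line_fun_def)
qed

context kernel begin

lemma admissible_K: assumes f: "admissible f" shows "admissible (K f)"
proof -
  obtain C where C: "\<And>x. \<bar>f x\<bar> \<le> C" using admissible_bdd f by metis
  show ?thesis
    using K_half_line[of f] K_bdd[OF admissible_meas[OF f] C] K_weighted(1)[OF weight_quadratic, of f] f
    by (auto simp: admissible_def)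
qed

lemma admissible_S: assumes f: "admissible f" and t: "t \<ge> 0" shows "admissible (S t f)"
proof -
  obtain C where C: "\<And>x. \<bar>f x\<bar> \<le> C" using admissible_bdd f by metis
  have "integrable lborel (\<lambda>y. (1 + y\<^sup>2) * S t f y)"
    unfolding S_def
    by (rule K_series_weighted(1)[OF weight_quadratic admissible_half_line[OF f] C _ poisson_abs_summable[OF t] poisson_power_summable[OF t]])
       (use f in \<open>simp add: admissible_def\<close>)
  then show ?thesis using S_half_line[of f] S_bdd[OF admissible_half_line[OF f] C t] f by (auto simp: admissible_def)
qed

text \<open>The regular part of the odd evolution; the term \<open>exp (- t) * f x\<close> is kept
  apart.\<close>

definition odd_ev :: "(real \<Rightarrow> real) \<Rightarrow> real \<Rightarrow> real \<Rightarrow> real" where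
  "odd_ev f x t = (LINT \<xi>|lborel. rsym t \<xi> * (sin (\<xi> * x) * sin_transform f \<xi>)) / pi"

text \<open>Termwise comparison of the powers with nonnegative Poisson weights. The singular terms
  of both bounds coincide, because the shifted datum is evaluated at the shifted point.\<close>

lemma S_sandwich:
  assumes f: "admissible f" and nn: "\<And>x. f x \<ge> 0" and t: "t \<ge> 0" and x: "x \<ge> 0"
  shows "exp (- t) * f x + odd_ev f x t \<le> S t f x"
    and "S t f x \<le> exp (- t) * f x + odd_ev (\<lambda>z. f (z - d)) (x + d) t"
proof -
  obtain C where C: "\<And>x. \<bar>f x\<bar> \<le> C" using admissible_bdd f by metis
  note h = admissible_half_line[OF f]
  have p: "poisson_weight t n \<ge> 0" for n by (rule poisson_weight_nonneg[OF t])
  have s: "(\<lambda>n. poisson_weight t n * (K ^^ n) f x) sums S t f x" by (rule S_sums[OF h C t])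
  have "(\<lambda>n. poisson_weight t n * (K_odd ^^ n) f x) sums (exp (- t) * f x + odd_ev f x t)"
    unfolding odd_ev_def by (rule K_odd_exp_sums[OF admissible_int[OF f] half_line_fun_neg[OF h] x t])
  from sums_le[OF _ this s] show "exp (- t) * f x + odd_ev f x t \<le> S t f x"
    using K_odd_pow_le[OF h C nn] p by (auto intro: mult_left_mono)
  note fd = admissible_shift[OF f d_pos]
  have "(\<lambda>n. poisson_weight t n * (K_odd ^^ n) (\<lambda>z. f (z - d)) (x + d)) sums
      (exp (- t) * f (x + d - d) + odd_ev (\<lambda>z. f (z - d)) (x + d) t)"
    unfolding odd_ev_def
    by (rule K_odd_exp_sums[OF admissible_int[OF fd] half_line_fun_neg[OF admissible_half_line[OF fd]] _ t]) (use x d_pos in auto)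
  from sums_le[OF _ s this] show "S t f x \<le> exp (- t) * f x + odd_ev (\<lambda>z. f (z - d)) (x + d) t"
    using K_pow_le_K_odd_shift[OF h C nn] p by (auto intro: mult_left_mono)
qed

text \<open>Moments about -d, that is, moments about 0 of the datum shifted by \<open>d\<close>. For
  \<open>mom1\<close> this is also the norm in which \<open>K\<close> is a contraction.\<close>

definition mom1 :: "(real \<Rightarrow> real) \<Rightarrow> real" where "mom1 f = (LINT y|lborel. (\<bar>y\<bar> + d) * \<bar>f y\<bar>)"
definition mom2 :: "(real \<Rightarrow> real) \<Rightarrow> real" where "mom2 f = (LINT y|lborel. (\<bar>y\<bar> + d)\<^sup>2 * \<bar>f y\<bar>)"

lemma mom1_nonneg: "mom1 f \<ge> 0" and mom2_nonneg: "mom2 f \<ge> 0"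
  unfolding mom1_def mom2_def using d_pos by (auto intro!: Bochner_Integration.integral_nonneg)

lemma shift_moments:
  assumes f: "half_line_fun f"
  shows "(LINT y|lborel. y * \<bar>f (y - d)\<bar>) = mom1 f" "(LINT y|lborel. y\<^sup>2 * \<bar>f (y - d)\<bar>) = mom2 f"
    "(LINT y|lborel. y * f (y - d)) = (LINT y|lborel. (y + d) * f y)"
proof -
  have e: "(y + d) * \<bar>f y\<bar> = (\<bar>y\<bar> + d) * \<bar>f y\<bar>" "(y + d)\<^sup>2 * \<bar>f y\<bar> = (\<bar>y\<bar> + d)\<^sup>2 * \<bar>f y\<bar>" for y
    using half_line_fun_neg[OF f, of y] by (cases "y < 0"; simp)+
  show "(LINT y|lborel. y * \<bar>f (y - d)\<bar>) = mom1 f" "(LINT y|lborel. y\<^sup>2 * \<bar>f (y - d)\<bar>) = mom2 f"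
    using lborel_integral_shift[of "\<lambda>y. y * \<bar>f (y - d)\<bar>" d] lborel_integral_shift[of "\<lambda>y. y\<^sup>2 * \<bar>f (y - d)\<bar>" d]
    by (simp_all add: mom1_def mom2_def flip: e)
  show "(LINT y|lborel. y * f (y - d)) = (LINT y|lborel. (y + d) * f y)"
    using lborel_integral_shift[of "\<lambda>y. y * f (y - d)" d] by simp
qed

lemma S_abs_le:
  assumes f: "admissible f" and t: "t \<ge> 0" shows "\<bar>S t f x\<bar> \<le> S t (\<lambda>x. \<bar>f x\<bar>) x"
proof -
  obtain C where C: "\<And>x. \<bar>f x\<bar> \<le> C" using admissible_bdd f by metis
  note h = admissible_half_line[OF f]
  have C': "\<bar>\<bar>f x\<bar>\<bar> \<le> C" for x using C by simp
  have "\<bar>S t f x\<bar> \<le> (\<Sum>n. \<bar>poisson_weight t n * (K ^^ n) f x\<bar>)"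
    unfolding S_def K_series_def by (rule summable_rabs[OF K_series_summable[OF h C poisson_abs_summable[OF t]]])
  also have "\<dots> \<le> (\<Sum>n. poisson_weight t n * (K ^^ n) (\<lambda>x. \<bar>f x\<bar>) x)"
  proof (rule suminf_le[OF _ K_series_summable[OF h C poisson_abs_summable[OF t]] sums_summable[OF S_sums[OF admissible_half_line[OF admissible_abs[OF f]] C' t]]])
    fix n show "\<bar>poisson_weight t n * (K ^^ n) f x\<bar> \<le> poisson_weight t n * (K ^^ n) (\<lambda>x. \<bar>f x\<bar>) x"
      using mult_left_mono[OF K_pow_abs[OF h C] poisson_weight_nonneg[OF t]] poisson_weight_nonneg[OF t, of n]
      by (simp add: abs_mult)
  qed
  also have "\<dots> = S t (\<lambda>x. \<bar>f x\<bar>) x" by (simp add: S_def K_series_def)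
  finally show ?thesis .
qed

text \<open>Only the upper comparison is used, applied to |f|; the shift by \<open>d\<close> turns x
  and the first moment into \<open>x + d\<close> and \<open>mom1 f\<close>.\<close>

lemma S_pointwise_bound:
  assumes f: "admissible f" and t: "t > 0" and x: "x \<ge> 0"
  shows "\<bar>S t f x\<bar> \<le> exp (- t) * \<bar>f x\<bar> + (x + d) * mom1 f * sym_norm t / pi"
proof -
  let ?g = "\<lambda>x. \<bar>f x\<bar>" let ?gd = "\<lambda>z. ?g (z - d)"
  note g = admissible_abs[OF f]
  note gd = admissible_shift[OF g d_pos]
  have "\<bar>S t f x\<bar> \<le> S t ?g x" using S_abs_le[OF f] t by simp
  also have "\<dots> \<le> exp (- t) * ?g x + odd_ev ?gd (x + d) t" using S_sandwich(2)[OF g] t x by simp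
  also have "odd_ev ?gd (x + d) t \<le> \<bar>odd_ev ?gd (x + d) t\<bar>" by simp
  also have "\<dots> \<le> (x + d) * (LINT y|lborel. y * \<bar>?gd y\<bar>) * sym_norm t / pi"
    unfolding odd_ev_def
    by (rule odd_evolution_bound[OF admissible_int[OF gd] admissible_linear_int(1)[OF gd] half_line_fun_neg[OF admissible_half_line[OF gd]] t])
       (use x d_pos in auto)
  also have "(LINT y|lborel. y * \<bar>?gd y\<bar>) = mom1 f"
    using shift_moments(1)[OF admissible_half_line[OF f]] by simp
  finally show ?thesis by simp
qed

text \<open>A Lipschitz constant of \<open>W\<close> in space, obtained by differentiating its
  integrand in x.\<close>

definition W_slope :: "real \<Rightarrow> real" where "W_slope s = gauss_moment 2 * (q * s) powr (- (3/2)) / pi"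

lemma W_slope_nonneg: "W_slope s \<ge> 0" by (simp add: W_slope_def gauss_moment_nonneg)

lemma W_slope_eq: "s > 0 \<Longrightarrow> W_slope s = W_slope 1 * s powr (- (3/2))"
  using q_pos by (simp add: W_slope_def powr_mult)

lemma W_lipschitz:
  assumes s: "s > 0" shows "\<bar>W x s - W y s\<bar> \<le> \<bar>x - y\<bar> * W_slope s"
proof -
  let ?e = "\<lambda>\<xi>. exp (- (q * s * \<xi>\<^sup>2))"
  have eq: "W x s - W y s = (LINT \<xi>|lborel. ?e \<xi> * (\<xi> * sin (\<xi> * x)) - ?e \<xi> * (\<xi> * sin (\<xi> * y))) / pi"
    using W_int[OF s] by (simp add: W_def diff_divide_distrib)
  have "\<bar>LINT \<xi>|lborel. ?e \<xi> * (\<xi> * sin (\<xi> * x)) - ?e \<xi> * (\<xi> * sin (\<xi> * y))\<bar>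
      \<le> (LINT \<xi>|lborel. \<bar>?e \<xi> * (\<xi> * sin (\<xi> * x)) - ?e \<xi> * (\<xi> * sin (\<xi> * y))\<bar>)" by (rule integral_abs_bound)
  also have "\<dots> \<le> (LINT \<xi>|lborel. \<bar>x - y\<bar> * (\<xi>\<^sup>2 * ?e \<xi>))"
  proof (intro integral_mono integrable_abs Bochner_Integration.integrable_diff W_int s integrable_mult_right gauss_q_sq_int)
    fix \<xi>
    have "?e \<xi> * (\<bar>\<xi>\<bar> * \<bar>sin (\<xi> * x) - sin (\<xi> * y)\<bar>) \<le> ?e \<xi> * (\<bar>\<xi>\<bar> * \<bar>\<xi> * x - \<xi> * y\<bar>)"
      by (intro mult_left_mono abs_sin_diff_le) auto
    also have "\<bar>\<xi> * x - \<xi> * y\<bar> = \<bar>\<xi>\<bar> * \<bar>x - y\<bar>" by (simp add: abs_mult flip: right_diff_distrib)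
    also have "?e \<xi> * (\<bar>\<xi>\<bar> * (\<bar>\<xi>\<bar> * \<bar>x - y\<bar>)) = \<bar>x - y\<bar> * (\<bar>\<xi>\<bar>\<^sup>2 * ?e \<xi>)" unfolding power2_eq_square by (simp only: mult_ac)
    finally show "\<bar>?e \<xi> * (\<xi> * sin (\<xi> * x)) - ?e \<xi> * (\<xi> * sin (\<xi> * y))\<bar> \<le> \<bar>x - y\<bar> * (\<xi>\<^sup>2 * ?e \<xi>)"
      by (simp add: abs_mult flip: right_diff_distrib)
  qed
  also have "\<dots> = \<bar>x - y\<bar> * (W_slope s * pi)" using gauss_q_sq[OF s] by (simp add: W_slope_def)
  finally show ?thesis unfolding eq by (simp add: abs_divide divide_le_eq mult.assoc)
qed

lemma W_bound: "s > 0 \<Longrightarrow> \<bar>W x s\<bar> \<le> \<bar>x\<bar> * W_slope s"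
  using W_lipschitz[of s x 0] by (simp add: W_def)

text \<open>The difference of the two Gaussians has one sign, so the integral of its absolute value
  is again a difference of slopes and no time derivative is taken.\<close>

lemma W_time:
  assumes s: "s > 0" "s \<le> t" shows "\<bar>W x s - W x t\<bar> \<le> \<bar>x\<bar> * (W_slope s - W_slope t)"
proof -
  let ?e = "\<lambda>s \<xi>. exp (- (q * s * \<xi>\<^sup>2))"
  have t: "t > 0" using s by simp
  have eq: "W x s - W x t = (LINT \<xi>|lborel. ?e s \<xi> * (\<xi> * sin (\<xi> * x)) - ?e t \<xi> * (\<xi> * sin (\<xi> * x))) / pi"
    using W_int[OF s(1)] W_int[OF t] by (simp add: W_def diff_divide_distrib)
  have "\<bar>LINT \<xi>|lborel. ?e s \<xi> * (\<xi> * sin (\<xi> * x)) - ?e t \<xi> * (\<xi> * sin (\<xi> * x))\<bar>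
      \<le> (LINT \<xi>|lborel. \<bar>?e s \<xi> * (\<xi> * sin (\<xi> * x)) - ?e t \<xi> * (\<xi> * sin (\<xi> * x))\<bar>)" by (rule integral_abs_bound)
  also have "\<dots> \<le> (LINT \<xi>|lborel. \<bar>x\<bar> * (\<xi>\<^sup>2 * ?e s \<xi> - \<xi>\<^sup>2 * ?e t \<xi>))"
  proof (intro integral_mono integrable_abs Bochner_Integration.integrable_diff W_int s(1) t integrable_mult_right gauss_q_sq_int)
    fix \<xi>
    have "q * s * \<xi>\<^sup>2 \<le> q * t * \<xi>\<^sup>2" using s q_pos by (intro mult_right_mono mult_left_mono) auto
    then have m: "?e t \<xi> \<le> ?e s \<xi>" by simp
    have "(?e s \<xi> - ?e t \<xi>) * (\<bar>\<xi>\<bar> * \<bar>sin (\<xi> * x)\<bar>) \<le> (?e s \<xi> - ?e t \<xi>) * (\<bar>\<xi>\<bar> * \<bar>\<xi> * x\<bar>)"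
      using m by (intro mult_left_mono abs_sin_x_le_abs_x) auto
    also have "\<dots> = \<bar>x\<bar> * (\<bar>\<xi>\<bar>\<^sup>2 * ?e s \<xi> - \<bar>\<xi>\<bar>\<^sup>2 * ?e t \<xi>)"
      unfolding power2_eq_square by (simp add: abs_mult algebra_simps)
    finally show "\<bar>?e s \<xi> * (\<xi> * sin (\<xi> * x)) - ?e t \<xi> * (\<xi> * sin (\<xi> * x))\<bar> \<le> \<bar>x\<bar> * (\<xi>\<^sup>2 * ?e s \<xi> - \<xi>\<^sup>2 * ?e t \<xi>)"
      using m by (simp add: abs_mult flip: left_diff_distrib)
  qed
  also have "\<dots> = \<bar>x\<bar> * ((W_slope s - W_slope t) * pi)"
    using gauss_q_sq[OF s(1)] gauss_q_sq[OF t] gauss_q_sq_int[OF s(1)] gauss_q_sq_int[OF t] by (simp add: W_slope_def left_diff_distrib)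
  finally show ?thesis unfolding eq by (simp add: abs_divide divide_le_eq mult.assoc)
qed

text \<open>The error of \<open>odd_evolution_asymp\<close> per unit of x, with moments about -d so
  that it serves both reflections.\<close>

definition far_err :: "(real \<Rightarrow> real) \<Rightarrow> real \<Rightarrow> real" where
  "far_err f s = (mom1 f * sym_err s + mom2 f * (gauss_moment 3 * (q * s) powr (- 2))) / pi"

lemma far_err_nonneg: "far_err f s \<ge> 0"
  unfolding far_err_def by (intro divide_nonneg_nonneg add_nonneg_nonneg mult_nonneg_nonneg mom1_nonneg mom2_nonneg sym_err_nonneg gauss_moment_nonneg) auto

text \<open>The lower barrier carries the moment of \<open>f\<close> at the point x; the upper one
  carries that moment plus \<open>d\<close> times the mass, at the point x + d. The last summand is
  this gap: \<open>mom1 f\<close> comes from moving the point, the mass from changing the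
  moment.\<close>

lemma S_far_nonneg:
  assumes f: "admissible f" and nn: "\<And>x. f x \<ge> 0" and s: "s > 0" and x: "x \<ge> 0"
  shows "\<bar>S s f x - W x s * (LINT y|lborel. y * f y)\<bar>
    \<le> exp (- s) * \<bar>f x\<bar> + (x + d) * far_err f s + d * W_slope s * (mom1 f + (x + d) * (LINT y|lborel. \<bar>f y\<bar>))"
proof -
  let ?fd = "\<lambda>z. f (z - d)"
  let ?m = "LINT y|lborel. y * f y" and ?n = "LINT y|lborel. \<bar>f y\<bar>"
  note fd = admissible_shift[OF f d_pos] and h = admissible_half_line[OF f]
  have n_nn: "?n \<ge> 0" by (intro Bochner_Integration.integral_nonneg) auto
  have md: "(LINT y|lborel. y * ?fd y) = ?m + d * ?n"
    unfolding shift_moments(3)[OF h] using admissible_linear_int(1)[OF f] admissible_int[OF f] nn by (simp add: distrib_right)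
  have mle: "0 \<le> ?m" "?m + d * ?n = mom1 f"
  proof -
    have "0 \<le> y * f y" for y using half_line_fun_neg[OF h, of y] nn[of y] by (cases "y < 0") auto
    then show "0 \<le> ?m" by (intro Bochner_Integration.integral_nonneg)
    show "?m + d * ?n = mom1 f" using md shift_moments(1)[OF h] nn by simp
  qed
  have 1: "\<bar>odd_ev f x s - W x s * ?m\<bar> \<le> (x + d) * far_err f s"
  proof -
    have yy: "(LINT y|lborel. y * \<bar>f y\<bar>) \<le> mom1 f" "(LINT y|lborel. y\<^sup>2 * \<bar>f y\<bar>) \<le> mom2 f"
      unfolding mom1_def mom2_def
      by (intro integral_mono admissible_linear_int admissible_quadratic_int admissible_abs f mult_right_mono; use d_pos in \<open>auto intro!: power_mono simp: abs_le_square_iff[symmetric]\<close>)+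
    have "\<bar>odd_ev f x s - W x s * ?m\<bar> \<le> x * ((LINT y|lborel. y * \<bar>f y\<bar>) * sym_err s + (LINT y|lborel. y\<^sup>2 * \<bar>f y\<bar>) * (gauss_moment 3 * (q * s) powr (- 2))) / pi"
      unfolding odd_ev_def
      by (rule odd_evolution_asymp[OF admissible_int[OF f] admissible_linear_int(1)[OF f] admissible_quadratic_int(1)[OF f] half_line_fun_neg[OF h] s x])
    also have "\<dots> \<le> x * (mom1 f * sym_err s + mom2 f * (gauss_moment 3 * (q * s) powr (- 2))) / pi"
      using x by (intro divide_right_mono mult_left_mono add_mono mult_right_mono yy sym_err_nonneg mult_nonneg_nonneg gauss_moment_nonneg) auto
    also have "\<dots> = x * far_err f s" by (simp add: far_err_def)
    also have "\<dots> \<le> (x + d) * far_err f s" using d_pos by (intro mult_right_mono far_err_nonneg) auto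
    finally show ?thesis .
  qed
  have 2: "\<bar>odd_ev ?fd (x + d) s - W (x + d) s * mom1 f\<bar> \<le> (x + d) * far_err f s"
    using odd_evolution_asymp[OF admissible_int[OF fd] admissible_linear_int(1)[OF fd] admissible_quadratic_int(1)[OF fd] half_line_fun_neg[OF admissible_half_line[OF fd]] s, of "x + d"] x d_pos
    unfolding shift_moments[OF h] md[unfolded shift_moments(3)[OF h]] by (simp add: odd_ev_def far_err_def mle)
  have 3: "\<bar>W (x + d) s * mom1 f - W x s * ?m\<bar> \<le> d * W_slope s * (mom1 f + (x + d) * ?n)"
  proof -
    have eq: "W (x + d) s * mom1 f - W x s * ?m = (W (x + d) s - W x s) * mom1 f + W x s * (d * ?n)"
      unfolding mle(2)[symmetric] by (simp add: algebra_simps)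
    have "\<bar>W (x + d) s - W x s\<bar> \<le> d * W_slope s" using W_lipschitz[OF s, of "x + d" x] d_pos by simp
    then have t1: "\<bar>(W (x + d) s - W x s) * mom1 f\<bar> \<le> d * W_slope s * mom1 f"
      using mult_right_mono[OF _ mom1_nonneg] mom1_nonneg[of f] by (simp add: abs_mult)
    have dn: "0 \<le> d * ?n" using d_pos n_nn by simp
    have "\<bar>W x s\<bar> \<le> (x + d) * W_slope s"
      using W_bound[OF s, of x] x mult_right_mono[OF _ W_slope_nonneg, of x "x + d" s] d_pos by simp
    from mult_right_mono[OF this dn] have t2: "\<bar>W x s * (d * ?n)\<bar> \<le> (x + d) * W_slope s * (d * ?n)"
      by (simp only: abs_mult[of "W x s" "d * ?n"] abs_of_nonneg[OF dn])
    have "d * W_slope s * (mom1 f + (x + d) * ?n) = d * W_slope s * mom1 f + (x + d) * W_slope s * (d * ?n)"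
      by (simp add: algebra_simps)
    then show ?thesis
      unfolding eq using abs_triangle_ineq[of "(W (x + d) s - W x s) * mom1 f" "W x s * (d * ?n)"] t1 t2 by linarith
  qed
  note sw = S_sandwich[OF f nn less_imp_le[OF s] x]
  have nnn: "0 \<le> d * W_slope s * (mom1 f + (x + d) * ?n)"
    using d_pos x n_nn W_slope_nonneg mom1_nonneg by (intro mult_nonneg_nonneg add_nonneg_nonneg) auto
  have "0 \<le> exp (- s) * f x" using nn by simp
  then show ?thesis
    using sw 1 2 3 nnn abs_of_nonneg[OF nn, of x] unfolding abs_le_iff by (elim conjE, intro conjI; linarith)
qed

lemma pos_neg_integral:
  fixes f g :: "real \<Rightarrow> real"
  assumes f: "admissible f" and [measurable]: "g \<in> borel_measurable borel" and g: "\<And>y. \<bar>g y\<bar> \<le> D * (1 + y\<^sup>2)"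
  shows "(LINT y|lborel. g y * \<bar>max 0 (f y)\<bar>) + (LINT y|lborel. g y * \<bar>max 0 (- f y)\<bar>) = (LINT y|lborel. g y * \<bar>f y\<bar>)"
proof -
  have "(LINT y|lborel. g y * \<bar>max 0 (f y)\<bar>) + (LINT y|lborel. g y * \<bar>max 0 (- f y)\<bar>)
      = (LINT y|lborel. g y * \<bar>max 0 (f y)\<bar> + g y * \<bar>max 0 (- f y)\<bar>)"
    by (rule Bochner_Integration.integral_add[symmetric]; rule admissible_mult_int[OF admissible_abs _ g]; use admissible_pos_part[OF f] admissible_neg_part[OF f] in measurable)
  also have "\<dots> = (LINT y|lborel. g y * \<bar>f y\<bar>)"
    by (intro Bochner_Integration.integral_cong refl) (auto simp: max_def)
  finally show ?thesis .
qed

text \<open>The sandwich needs a sign, so \<open>f\<close> is split into positive and negative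
  parts. Nothing is lost: each error term is linear in |f| or in its integrals, and these add up
  exactly.\<close>

lemma S_far:
  assumes f: "admissible f" and s: "s > 0" and x: "x \<ge> 0"
  shows "\<bar>S s f x - W x s * (LINT y|lborel. y * f y)\<bar>
    \<le> exp (- s) * \<bar>f x\<bar> + (x + d) * far_err f s + d * W_slope s * (mom1 f + (x + d) * (LINT y|lborel. \<bar>f y\<bar>))"
proof -
  let ?p = "\<lambda>x. max 0 (f x)" and ?n = "\<lambda>x. max 0 (- f x)"
  note p = admissible_pos_part[OF f] and n = admissible_neg_part[OF f]
  obtain C where C: "\<And>x. \<bar>f x\<bar> \<le> C" using admissible_bdd f by metis
  have b: "\<bar>?p x\<bar> \<le> C" "\<bar>?n x\<bar> \<le> C" for x using C[of x] by auto
  have fe: "f = (\<lambda>x. ?p x - ?n x)" by (auto simp: fun_eq_iff max_def)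
  have Se: "S s f x = S s ?p x - S s ?n x"
    by (subst fe, unfold S_def, rule K_series_diff[OF admissible_half_line[OF p] b(1) admissible_half_line[OF n] b(2) poisson_abs_summable]) (use s in simp)
  have me: "(LINT y|lborel. y * f y) = (LINT y|lborel. y * ?p y) - (LINT y|lborel. y * ?n y)"
    by (subst fe, simp only: right_diff_distrib) (intro Bochner_Integration.integral_diff admissible_linear_int p n)
  have m0: "(LINT y|lborel. \<bar>?p y\<bar>) + (LINT y|lborel. \<bar>?n y\<bar>) = (LINT y|lborel. \<bar>f y\<bar>)"
    using pos_neg_integral[OF f, of "\<lambda>_. 1" 1] by simp
  have m1: "mom1 ?p + mom1 ?n = mom1 f"
    unfolding mom1_def
  proof (rule pos_neg_integral[OF f, where D = "1 + d"])
    show "\<bar>\<bar>y\<bar> + d\<bar> \<le> (1 + d) * (1 + y\<^sup>2)" for y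
      using order_trans[OF abs_le_one_plus_square[of y], of "1 + y\<^sup>2 + d * y\<^sup>2"] d_pos by (simp add: algebra_simps)
  qed simp
  have m2: "mom2 ?p + mom2 ?n = mom2 f"
    unfolding mom2_def
  proof (rule pos_neg_integral[OF f, where D = "1 + 2 * d + d\<^sup>2"])
    fix y :: real
    have "2 * (\<bar>y\<bar> * d) \<le> 2 * ((1 + y\<^sup>2) * d)" using abs_le_one_plus_square[of y] d_pos by (intro mult_left_mono mult_right_mono) auto
    moreover have "(\<bar>y\<bar> + d)\<^sup>2 = y\<^sup>2 + d\<^sup>2 + 2 * (\<bar>y\<bar> * d)" by (simp add: power2_sum)
    moreover have "(1 + 2 * d + d\<^sup>2) * (1 + y\<^sup>2) = 1 + y\<^sup>2 + 2 * ((1 + y\<^sup>2) * d) + d\<^sup>2 + d\<^sup>2 * y\<^sup>2"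
      by (simp add: algebra_simps)
    moreover have "0 \<le> d\<^sup>2 * y\<^sup>2" by simp
    ultimately have "(\<bar>y\<bar> + d)\<^sup>2 \<le> (1 + 2 * d + d\<^sup>2) * (1 + y\<^sup>2)" by linarith
    then show "\<bar>(\<bar>y\<bar> + d)\<^sup>2\<bar> \<le> (1 + 2 * d + d\<^sup>2) * (1 + y\<^sup>2)" by simp
  qed simp
  have fe2: "far_err ?p s + far_err ?n s = far_err f s"
    unfolding far_err_def m1[symmetric] m2[symmetric] by (simp add: algebra_simps add_divide_distrib)
  have "\<bar>S s f x - W x s * (LINT y|lborel. y * f y)\<bar>
    \<le> \<bar>S s ?p x - W x s * (LINT y|lborel. y * ?p y)\<bar> + \<bar>S s ?n x - W x s * (LINT y|lborel. y * ?n y)\<bar>"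
  proof -
    have "S s f x - W x s * (LINT y|lborel. y * f y)
      = (S s ?p x - W x s * (LINT y|lborel. y * ?p y)) - (S s ?n x - W x s * (LINT y|lborel. y * ?n y))"
      by (simp only: Se me right_diff_distrib diff_diff_eq2)
    then show ?thesis by (simp only: abs_triangle_ineq4)
  qed
  also have "\<dots> \<le> (exp (- s) * \<bar>?p x\<bar> + (x + d) * far_err ?p s + d * W_slope s * (mom1 ?p + (x + d) * (LINT y|lborel. \<bar>?p y\<bar>)))
     + (exp (- s) * \<bar>?n x\<bar> + (x + d) * far_err ?n s + d * W_slope s * (mom1 ?n + (x + d) * (LINT y|lborel. \<bar>?n y\<bar>)))"
    by (intro add_mono S_far_nonneg p n s x) auto
  also have "\<dots> = exp (- s) * (\<bar>?p x\<bar> + \<bar>?n x\<bar>) + (x + d) * (far_err ?p s + far_err ?n s)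
      + d * W_slope s * ((mom1 ?p + mom1 ?n) + (x + d) * ((LINT y|lborel. \<bar>?p y\<bar>) + (LINT y|lborel. \<bar>?n y\<bar>)))"
    by (simp only: distrib_left distrib_right)
  also have "\<bar>?p x\<bar> + \<bar>?n x\<bar> = \<bar>f x\<bar>" by (auto simp: max_def)
  finally show ?thesis unfolding fe2 m1 m0 .
qed

subsection \<open>Representation of solutions\<close>

abbreviation half_weight :: "real \<Rightarrow> real" where "half_weight x \<equiv> \<bar>x\<bar> + d"

text \<open>Testing against bounded functions requires only unweighted L1 limits; weighted
  integrability is kept for the symmetry of \<open>K\<close>. Values are Borel representatives, and
  time is the first argument.\<close>

definition curve :: "(real \<Rightarrow> real \<Rightarrow> real) \<Rightarrow> bool" where
  "curve v \<longleftrightarrow>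
    (\<forall>t\<ge>0. half_line_fun (v t) \<and> integrable lborel (\<lambda>x. half_weight x * v t x)) \<and>
    (\<forall>t\<ge>0. ((\<lambda>s. LINT x|lborel. \<bar>v s x - v t x\<bar>) \<longlongrightarrow> 0) (at t within {0..})) \<and>
    (\<forall>t>0. ((\<lambda>h. LINT x|lborel. \<bar>(v (t + h) x - v t x) / h - (K (v t) x - v t x)\<bar>) \<longlongrightarrow> 0) (at 0))"

lemma integrable_of_weighted:
  assumes f: "f \<in> borel_measurable borel" and i: "integrable lborel (\<lambda>x. half_weight x * f x)"
  shows "integrable lborel f"
proof (rule Bochner_Integration.integrable_bound[OF integrable_mult_right[OF i, of "1 / d"]])
  show "AE x in lborel. norm (f x) \<le> norm (1 / d * (half_weight x * f x))"
  proof (rule AE_I2)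
    fix x
    have "d * \<bar>f x\<bar> \<le> half_weight x * \<bar>f x\<bar>" by (intro mult_right_mono) auto
    then have "\<bar>f x\<bar> \<le> (half_weight x * \<bar>f x\<bar>) / d" using d_pos by (simp only: pos_le_divide_eq mult.commute)
    then show "norm (f x) \<le> norm (1 / d * (half_weight x * f x))" using d_pos by (simp add: abs_mult)
  qed
qed (use f in auto)

lemma integrable_mult_bounded:
  fixes f g :: "real \<Rightarrow> real"
  assumes f: "integrable lborel f" and g: "g \<in> borel_measurable borel" "\<And>x. \<bar>g x\<bar> \<le> C"
  shows "integrable lborel (\<lambda>x. f x * g x)"
proof (rule Bochner_Integration.integrable_bound[OF integrable_mult_right[OF f, of C]])
  show "AE x in lborel. norm (f x * g x) \<le> norm (C * f x)"
  proof (rule AE_I2)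
    fix x
    have "\<bar>g x\<bar> * \<bar>f x\<bar> \<le> \<bar>C\<bar> * \<bar>f x\<bar>" by (intro mult_right_mono order_trans[OF g(2)]) auto
    then show "norm (f x * g x) \<le> norm (C * f x)" by (simp add: abs_mult mult.commute)
  qed
qed (use g borel_measurable_integrable[OF f] in measurable)

lemma integral_mult_bounded:
  fixes f g :: "real \<Rightarrow> real"
  assumes f: "integrable lborel f" and g: "g \<in> borel_measurable borel" "\<And>x. \<bar>g x\<bar> \<le> C"
  shows "\<bar>LINT x|lborel. f x * g x\<bar> \<le> C * (LINT x|lborel. \<bar>f x\<bar>)"
proof -
  have "\<bar>LINT x|lborel. f x * g x\<bar> \<le> (LINT x|lborel. \<bar>f x * g x\<bar>)" by (rule integral_abs_bound)
  also have "\<dots> \<le> (LINT x|lborel. C * \<bar>f x\<bar>)"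
  proof (intro integral_mono integrable_abs integrable_mult_bounded[OF f g] integrable_mult_right f)
    fix x
    have "\<bar>g x\<bar> * \<bar>f x\<bar> \<le> C * \<bar>f x\<bar>" by (intro mult_right_mono g(2)) auto
    then show "\<bar>f x * g x\<bar> \<le> C * \<bar>f x\<bar>" by (simp add: abs_mult mult.commute)
  qed
  finally show ?thesis by simp
qed

lemma K_pairing_bounded:
  assumes f: "half_line_fun f" "integrable lborel (\<lambda>x. half_weight x * f x)"
    and g: "half_line_fun g" "\<And>x. \<bar>g x\<bar> \<le> C"
  shows "(LINT x|lborel. K f x * g x) = (LINT x|lborel. f x * K g x)"
proof -
  have C: "C \<ge> 0" using order_trans[OF abs_ge_zero g(2)] .
  have b: "\<bar>g x\<bar> \<le> C / d * half_weight x" for x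
  proof -
    have "\<bar>g x\<bar> * d \<le> C * half_weight x" using C d_pos by (intro mult_mono g(2)) auto
    then have "\<bar>g x\<bar> \<le> (C * half_weight x) / d" using d_pos by (simp only: pos_le_divide_eq)
    then show ?thesis by simp
  qed
  have "C / d \<ge> 0" using C d_pos by simp
  from K_weighted_pairing(2)[OF weight_half_space f g(1) b this] show ?thesis by (simp add: mult.commute)
qed

lemma K_pow_pairing_bounded:
  assumes f: "half_line_fun f" "integrable lborel (\<lambda>x. half_weight x * f x)"
    and g: "half_line_fun g" "\<And>x. \<bar>g x\<bar> \<le> C"
  shows "(LINT x|lborel. (K ^^ n) f x * g x) = (LINT x|lborel. f x * (K ^^ n) g x)"
  using g
proof (induction n arbitrary: g)
  case (Suc n)
  have "(LINT x|lborel. (K ^^ Suc n) f x * g x) = (LINT x|lborel. (K ^^ n) f x * K g x)"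
    using K_pairing_bounded[OF K_pow_half_line[OF f(1)] _ Suc.prems, of n] K_pow_weighted[OF weight_half_space f, of n] by simp
  also have "\<dots> = (LINT x|lborel. f x * (K ^^ n) (K g) x)"
    by (rule Suc.IH[OF K_half_line[OF Suc.prems(1)] K_bdd[OF half_line_fun_meas[OF Suc.prems(1)] Suc.prems(2)]])
  finally show ?case by (simp add: funpow_swap1)
qed simp

context
  fixes v :: "real \<Rightarrow> real \<Rightarrow> real" and \<tau> T :: real
  assumes curve: "curve v" and \<tau>: "\<tau> \<ge> 0" "\<tau> \<le> T"
begin

lemma curve_half_line: "t \<ge> 0 \<Longrightarrow> half_line_fun (v t)"
  and curve_wint: "t \<ge> 0 \<Longrightarrow> integrable lborel (\<lambda>x. half_weight x * v t x)"
  and curve_cont: "t \<ge> 0 \<Longrightarrow> ((\<lambda>s. LINT x|lborel. \<bar>v s x - v t x\<bar>) \<longlongrightarrow> 0) (at t within {0..})"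
  and curve_deriv: "t > 0 \<Longrightarrow> ((\<lambda>h. LINT x|lborel. \<bar>(v (t + h) x - v t x) / h - (K (v t) x - v t x)\<bar>) \<longlongrightarrow> 0) (at 0)"
  using curve by (auto simp: curve_def)

lemma curve_int: "t \<ge> 0 \<Longrightarrow> integrable lborel (v t)"
  by (rule integrable_of_weighted[OF half_line_fun_meas[OF curve_half_line] curve_wint])

lemma curve_K_int: "t \<ge> 0 \<Longrightarrow> integrable lborel (K (v t))"
  by (rule integrable_of_weighted[OF half_line_fun_meas[OF K_half_line[OF curve_half_line]]
      K_weighted(1)[OF weight_half_space curve_half_line curve_wint]])

lemma tendsto_pairing:
  assumes g: "half_line_fun g" "\<And>x. \<bar>g x\<bar> \<le> C" and t: "t \<ge> 0"
  shows "((\<lambda>s. LINT x|lborel. v s x * g x) \<longlongrightarrow> (LINT x|lborel. v t x * g x)) (at t within {0..})"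
proof (rule LIM_zero_cancel, rule Lim_null_comparison)
  show "\<forall>\<^sub>F s in at t within {0..}. norm ((LINT x|lborel. v s x * g x) - (LINT x|lborel. v t x * g x))
      \<le> C * (LINT x|lborel. \<bar>v s x - v t x\<bar>)"
    unfolding eventually_at_filter
  proof (rule always_eventually, intro allI impI)
    fix s :: real assume "s \<in> {0..}"
    then have s: "s \<ge> 0" by simp
    note gm = half_line_fun_meas[OF g(1)]
    have "(LINT x|lborel. v s x * g x) - (LINT x|lborel. v t x * g x) = (LINT x|lborel. (v s x - v t x) * g x)"
      using integrable_mult_bounded[OF curve_int[OF s] gm g(2)] integrable_mult_bounded[OF curve_int[OF t] gm g(2)]
      by (simp add: left_diff_distrib)
    then show "norm ((LINT x|lborel. v s x * g x) - (LINT x|lborel. v t x * g x)) \<le> C * (LINT x|lborel. \<bar>v s x - v t x\<bar>)"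
      using integral_mult_bounded[OF Bochner_Integration.integrable_diff[OF curve_int[OF s] curve_int[OF t]] gm g(2)] by simp
  qed
  show "((\<lambda>s. C * (LINT x|lborel. \<bar>v s x - v t x\<bar>)) \<longlongrightarrow> 0) (at t within {0..})"
    using tendsto_mult_right_zero[OF curve_cont[OF t]] .
qed

text \<open>Symmetry moves \<open>K\<close> onto the test function. As bounded test functions are
  stable under \<open>K\<close>, the pairings satisfy a closed family of scalar differential
  equations.\<close>

lemma deriv_pairing:
  assumes g: "half_line_fun g" "\<And>x. \<bar>g x\<bar> \<le> C" and t: "t > 0"
  shows "((\<lambda>s. LINT x|lborel. v s x * g x) has_real_derivative
    (LINT x|lborel. v t x * K g x) - (LINT x|lborel. v t x * g x)) (at t)"
  unfolding DERIV_def
proof (rule LIM_zero_cancel, rule Lim_null_comparison)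
  let ?R = "\<lambda>h x. (v (t + h) x - v t x) / h - (K (v t) x - v t x)"
  show "((\<lambda>h. C * (LINT x|lborel. \<bar>?R h x\<bar>)) \<longlongrightarrow> 0) (at 0)"
    using tendsto_mult_right_zero[OF curve_deriv[OF t]] .
  have "\<forall>\<^sub>F h in at 0. - t < h" using t by (intro eventually_at_in_open'[of "{-t<..}", simplified]) auto
  then show "\<forall>\<^sub>F h in at 0. norm (((LINT x|lborel. v (t + h) x * g x) - (LINT x|lborel. v t x * g x)) / h -
      ((LINT x|lborel. v t x * K g x) - (LINT x|lborel. v t x * g x))) \<le> C * (LINT x|lborel. \<bar>?R h x\<bar>)"
  proof eventually_elim
    fix h assume "- t < h"
    then have h: "t + h \<ge> 0" and t0: "t \<ge> 0" using t by auto
    note gm = half_line_fun_meas[OF g(1)]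
    note ii = integrable_mult_bounded[OF curve_int[OF h] gm g(2)] integrable_mult_bounded[OF curve_int[OF t0] gm g(2)]
      integrable_mult_bounded[OF curve_K_int[OF t0] gm g(2)]
    have "(LINT x|lborel. ?R h x * g x) = (LINT x|lborel. (v (t + h) x * g x - v t x * g x) / h - (K (v t) x * g x - v t x * g x))"
      by (simp add: algebra_simps diff_divide_distrib)
    also have "\<dots> = ((LINT x|lborel. v (t + h) x * g x) - (LINT x|lborel. v t x * g x)) / h -
      ((LINT x|lborel. K (v t) x * g x) - (LINT x|lborel. v t x * g x))"
      using ii by simp
    also have "(LINT x|lborel. K (v t) x * g x) = (LINT x|lborel. v t x * K g x)"
      by (rule K_pairing_bounded[OF curve_half_line[OF t0] curve_wint[OF t0] g])
    finally have eq: "((LINT x|lborel. v (t + h) x * g x) - (LINT x|lborel. v t x * g x)) / h -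
      ((LINT x|lborel. v t x * K g x) - (LINT x|lborel. v t x * g x)) = (LINT x|lborel. ?R h x * g x)" by simp
    have Ri: "integrable lborel (?R h)"
      by (intro Bochner_Integration.integrable_diff integrable_divide curve_int curve_K_int h t0)
    show "norm (((LINT x|lborel. v (t + h) x * g x) - (LINT x|lborel. v t x * g x)) / h -
      ((LINT x|lborel. v t x * K g x) - (LINT x|lborel. v t x * g x))) \<le> C * (LINT x|lborel. \<bar>?R h x\<bar>)"
      unfolding eq real_norm_def by (rule integral_mult_bounded[OF Ri gm g(2)])
  qed
qed

lemma curve_norm_bounded: "\<exists>M. \<forall>t\<in>{\<tau>..T}. (LINT x|lborel. \<bar>v t x\<bar>) \<le> M"
proof -
  have "continuous_on {\<tau>..T} (\<lambda>t. LINT x|lborel. \<bar>v t x\<bar>)"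
    unfolding continuous_on_def
  proof
    fix t assume "t \<in> {\<tau>..T}"
    then have t: "t \<ge> 0" using \<tau> by auto
    have "((\<lambda>s. LINT x|lborel. \<bar>v s x\<bar>) \<longlongrightarrow> (LINT x|lborel. \<bar>v t x\<bar>)) (at t within {0..})"
    proof (rule LIM_zero_cancel, rule Lim_null_comparison[OF _ curve_cont[OF t]])
      show "\<forall>\<^sub>F s in at t within {0..}. norm ((LINT x|lborel. \<bar>v s x\<bar>) - (LINT x|lborel. \<bar>v t x\<bar>)) \<le> (LINT x|lborel. \<bar>v s x - v t x\<bar>)"
        unfolding eventually_at_filter
      proof (rule always_eventually, intro allI impI)
        fix s :: real assume "s \<in> {0..}"
        then have s: "s \<ge> 0" by simp
        have "(LINT x|lborel. \<bar>v s x\<bar>) - (LINT x|lborel. \<bar>v t x\<bar>) = (LINT x|lborel. \<bar>v s x\<bar> - \<bar>v t x\<bar>)"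
          using curve_int[OF s] curve_int[OF t] by simp
        also have "\<bar>\<dots>\<bar> \<le> (LINT x|lborel. \<bar>\<bar>v s x\<bar> - \<bar>v t x\<bar>\<bar>)" by (rule integral_abs_bound)
        also have "\<dots> \<le> (LINT x|lborel. \<bar>v s x - v t x\<bar>)"
          by (intro integral_mono integrable_abs Bochner_Integration.integrable_diff curve_int s t) simp
        finally show "norm ((LINT x|lborel. \<bar>v s x\<bar>) - (LINT x|lborel. \<bar>v t x\<bar>)) \<le> (LINT x|lborel. \<bar>v s x - v t x\<bar>)" by simp
      qed
    qed
    then show "((\<lambda>s. LINT x|lborel. \<bar>v s x\<bar>) \<longlongrightarrow> (LINT x|lborel. \<bar>v t x\<bar>)) (at t within {\<tau>..T})"
      by (rule tendsto_within_subset) (use \<tau> in auto)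
  qed
  then have "bounded ((\<lambda>t. LINT x|lborel. \<bar>v t x\<bar>) ` {\<tau>..T})"
    by (intro compact_imp_bounded compact_continuous_image) auto
  then show ?thesis unfolding bounded_iff by (auto simp: abs_le_iff)
qed

text \<open>The factor \<open>exp t\<close> cancels the term -v of the equation: differentiation in
  t becomes replacement of \<open>g\<close> by \<open>K g\<close>.\<close>

definition exp_pairing :: "(real \<Rightarrow> real) \<Rightarrow> real \<Rightarrow> real" where
  "exp_pairing g t = exp t * (LINT x|lborel. v t x * g x)"

text \<open>Taylor's formula about \<open>\<tau>\<close> without higher derivatives: the error at
  stage \<open>Suc N\<close> for \<open>g\<close> has as derivative the error at stage
  \<open>N\<close> for \<open>K g\<close>, so the induction runs over all test functions bounded by
  1 simultaneously.\<close>

lemma exp_pairing_taylor: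
  assumes M: "\<And>t. t \<in> {\<tau>..T} \<Longrightarrow> (LINT x|lborel. \<bar>v t x\<bar>) \<le> M"
    and g: "half_line_fun g" "\<And>x. \<bar>g x\<bar> \<le> 1" and t: "t \<in> {\<tau>..T}"
  shows "\<bar>exp_pairing g t - (\<Sum>n<N. (t - \<tau>) ^ n / fact n * exp_pairing ((K ^^ n) g) \<tau>)\<bar> \<le> exp T * M * ((t - \<tau>) ^ N / fact N)"
  using g t
proof (induction N arbitrary: g t)
  case 0
  then have t0: "t \<ge> 0" using \<tau> by auto
  have "\<bar>LINT x|lborel. v t x * g x\<bar> \<le> 1 * (LINT x|lborel. \<bar>v t x\<bar>)"
    by (rule integral_mult_bounded[OF curve_int[OF t0] half_line_fun_meas[OF 0(1)] 0(2)])
  also have "\<dots> \<le> M" using M[OF 0(3)] by simp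
  finally have "exp t * \<bar>LINT x|lborel. v t x * g x\<bar> \<le> exp T * M" using 0(3) by (intro mult_mono) auto
  then show ?case by (simp add: exp_pairing_def abs_mult)
next
  case (Suc N)
  let ?P = "\<lambda>N g t. \<Sum>n<N. (t - \<tau>) ^ n / fact n * exp_pairing ((K ^^ n) g) \<tau>"
  let ?B = "\<lambda>N t. exp T * M * ((t - \<tau>) ^ N / fact N)"
  note Kg = K_half_line[OF Suc.prems(1)] K_bdd[OF half_line_fun_meas[OF Suc.prems(1)] Suc.prems(2)]
  have dP: "((?P (Suc N) g) has_real_derivative ?P N (K g) t) (at t)" for t
  proof -
    have e: "?P (Suc N) g = (\<lambda>t. exp_pairing g \<tau> + (\<Sum>n<N. (t - \<tau>) ^ Suc n / fact (Suc n) * exp_pairing ((K ^^ n) (K g)) \<tau>))"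
      by (rule ext, subst sum.lessThan_Suc_shift) (simp add: funpow_swap1)
    have "((\<lambda>t. (t - \<tau>) ^ Suc n / fact (Suc n) * exp_pairing ((K ^^ n) (K g)) \<tau>) has_real_derivative
        (t - \<tau>) ^ n / fact n * exp_pairing ((K ^^ n) (K g)) \<tau>) (at t)" for n
    proof -
      have "((\<lambda>t. (t - \<tau>) ^ Suc n / fact (Suc n) * exp_pairing ((K ^^ n) (K g)) \<tau>) has_real_derivative
        (real (Suc n) * (t - \<tau>) ^ n) / fact (Suc n) * exp_pairing ((K ^^ n) (K g)) \<tau>) (at t)"
        by (rule DERIV_cmult_right, rule DERIV_cdivide) (auto intro!: derivative_eq_intros simp del: power_Suc)
      then show ?thesis by (simp add: fact_Suc del: of_nat_Suc power_Suc)
    qed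
    then have "((\<lambda>t. \<Sum>n<N. (t - \<tau>) ^ Suc n / fact (Suc n) * exp_pairing ((K ^^ n) (K g)) \<tau>) has_real_derivative
        ?P N (K g) t) (at t)"
      by (rule DERIV_sum)
    from DERIV_add[OF DERIV_const this, of "exp_pairing g \<tau>"] show ?thesis unfolding e by simp
  qed
  have dF: "((exp_pairing g) has_real_derivative exp_pairing (K g) t) (at t)" if "t > 0" for t
    unfolding exp_pairing_def[abs_def]
    by (rule DERIV_cong[OF DERIV_mult[OF DERIV_exp deriv_pairing[OF Suc.prems(1,2) that]]]) (simp add: algebra_simps)
  have dB: "((?B (Suc N)) has_real_derivative ?B N t) (at t)" for t
  proof -
    have "((\<lambda>t. exp T * M * ((t - \<tau>) ^ Suc N / fact (Suc N))) has_real_derivative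
      exp T * M * ((real (Suc N) * (t - \<tau>) ^ N) / fact (Suc N))) (at t)"
      by (rule DERIV_cmult, rule DERIV_cdivide) (auto intro!: derivative_eq_intros simp del: power_Suc)
    then show ?thesis by (simp add: fact_Suc del: of_nat_Suc power_Suc)
  qed
  have cF: "continuous_on {\<tau>..t} (exp_pairing g)"
    unfolding continuous_on_def
  proof
    fix s assume "s \<in> {\<tau>..t}"
    then have "s \<ge> 0" using \<tau> by auto
    from tendsto_mult[OF tendsto_exp[OF tendsto_ident_at] tendsto_pairing[OF Suc.prems(1,2) this]]
    show "(exp_pairing g \<longlongrightarrow> exp_pairing g s) (at s within {\<tau>..t})"
      unfolding exp_pairing_def[abs_def] by (rule tendsto_within_subset) (use \<tau> in auto)
  qed
  have cP: "continuous_on {\<tau>..t} (?P (Suc N) g)" "continuous_on {\<tau>..t} (?B (Suc N))"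
    by (intro continuous_intros; simp)+
  have IH: "\<bar>exp_pairing (K g) s - ?P N (K g) s\<bar> \<le> ?B N s" if "\<tau> < s" "s < t" for s
    using that Suc.prems(3) by (intro Suc.IH[OF Kg]) auto
  have 0: "exp_pairing g \<tau> - ?P (Suc N) g \<tau> = 0" "?B (Suc N) \<tau> = 0"
    by (subst sum.lessThan_Suc_shift) simp_all
  have tt: "\<tau> \<le> t" using Suc.prems by simp
  \<comment> \<open>The bound minus the error and the bound plus the error are both nondecreasing,
    by the induction hypothesis for \<open>K g\<close>, and both start from 0 at
    \<open>\<tau>\<close>.\<close>
  have "?B (Suc N) \<tau> - (exp_pairing g \<tau> - ?P (Suc N) g \<tau>) \<le> ?B (Suc N) t - (exp_pairing g t - ?P (Suc N) g t)"
  proof (rule DERIV_nonneg_imp_increasing_open[OF tt])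
    fix s assume s: "\<tau> < s" "s < t"
    show "\<exists>y. ((\<lambda>s. ?B (Suc N) s - (exp_pairing g s - ?P (Suc N) g s)) has_real_derivative y) (at s) \<and> 0 \<le> y"
      by (rule exI[of _ "?B N s - (exp_pairing (K g) s - ?P N (K g) s)"], intro conjI DERIV_diff dB dF dP)
         (use IH[OF s] s \<tau> in auto)
  qed (intro continuous_on_diff cF cP)
  moreover have "?B (Suc N) \<tau> + (exp_pairing g \<tau> - ?P (Suc N) g \<tau>) \<le> ?B (Suc N) t + (exp_pairing g t - ?P (Suc N) g t)"
  proof (rule DERIV_nonneg_imp_increasing_open[OF tt])
    fix s assume s: "\<tau> < s" "s < t"
    show "\<exists>y. ((\<lambda>s. ?B (Suc N) s + (exp_pairing g s - ?P (Suc N) g s)) has_real_derivative y) (at s) \<and> 0 \<le> y"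
      by (rule exI[of _ "?B N s + (exp_pairing (K g) s - ?P N (K g) s)"], intro conjI DERIV_add DERIV_diff dB dF dP)
         (use IH[OF s] s \<tau> in auto)
  qed (intro continuous_on_diff continuous_on_add cF cP)
  ultimately show ?case unfolding 0 by (simp only: abs_le_iff) linarith
qed

text \<open>Letting the Taylor order grow identifies each pairing with a bounded test function with
  that of the series. The starting time is arbitrary, so that restarting the same curve later
  produces the semigroup law.\<close>

lemma curve_unique:
  assumes f: "half_line_fun f" "\<And>x. \<bar>f x\<bar> \<le> C" "integrable lborel (\<lambda>x. half_weight x * f x)"
    and init: "AE x in lborel. v \<tau> x = f x"
  shows "AE x in lborel. v T x = S (T - \<tau>) f x"
proof -
  obtain M where M: "\<And>t. t \<in> {\<tau>..T} \<Longrightarrow> (LINT x|lborel. \<bar>v t x\<bar>) \<le> M" using curve_norm_bounded by blast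
  define r where "r = T - \<tau>"
  have r: "r \<ge> 0" and T0: "T \<ge> 0" using \<tau> by (auto simp: r_def)
  have Sint: "integrable lborel (S r f)"
    unfolding S_def
    by (rule integrable_of_weighted[OF half_line_fun_meas[OF K_series_half_line[OF f(1)]]
        K_series_weighted(1)[OF weight_half_space f poisson_abs_summable[OF r] poisson_power_summable[OF r]]])
  have pair: "(LINT x|lborel. v T x * g x) = (LINT x|lborel. S r f x * g x)"
    if g: "half_line_fun g" "\<And>x. \<bar>g x\<bar> \<le> 1" for g
  proof -
    note gm = half_line_fun_meas[OF g(1)]
    have F\<tau>: "exp_pairing ((K ^^ n) g) \<tau> = exp \<tau> * (LINT x|lborel. g x * (K ^^ n) f x)" for n
    proof -
      note Kg = half_line_fun_meas[OF K_pow_half_line[OF g(1), of n]]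
      have "(LINT x|lborel. v \<tau> x * (K ^^ n) g x) = (LINT x|lborel. f x * (K ^^ n) g x)"
        by (rule integral_cong_AE)
           (use init half_line_fun_meas[OF curve_half_line[OF \<tau>(1)]] half_line_fun_meas[OF f(1)] Kg in \<open>auto elim: eventually_mono\<close>)
      also have "\<dots> = (LINT x|lborel. (K ^^ n) f x * g x)" by (rule K_pow_pairing_bounded[OF f(1,3) g, symmetric])
      finally show ?thesis by (simp add: exp_pairing_def mult.commute)
    qed
    have "(\<lambda>N. \<Sum>n<N. r ^ n / fact n * exp_pairing ((K ^^ n) g) \<tau>) \<longlonglongrightarrow> exp_pairing g T"
    proof (rule LIM_zero_cancel, rule Lim_null_comparison)
      show "\<forall>\<^sub>F N in sequentially. norm ((\<Sum>n<N. r ^ n / fact n * exp_pairing ((K ^^ n) g) \<tau>) - exp_pairing g T) \<le> exp T * M * (r ^ N / fact N)"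
        using exp_pairing_taylor[OF M g, of T] \<tau> by (intro always_eventually allI) (simp add: r_def abs_minus_commute)
      have "(\<lambda>N. r ^ N / fact N) \<longlonglongrightarrow> 0"
        using summable_LIMSEQ_zero[OF sums_summable[OF exp_converges[of r]]] by (simp add: divide_inverse mult.commute)
      then show "(\<lambda>N. exp T * M * (r ^ N / fact N)) \<longlonglongrightarrow> 0" by (rule tendsto_mult_right_zero)
    qed
    then have "(\<lambda>n. r ^ n / fact n * exp_pairing ((K ^^ n) g) \<tau>) sums exp_pairing g T" by (simp add: sums_def)
    from sums_mult[OF this, of "exp (- T)"]
    have "(\<lambda>n. exp (- T) * (r ^ n / fact n * exp_pairing ((K ^^ n) g) \<tau>)) sums (LINT x|lborel. v T x * g x)"
      by (simp add: exp_pairing_def exp_minus field_simps)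
    moreover have "exp (- T) * (r ^ n / fact n * exp_pairing ((K ^^ n) g) \<tau>) = poisson_weight r n * (LINT x|lborel. g x * (K ^^ n) f x)" for n
    proof -
      have "exp (- T) * exp \<tau> = exp (- r)" by (simp add: r_def flip: exp_add)
      moreover have "exp (- T) * (r ^ n / fact n * (exp \<tau> * I)) = (exp (- T) * exp \<tau>) * r ^ n / fact n * I" for I
        by simp
      ultimately show ?thesis unfolding F\<tau> poisson_weight_def by simp
    qed
    ultimately have 1: "(\<lambda>n. poisson_weight r n * (LINT x|lborel. g x * (K ^^ n) f x)) sums (LINT x|lborel. v T x * g x)" by simp
    have gb: "\<bar>g x\<bar> \<le> 1 / d * half_weight x" for x
    proof -
      have "1 \<le> 1 / d * half_weight x" using d_pos by (simp add: field_simps)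
      with g(2)[of x] show ?thesis by (rule order_trans)
    qed
    have 2: "(\<lambda>n. poisson_weight r n * (LINT x|lborel. g x * (K ^^ n) f x)) sums (LINT x|lborel. g x * S r f x)"
      unfolding S_def
      by (rule K_series_pairing(2)[OF weight_half_space f poisson_abs_summable[OF r] poisson_power_summable[OF r] gm gb])
    show ?thesis using sums_unique2[OF 1 2] by (simp add: mult.commute)
  qed
  \<comment> \<open>Testing with the sign of the difference turns equality of pairings into a
    vanishing L1 norm.\<close>
  define g where "g x = sgn (v T x - S r f x)" for x
  have hl: "half_line_fun (v T)" "half_line_fun (S r f)" using curve_half_line[OF T0] S_half_line[OF f(1)] by auto
  have [measurable]: "v T \<in> borel_measurable borel" "S r f \<in> borel_measurable borel"
    using hl by (auto simp: half_line_fun_def)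
  have "g \<in> borel_measurable borel" unfolding g_def[abs_def] sgn_real_def by measurable
  then have g: "half_line_fun g" "\<And>x. \<bar>g x\<bar> \<le> 1"
    using hl by (auto simp: half_line_fun_def g_def sgn_real_def)
  note gm = half_line_fun_meas[OF g(1)]
  have "(LINT x|lborel. \<bar>v T x - S r f x\<bar>) = (LINT x|lborel. v T x * g x - S r f x * g x)"
    by (intro Bochner_Integration.integral_cong refl) (auto simp: g_def sgn_real_def)
  also have "\<dots> = 0"
    using integrable_mult_bounded[OF curve_int[OF T0] gm g(2)] integrable_mult_bounded[OF Sint gm g(2)] pair[OF g] by simp
  finally have "(LINT x|lborel. \<bar>v T x - S r f x\<bar>) = 0" .
  then have "AE x in lborel. \<bar>v T x - S r f x\<bar> = 0"
    by (subst (asm) integral_nonneg_eq_0_iff_AE)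
       (auto intro!: integrable_abs Bochner_Integration.integrable_diff curve_int T0 Sint)
  then show ?thesis by (simp add: r_def)
qed

end

end

section \<open>Passage from Lebesgue classes to Borel representatives\<close>

lemma lebesgue_measurable_AE:
  fixes f g :: "real \<Rightarrow> real"
  assumes g: "g \<in> borel_measurable borel" and ae: "AE x in lborel. f x = g x"
  shows "f \<in> borel_measurable lebesgue"
proof (rule measurableI)
  fix A :: "real set" assume A: "A \<in> sets borel"
  show "f -` A \<inter> space lebesgue \<in> sets lebesgue"
  proof (rule completion.in_sets_AE)
    show "g -` A \<inter> space lebesgue \<in> sets lebesgue"
      using measurable_sets_borel[OF g A] by auto
    show "AE x in lebesgue. (x \<in> g -` A \<inter> space lebesgue) = (x \<in> f -` A \<inter> space lebesgue)"
      using ae unfolding AE_completion_iff by eventually_elim auto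
  qed auto
qed auto

lemma lebesgue_integral_AE_lborel:
  fixes f g :: "real \<Rightarrow> real"
  assumes g: "g \<in> borel_measurable borel" and ae: "AE x in lborel. f x = g x"
  shows "integral\<^sup>L lebesgue f = integral\<^sup>L lborel g"
proof -
  have gl: "g \<in> borel_measurable lebesgue" by (rule lebesgue_measurable_AE[OF g]) simp
  have "integral\<^sup>L lebesgue f = integral\<^sup>L lebesgue g"
    by (rule integral_cong_AE[OF lebesgue_measurable_AE[OF g ae]])
       (use gl ae in \<open>auto simp: AE_completion_iff\<close>)
  then show ?thesis using g by (simp add: integral_completion)
qed

lemma lebesgue_integrable_AE_lborel:
  fixes f g :: "real \<Rightarrow> real"
  assumes g: "g \<in> borel_measurable borel" and ae: "AE x in lborel. f x = g x" and i: "integrable lebesgue f"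
  shows "integrable lborel g"
proof -
  have gl: "g \<in> borel_measurable lebesgue" by (rule lebesgue_measurable_AE[OF g]) simp
  have "integrable lebesgue g"
    by (rule integrable_cong_AE_imp[OF i]) (use gl ae in \<open>auto simp: AE_completion_iff\<close>)
  then show ?thesis using g by (simp add: integrable_completion)
qed

text \<open>Measurability is known for the weighted product on the half line, so a Borel version is
  chosen for that product and divided by the weight.\<close>

lemma weighted_L1_representative:
  fixes f w :: "real \<Rightarrow> real"
  assumes f: "in_weighted_L1 w {0<..} f" and w [measurable]: "w \<in> borel_measurable borel" and wp: "\<And>x. x > 0 \<Longrightarrow> w x > 0"
  obtains v where "v \<in> borel_measurable borel" "\<And>x. x \<le> 0 \<Longrightarrow> v x = 0"
    "integrable lborel (\<lambda>x. w x * v x)" "AE x in lborel. x > 0 \<longrightarrow> v x = f x"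
proof -
  have i: "integrable lebesgue (\<lambda>x. indicator {0<..} x *\<^sub>R (w x * f x))"
    using f by (simp add: in_weighted_L1_def set_integrable_def)
  obtain g where g [measurable]: "g \<in> borel_measurable lborel" and ae: "AE x in lborel. indicator {0<..} x *\<^sub>R (w x * f x) = g x"
    using completion_ex_borel_measurable_real[OF borel_measurable_integrable[OF i]] by blast
  define v where "v x = indicator {0<..} x * (g x / w x)" for x
  show thesis
  proof (rule that[of v])
    show "v \<in> borel_measurable borel" unfolding v_def by measurable
    have "AE x in lborel. indicator {0<..} x *\<^sub>R (w x * f x) = w x * v x"
      using ae by eventually_elim (use wp in \<open>auto simp: v_def indicator_def less_imp_neq[THEN not_sym]\<close>)
    then show "integrable lborel (\<lambda>x. w x * v x)"
      by (rule lebesgue_integrable_AE_lborel[rotated]) (use i in \<open>auto simp: v_def\<close>)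
    show "AE x in lborel. x > 0 \<longrightarrow> v x = f x"
      using ae by eventually_elim (use wp in \<open>auto simp: v_def indicator_def nonzero_divide_eq_eq less_imp_neq[THEN not_sym] mult.commute\<close>)
  qed (simp add: v_def)
qed

text \<open>The weight is at least 1 on the half line. One inequality suffices, as only limits equal
  to 0 have to be transferred.\<close>

lemma weighted_L1_norm_ge:
  fixes f v :: "real \<Rightarrow> real"
  assumes [measurable]: "v \<in> borel_measurable borel" and neg: "\<And>x. x < 0 \<Longrightarrow> v x = 0"
    and i: "integrable lborel (\<lambda>x. (1 + \<bar>x\<bar>) * v x)" and ae: "AE x in lborel. x > 0 \<longrightarrow> v x = f x"
  shows "(LINT x|lborel. \<bar>v x\<bar>) \<le> weighted_L1_norm (\<lambda>x. 1 + x) {0<..} f"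
proof -
  have i': "integrable lborel (\<lambda>x. indicator {0<..} x * ((1 + x) * \<bar>v x\<bar>))"
    by (rule Bochner_Integration.integrable_bound[OF i]) (auto simp: indicator_def abs_mult)
  have iv: "integrable lborel (\<lambda>x. \<bar>v x\<bar>)"
    by (rule Bochner_Integration.integrable_bound[OF i]) (auto simp: abs_mult mult_le_cancel_right1)
  have "(LINT x|lborel. \<bar>v x\<bar>) \<le> (LINT x|lborel. indicator {0<..} x * ((1 + x) * \<bar>v x\<bar>))"
  proof (rule integral_mono_AE[OF iv i'])
    show "AE x in lborel. \<bar>v x\<bar> \<le> indicator {0<..} x * ((1 + x) * \<bar>v x\<bar>)"
      using AE_lborel_singleton[of "0::real"]
      by eventually_elim (use neg in \<open>auto simp: indicator_def mult_le_cancel_right1 not_less less_eq_real_def\<close>)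
  qed
  also have "\<dots> = weighted_L1_norm (\<lambda>x. 1 + x) {0<..} f"
    unfolding weighted_L1_norm_def set_lebesgue_integral_def
    by (rule lebesgue_integral_AE_lborel[symmetric])
       (use ae in \<open>auto simp: indicator_def elim: eventually_mono\<close>)
  finally show ?thesis .
qed

context kernel begin

lemma weight_change:
  assumes [measurable]: "v \<in> borel_measurable borel" and neg: "\<And>x. x < 0 \<Longrightarrow> v x = 0"
    and i: "integrable lborel (\<lambda>x. (1 + x) * v x)"
  shows "integrable lborel (\<lambda>x. half_weight x * v x)"
proof (rule Bochner_Integration.integrable_bound[OF integrable_mult_right[OF i, of "1 + d"]])
  show "AE x in lborel. norm (half_weight x * v x) \<le> norm ((1 + d) * ((1 + x) * v x))"
  proof (rule AE_I2)
    fix x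
    show "norm (half_weight x * v x) \<le> norm ((1 + d) * ((1 + x) * v x))"
    proof (cases "x < 0")
      case False
      have "half_weight x \<le> (1 + d) * (1 + x)" using False d_pos by (simp add: algebra_simps)
      then have "half_weight x * \<bar>v x\<bar> \<le> (1 + d) * (1 + x) * \<bar>v x\<bar>" by (intro mult_right_mono) auto
      then show ?thesis using False d_pos by (simp add: abs_mult mult.assoc)
    qed (simp add: neg)
  qed
qed measurable

lemma weight_change':
  assumes [measurable]: "v \<in> borel_measurable borel" and i: "integrable lborel (\<lambda>x. half_weight x * v x)"
  shows "integrable lborel (\<lambda>x. (1 + \<bar>x\<bar>) * v x)"
proof -
  have eq: "(\<lambda>x. (1 + \<bar>x\<bar>) * v x) = (\<lambda>x. half_weight x * v x + (1 - d) * v x)"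
    by (rule ext) (simp add: algebra_simps)
  show ?thesis
    unfolding eq by (intro Bochner_Integration.integrable_add i integrable_mult_right integrable_of_weighted[OF assms])
qed

lemma conv_eq_K:
  assumes v: "half_line_fun v" and ae: "AE x in lborel. v x = f x" and x: "x \<ge> 0"
  shows "conv J f x = K v x"
proof -
  have [measurable]: "v \<in> borel_measurable borel" by (rule half_line_fun_meas[OF v])
  have "conv J f x = (LINT y|lborel. J (x - y) * v y)"
    unfolding conv_def
    by (rule lebesgue_integral_AE_lborel) (use ae in \<open>auto elim: eventually_mono\<close>)
  then show ?thesis using x by (simp add: K_def)
qed

text \<open>A representative is chosen separately at each time; the limits in \<open>curve\<close>
  involve only L1 norms and do not see these choices.\<close>

lemma solution_curve:
  assumes sol: "half_line_solution J u0 u"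
  obtains v where "curve v" "\<And>t. t \<ge> 0 \<Longrightarrow> AE x in lborel. x > 0 \<longrightarrow> v t x = u x t"
proof -
  have L1: "\<And>t. t \<ge> 0 \<Longrightarrow> in_weighted_L1 (\<lambda>x. 1 + x) {0<..} (\<lambda>x. u x t)"
    and cont: "\<And>t. t \<ge> 0 \<Longrightarrow> ((\<lambda>s. weighted_L1_norm (\<lambda>x. 1 + x) {0<..} (\<lambda>x. u x s - u x t)) \<longlongrightarrow> 0) (at t within {0..})"
    and der: "\<And>t. t > 0 \<Longrightarrow> ((\<lambda>h. weighted_L1_norm (\<lambda>x. 1 + x) {0<..}
          (\<lambda>x. (u x (t + h) - u x t) / h - (conv J (\<lambda>y. u y t) x - u x t))) \<longlongrightarrow> 0) (at 0)"
    and neg: "\<And>t. t > 0 \<Longrightarrow> AE x in lborel. x < 0 \<longrightarrow> u x t = 0"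
    using sol by (auto simp: half_line_solution_def AE_completion_iff)
  have "\<forall>t. \<exists>v. t \<ge> 0 \<longrightarrow> v \<in> borel_measurable borel \<and> (\<forall>x\<le>0. v x = 0) \<and>
      integrable lborel (\<lambda>x. (1 + x) * v x) \<and> (AE x in lborel. x > 0 \<longrightarrow> v x = u x t)"
  proof
    fix t :: real
    show "\<exists>v. t \<ge> 0 \<longrightarrow> v \<in> borel_measurable borel \<and> (\<forall>x\<le>0. v x = 0) \<and>
      integrable lborel (\<lambda>x. (1 + x) * v x) \<and> (AE x in lborel. x > 0 \<longrightarrow> v x = u x t)"
    proof (cases "t \<ge> 0")
      case True
      show ?thesis by (rule weighted_L1_representative[OF L1[OF True]]) auto
    qed auto
  qed
  from choice[OF this] obtain v where "\<forall>t. t \<ge> 0 \<longrightarrow> v t \<in> borel_measurable borel \<and> (\<forall>x\<le>0. v t x = 0) \<and>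
      integrable lborel (\<lambda>x. (1 + x) * v t x) \<and> (AE x in lborel. x > 0 \<longrightarrow> v t x = u x t)" ..
  note v = this[rule_format]
  have m: "v t \<in> borel_measurable borel" and z: "x < 0 \<Longrightarrow> v t x = 0" and ae: "AE x in lborel. x > 0 \<longrightarrow> v t x = u x t"
    and hl: "half_line_fun (v t)" and wi: "integrable lborel (\<lambda>x. half_weight x * v t x)" if "t \<ge> 0" for t x
    using v[OF that] weight_change[of "v t"] by (auto simp: half_line_fun_def)
  have "curve v"
    unfolding curve_def
  proof (intro conjI allI impI)
    fix t :: real assume t: "t \<ge> 0"
    show "half_line_fun (v t)" "integrable lborel (\<lambda>x. half_weight x * v t x)" using hl[OF t] wi[OF t] .
    show "((\<lambda>s. LINT x|lborel. \<bar>v s x - v t x\<bar>) \<longlongrightarrow> 0) (at t within {0..})"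
    proof (rule Lim_null_comparison[OF _ cont[OF t]])
      show "\<forall>\<^sub>F s in at t within {0..}. norm (LINT x|lborel. \<bar>v s x - v t x\<bar>) \<le> weighted_L1_norm (\<lambda>x. 1 + x) {0<..} (\<lambda>x. u x s - u x t)"
        unfolding eventually_at_filter
      proof (rule always_eventually, intro allI impI)
        fix s :: real assume "s \<in> {0..}"
        then have s: "s \<ge> 0" by simp
        have "integrable lborel (\<lambda>x. half_weight x * (v s x - v t x))"
          using wi[OF s] wi[OF t] by (simp add: right_diff_distrib)
        then have i: "integrable lborel (\<lambda>x. (1 + \<bar>x\<bar>) * (v s x - v t x))"
          using m[OF s] m[OF t] by (intro weight_change') auto
        have "AE x in lborel. x > 0 \<longrightarrow> v s x - v t x = u x s - u x t"
          using ae[OF s] ae[OF t] by eventually_elim auto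
        from weighted_L1_norm_ge[OF _ _ i this] show "norm (LINT x|lborel. \<bar>v s x - v t x\<bar>) \<le> weighted_L1_norm (\<lambda>x. 1 + x) {0<..} (\<lambda>x. u x s - u x t)"
          using m[OF s] m[OF t] z[OF s] z[OF t] by auto
      qed
    qed
  next
    fix t :: real assume t: "t > 0"
    then have t0: "t \<ge> 0" by simp
    \<comment> \<open>The exterior condition enters here: the convolution integrates u(., t) over
      the whole line, so agreement on the positive half line is not enough.\<close>
    have full: "AE x in lborel. v t x = u x t"
      using ae[OF t0] neg[OF t] AE_lborel_singleton[of "0::real"]
    proof eventually_elim
      case (elim x)
      then show ?case using z[OF t0, of x] by (cases "x < 0"; cases "x > 0") auto
    qed
    note Kv = K_half_line[OF hl[OF t0]]
    show "((\<lambda>h. LINT x|lborel. \<bar>(v (t + h) x - v t x) / h - (K (v t) x - v t x)\<bar>) \<longlongrightarrow> 0) (at 0)"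
    proof (rule Lim_null_comparison[OF _ der[OF t]])
      have "\<forall>\<^sub>F h in at 0. - t < h" using t by (intro eventually_at_in_open'[of "{-t<..}", simplified]) auto
      then show "\<forall>\<^sub>F h in at 0. norm (LINT x|lborel. \<bar>(v (t + h) x - v t x) / h - (K (v t) x - v t x)\<bar>)
        \<le> weighted_L1_norm (\<lambda>x. 1 + x) {0<..} (\<lambda>x. (u x (t + h) - u x t) / h - (conv J (\<lambda>y. u y t) x - u x t))"
      proof eventually_elim
        fix h assume "- t < h"
        then have h: "t + h \<ge> 0" by simp
        have [measurable]: "v t \<in> borel_measurable borel" "v (t + h) \<in> borel_measurable borel" "K (v t) \<in> borel_measurable borel"
          using m[OF h] m[OF t0] half_line_fun_meas[OF Kv] by auto
        have "integrable lborel (\<lambda>x. (half_weight x * v (t + h) x - half_weight x * v t x) / h - (half_weight x * K (v t) x - half_weight x * v t x))"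
          by (intro Bochner_Integration.integrable_diff integrable_divide wi h t0 K_weighted(1)[OF weight_half_space hl wi])
        also have "(\<lambda>x. (half_weight x * v (t + h) x - half_weight x * v t x) / h - (half_weight x * K (v t) x - half_weight x * v t x))
            = (\<lambda>x. half_weight x * ((v (t + h) x - v t x) / h - (K (v t) x - v t x)))"
          by (auto simp: fun_eq_iff right_diff_distrib)
        finally have i: "integrable lborel (\<lambda>x. (1 + \<bar>x\<bar>) * ((v (t + h) x - v t x) / h - (K (v t) x - v t x)))"
          by (intro weight_change') auto
        have "AE x in lborel. x > 0 \<longrightarrow> (v (t + h) x - v t x) / h - (K (v t) x - v t x)
            = (u x (t + h) - u x t) / h - (conv J (\<lambda>y. u y t) x - u x t)"
          using ae[OF h] ae[OF t0] by eventually_elim (auto simp: conv_eq_K[OF hl[OF t0] full])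
        from weighted_L1_norm_ge[OF _ _ i this]
        show "norm (LINT x|lborel. \<bar>(v (t + h) x - v t x) / h - (K (v t) x - v t x)\<bar>)
        \<le> weighted_L1_norm (\<lambda>x. 1 + x) {0<..} (\<lambda>x. (u x (t + h) - u x t) / h - (conv J (\<lambda>y. u y t) x - u x t))"
          using z[OF h] z[OF t0] half_line_fun_neg[OF Kv] by auto
      qed
    qed
  qed
  then show thesis using that ae by blast
qed

subsection \<open>Stationary solution and maximum principle\<close>

lemma K_cong_AE:
  assumes "f \<in> borel_measurable borel" "g \<in> borel_measurable borel" "AE x in lborel. f x = g x"
  shows "K f x = K g x"
proof -
  have [measurable]: "f \<in> borel_measurable borel" "g \<in> borel_measurable borel" by fact+
  have "(LINT y|lborel. J (x - y) * f y) = (LINT y|lborel. J (x - y) * g y)"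
    by (rule integral_cong_AE) (use assms(3) in \<open>auto elim: eventually_mono\<close>)
  then show ?thesis by (simp add: K_def)
qed

lemma J_poly_int: "integrable lborel (\<lambda>y. J (x - y) * (a + b * y + c * y\<^sup>2))"
proof -
  have "integrable lborel (\<lambda>y. (a + b * y + c * y\<^sup>2) * J (y - x))"
    by (rule J_translate_int) (intro continuous_intros)
  then show ?thesis using J_even[of "_ - x"] by (simp add: mult.commute)
qed

text \<open>Affine functions are reproduced and the square gains \<open>2 * q\<close>; this gain is
  the margin of the barrier in \<open>maximum_principle\<close>.\<close>

lemma J_poly: "(LINT y|lborel. J (x - y) * (a + b * y + c * y\<^sup>2)) = a + b * x + c * (x\<^sup>2 + 2 * q)"
proof -
  have i: "integrable lborel (\<lambda>y. (w y) * J (y - x))" if "continuous_on UNIV w" for w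
    by (rule J_translate_int[OF that])
  have 0: "(LINT y|lborel. J (y - x)) = 1"
    using lborel_integral_shift[of J "- x"] by (simp add: J_int1)
  have "(LINT y|lborel. (0 + y\<^sup>2) * J (y - x)) = 0 + x\<^sup>2 + 2 * q" by (rule J_quadratic)
  then have 2: "(LINT y|lborel. y\<^sup>2 * J (y - x)) = x\<^sup>2 + 2 * q" by simp
  have "(LINT y|lborel. y * J (y - x)) = (LINT z|lborel. J z * z ^ 1 + x * J z)"
    using lborel_integral_shift[of "\<lambda>y. y * J (y - x)" x] by (simp add: algebra_simps)
  also have "\<dots> = (LINT z|lborel. J z * z) + x"
    using J_pow_int[of 1] J_int by (simp add: J_int1)
  also have "(LINT z|lborel. J z * z) = 0"
    using lborel_integral_reflect[of "\<lambda>z. J z * z" 0] by (simp add: J_even)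
  finally have 1: "(LINT y|lborel. y * J (y - x)) = x" by simp
  have "(LINT y|lborel. J (x - y) * (a + b * y + c * y\<^sup>2))
      = (LINT y|lborel. a * J (y - x) + b * (y * J (y - x)) + c * (y\<^sup>2 * J (y - x)))"
    using J_even[of "_ - x"] by (simp add: algebra_simps)
  also have "\<dots> = a * 1 + b * x + c * (x\<^sup>2 + 2 * q)"
    using i[of "\<lambda>_. 1"] i[of "\<lambda>y. y"] i[of "\<lambda>y. y\<^sup>2"] by (simp add: 0 1 2 continuous_intros)
  finally show ?thesis by simp
qed

text \<open>One application of \<open>K\<close> to a Borel version of \<open>\<phi>\<close> removes
  the null set: the stationary equation holds at every x >= 0, hence the result equals
  \<open>\<phi>\<close> there pointwise. Likewise averaging upgrades the almost everywhere bound on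
  \<open>\<phi> x - x\<close> to a pointwise one, since the kernel reproduces the identity
  function.\<close>

lemma stationary_representative:
  assumes st: "stationary_solution d J \<phi>"
  obtains \<psi> C where "half_line_fun \<psi>" "\<And>x. x \<ge> 0 \<Longrightarrow> \<psi> x = \<phi> x" "\<And>x. K \<psi> x = \<psi> x"
    "C \<ge> 0" "\<And>x. x \<ge> 0 \<Longrightarrow> \<bar>\<psi> x - x\<bar> \<le> C"
proof -
  have conv: "\<And>x. x \<ge> 0 \<Longrightarrow> conv J \<phi> x = \<phi> x" and neg: "\<And>x. - d < x \<Longrightarrow> x < 0 \<Longrightarrow> \<phi> x = 0"
    and m: "(\<lambda>x. indicator {0<..} x *\<^sub>R (\<phi> x - x)) \<in> borel_measurable lebesgue"
    using st by (auto simp: stationary_solution_def in_Linf_def set_borel_measurable_def)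
  obtain C0 where C0: "AE x in lborel. x > 0 \<longrightarrow> \<bar>\<phi> x - x\<bar> \<le> C0"
    using st by (auto simp: stationary_solution_def in_Linf_def AE_completion_iff)
  obtain g where [measurable]: "g \<in> borel_measurable lborel" and g: "AE x in lborel. indicator {0<..} x *\<^sub>R (\<phi> x - x) = g x"
    using completion_ex_borel_measurable_real[OF m] by blast
  define p where "p x = indicator {0<..} x * (g x + x)" for x
  have pm [measurable]: "p \<in> borel_measurable borel" unfolding p_def by measurable
  have pe: "AE x in lborel. x > 0 \<longrightarrow> p x = \<phi> x"
    using g by eventually_elim (auto simp: p_def)
  have phl: "half_line_fun p" by (auto simp: half_line_fun_def p_def)
  define \<psi> where "\<psi> = K p"
  have hl: "half_line_fun \<psi>" unfolding \<psi>_def by (rule K_half_line[OF phl])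
  have eq: "\<psi> x = \<phi> x" if x: "x \<ge> 0" for x
  proof -
    have "conv J \<phi> x = (LINT y|lborel. J (x - y) * p y)"
      unfolding conv_def
    proof (rule lebesgue_integral_AE_lborel)
      show "AE y in lborel. J (x - y) * \<phi> y = J (x - y) * p y"
        using pe AE_lborel_singleton[of "0::real"]
      proof eventually_elim
        case (elim y)
        then show ?case
          using neg[of y] J_supp[of "x - y"] x half_line_fun_neg[OF phl, of y]
          by (cases "y > 0"; cases "y > - d") auto
      qed
    qed measurable
    then show ?thesis using conv[OF x] x by (simp add: \<psi>_def K_def)
  qed
  have pae: "AE x in lborel. p x = \<psi> x"
    using pe AE_lborel_singleton[of "0::real"]
  proof eventually_elim
    case (elim x)
    then show ?case using eq[of x] half_line_fun_neg[OF phl, of x] half_line_fun_neg[OF hl, of x]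
      by (cases "x > 0"; cases "x < 0") auto
  qed
  have K\<psi>: "K \<psi> x = \<psi> x" for x
    using K_cong_AE[OF pm half_line_fun_meas[OF hl] pae, of x] unfolding \<psi>_def by (rule sym)
  \<comment> \<open>For x near 0 the average also sees the interval (-d, 0), where
    \<open>\<psi>\<close> vanishes and differs from the identity by at most
    \<open>d\<close>.\<close>
  define C where "C = \<bar>C0\<bar> + d"
  have b: "\<bar>\<psi> x - x\<bar> \<le> C" if x: "x \<ge> 0" for x
  proof -
    have [measurable]: "\<psi> \<in> borel_measurable borel" by (rule half_line_fun_meas[OF hl])
    have ae: "AE y in lborel. \<bar>J (x - y) * (\<psi> y - y)\<bar> \<le> C * J (x - y)"
      using C0 AE_lborel_singleton[of "0::real"]
    proof eventually_elim
      case (elim y)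
      have "\<bar>\<psi> y - y\<bar> \<le> C" if "y > - d"
        using elim eq[of y] half_line_fun_neg[OF hl, of y] that d_pos by (cases "y > 0") (auto simp: C_def)
      then show ?case
        using J_nonneg[of "x - y"] J_supp[of "x - y"] x mult_right_mono[of "\<bar>\<psi> y - y\<bar>" C "J (x - y)"]
        by (cases "y > - d") (auto simp: abs_mult mult.commute)
    qed
    have i2: "integrable lborel (\<lambda>y. C * J (x - y))" by (intro integrable_mult_right J_reflect_int)
    have i1: "integrable lborel (\<lambda>y. J (x - y) * (\<psi> y - y))"
      by (rule Bochner_Integration.integrable_bound[OF i2]) (use ae in \<open>auto elim!: eventually_mono\<close>)
    have iy: "integrable lborel (\<lambda>y. J (x - y) * y)" using J_poly_int[of x 0 1 0] by simp
    have i\<psi>: "integrable lborel (\<lambda>y. J (x - y) * \<psi> y)"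
      using Bochner_Integration.integrable_add[OF i1 iy] by (simp add: right_diff_distrib)
    have "\<psi> x = (LINT y|lborel. J (x - y) * \<psi> y)" using K\<psi>[of x] x by (simp add: K_def)
    moreover have "x = (LINT y|lborel. J (x - y) * y)" using J_poly[of x 0 1 0] by simp
    ultimately have "\<psi> x - x = (LINT y|lborel. J (x - y) * (\<psi> y - y))"
      using i\<psi> iy by (simp add: right_diff_distrib)
    also have "\<bar>\<dots>\<bar> \<le> (LINT y|lborel. \<bar>J (x - y) * (\<psi> y - y)\<bar>)" by (rule integral_abs_bound)
    also have "\<dots> \<le> (LINT y|lborel. C * J (x - y))" by (rule integral_mono_AE[OF integrable_abs[OF i1] i2 ae])
    finally show ?thesis by (simp add: J_reflect_int1)
  qed
  have "C \<ge> 0" using d_pos by (simp add: C_def)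
  then show thesis using that hl eq K\<psi> b by blast
qed

text \<open>The barrier \<open>\<epsilon>(x + d + 1) + (\<delta>/q)((X + d)\<^sup>2 - x\<^sup>2)\<close> is a strict supersolution with
  margin \<open>2\<delta>\<close>, so each application of the equation lowers an almost everywhere bound
  on the excess over the barrier by \<open>\<delta>\<close>.\<close>

lemma maximum_principle:
  assumes e: "half_line_fun e" and B: "\<And>x. x \<le> X + d \<Longrightarrow> \<bar>e x\<bar> \<le> B" and X: "X \<ge> 0"
    and eps: "\<epsilon> > 0" and del: "\<delta> > 0"
    and sub: "AE x in lborel. 0 \<le> x \<and> x \<le> X \<longrightarrow> e x \<le> K e x + \<delta>"
    and bdry: "AE x in lborel. X < x \<and> x \<le> X + d \<longrightarrow> e x \<le> \<epsilon> * (x + 1)"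
  shows "AE x in lborel. 0 \<le> x \<and> x \<le> X \<longrightarrow> e x \<le> \<epsilon> * (x + d + 1) + \<delta> / q * ((X + d)\<^sup>2 - x\<^sup>2)"
proof -
  have [measurable]: "e \<in> borel_measurable borel" by (rule half_line_fun_meas[OF e])
  define P where "P x = \<epsilon> * (x + d + 1) + \<delta> / q * ((X + d)\<^sup>2 - x\<^sup>2)" for x
  have B0: "B \<ge> 0" using B[of 0] X d_pos by auto
  have Pge: "P x \<ge> \<epsilon> * (x + d + 1)" if "- d \<le> x" "x \<le> X + d" for x
  proof -
    have "\<bar>x\<bar> \<le> \<bar>X + d\<bar>" using that X d_pos by auto
    then have "x\<^sup>2 \<le> (X + d)\<^sup>2" by (simp add: abs_le_square_iff)
    then have "0 \<le> \<delta> / q * ((X + d)\<^sup>2 - x\<^sup>2)" using del q_pos by (intro mult_nonneg_nonneg) auto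
    then show ?thesis by (simp add: P_def)
  qed
  have Pnn: "P x \<ge> 0" if "- d \<le> x" "x \<le> X + d" for x
    using Pge[OF that] that eps by (rule_tac order_trans[rotated]) auto
  \<comment> \<open>The a priori bound \<open>B\<close> only starts the iteration; after n >
    B/\<delta> steps the excess is exactly 0, so \<open>B\<close> does not enter the conclusion.
    This matters because \<open>B\<close> will grow like t^(3/2) in the application.\<close>
  have iter: "AE x in lborel. 0 \<le> x \<and> x \<le> X \<longrightarrow> e x \<le> P x + max 0 (B - real n * \<delta>)" for n
  proof (induction n)
    case 0
    have "e x \<le> P x + B" if "0 \<le> x" "x \<le> X" for x using B[of x] Pnn[of x] that d_pos by auto
    then show ?case using B0 by auto
  next
    case (Suc n)
    define s where "s = max 0 (B - real n * \<delta>)"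
    have s: "s \<ge> 0" by (simp add: s_def)
    have bound: "AE y in lborel. y \<le> X + d \<and> - d \<le> y \<longrightarrow> e y \<le> P y + s"
      using Suc bdry
    proof eventually_elim
      case (elim y)
      show ?case
      proof (intro impI, elim conjE)
        assume y: "y \<le> X + d" "- d \<le> y"
        \<comment> \<open>On the exterior \<open>e\<close> vanishes and the barrier is nonnegative;
          inside, the previous bound applies; on the collar of width \<open>d\<close> the boundary
          estimate lies below the barrier.\<close>
        consider "y < 0" | "0 \<le> y" "y \<le> X" | "X < y" by linarith
        then show "e y \<le> P y + s"
        proof cases
          case 1 then show ?thesis using half_line_fun_neg[OF e 1] Pnn[OF y(2,1)] s by simp
        next
          case 2 then show ?thesis using elim(1) by (simp add: s_def)
        next
          case 3
          then have "e y \<le> \<epsilon> * (y + 1)" using elim(2) y by simp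
          also have "\<dots> \<le> \<epsilon> * (y + d + 1)" using eps d_pos by (intro mult_left_mono) auto
          also have "\<dots> \<le> P y" by (rule Pge[OF y(2,1)])
          finally show ?thesis using s by simp
        qed
      qed
    qed
    have Ke: "K e x \<le> P x + s - 2 * \<delta>" if x: "0 \<le> x" "x \<le> X" for x
    proof -
      have P': "P y + s = (\<epsilon> * (d + 1) + \<delta> / q * (X + d)\<^sup>2 + s) + \<epsilon> * y + (- \<delta> / q) * y\<^sup>2" for y
        by (simp add: P_def algebra_simps)
      have ie: "integrable lborel (\<lambda>y. J (x - y) * e y)"
      proof (rule Bochner_Integration.integrable_bound[OF integrable_mult_right[OF J_reflect_int[of x], of B]])
        show "AE y in lborel. norm (J (x - y) * e y) \<le> norm (B * J (x - y))"
        proof (rule AE_I2)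
          fix y show "norm (J (x - y) * e y) \<le> norm (B * J (x - y))"
            using B[of y] J_supp[of "x - y"] J_nonneg[of "x - y"] B0 x mult_right_mono[of "\<bar>e y\<bar>" B "J (x - y)"]
            by (cases "y \<le> X + d") (auto simp: abs_mult mult.commute)
        qed
      qed measurable
      have "(LINT y|lborel. J (x - y) * e y) \<le> (LINT y|lborel. J (x - y) * (P y + s))"
      proof (rule integral_mono_AE[OF ie])
        show "integrable lborel (\<lambda>y. J (x - y) * (P y + s))" unfolding P' by (rule J_poly_int)
        show "AE y in lborel. J (x - y) * e y \<le> J (x - y) * (P y + s)"
          using bound
        proof eventually_elim
          case (elim y)
          then show ?case
            using J_supp[of "x - y"] J_nonneg[of "x - y"] x
            by (cases "y \<le> X + d \<and> - d \<le> y") (auto intro: mult_left_mono)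
        qed
      qed
      also have "\<dots> = P x + s - 2 * \<delta>"
        unfolding P' J_poly using q_pos by (simp add: field_simps)
      finally show ?thesis using x by (simp add: K_def)
    qed
    have "AE x in lborel. 0 \<le> x \<and> x \<le> X \<longrightarrow> e x \<le> P x + (s - \<delta>)"
      using sub by eventually_elim (use Ke in force)
    moreover have "s - \<delta> \<le> max 0 (B - real (Suc n) * \<delta>)"
      using del by (auto simp: s_def max_def algebra_simps)
    ultimately show ?case by (auto elim!: eventually_mono)
  qed
  obtain n where "B / \<delta> < real n" using reals_Archimedean2 by blast
  then have "B - real n * \<delta> \<le> 0" using del by (simp add: field_simps)
  then have "max 0 (B - real n * \<delta>) = 0" by (rule max_absorb1)
  then show ?thesis using iter[of n] by (simp add: P_def)
qed

text \<open>Combines the contraction constant 1 of the weight with the total Poisson mass 1.\<close>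

lemma mom1_S_le:
  assumes f: "admissible f" and t: "t \<ge> 0" shows "mom1 (S t f) \<le> mom1 f"
proof -
  obtain C where C: "\<And>x. \<bar>f x\<bar> \<le> C" using admissible_bdd f by metis
  have "(LINT x|lborel. (\<bar>x\<bar> + d) * \<bar>S t f x\<bar>) \<le> (\<Sum>n. \<bar>poisson_weight t n\<bar> * 1 ^ n) * (LINT y|lborel. (\<bar>y\<bar> + d) * \<bar>f y\<bar>)"
    unfolding S_def
    by (rule K_series_weighted(2)[OF weight_half_space admissible_half_line[OF f] C admissible_linear_int(3)[OF f] poisson_abs_summable[OF t] poisson_power_summable[OF t]])
  then show ?thesis using poisson_abs_suminf[OF t] by (simp add: mom1_def)
qed

text \<open>Symmetry of \<open>K\<close> and stationarity of \<open>\<psi>\<close> leave the pairing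
  unchanged under every power of \<open>K\<close>. The last claim is how the plain first moment
  approaches the conserved one, as the mass tends to 0.\<close>

lemma S_moment_conserved:
  assumes f: "admissible f" and t: "t \<ge> 0" and \<psi>: "half_line_fun \<psi>" "\<And>x. K \<psi> x = \<psi> x"
    and b: "C \<ge> 0" "\<And>x. x \<ge> 0 \<Longrightarrow> \<bar>\<psi> x - x\<bar> \<le> C"
  shows "(LINT x|lborel. \<psi> x * S t f x) = (LINT x|lborel. \<psi> x * f x)"
    and "integrable lborel (\<lambda>x. \<psi> x * S t f x)"
    and "\<bar>(LINT y|lborel. y * S t f y) - (LINT x|lborel. \<psi> x * f x)\<bar> \<le> C * (LINT y|lborel. \<bar>S t f y\<bar>)"
proof -
  obtain C' where C': "\<And>x. \<bar>f x\<bar> \<le> C'" using admissible_bdd f by metis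
  have \<psi>b: "\<bar>\<psi> x\<bar> \<le> (1 + C / d) * (\<bar>x\<bar> + d)" if "x \<ge> 0" for x
  proof -
    have "\<bar>\<psi> x\<bar> \<le> x + C" using b(2)[OF that] that by linarith
    also have "\<dots> \<le> (1 + C / d) * (\<bar>x\<bar> + d)" using that b(1) d_pos by (simp add: field_simps)
    finally show ?thesis .
  qed
  have W_coeff: "1 + C / d \<ge> 0" using b(1) d_pos by simp
  have cons: "(LINT x|lborel. \<psi> x * (K ^^ n) f x) = (LINT x|lborel. \<psi> x * f x)" for n
  proof (induction n)
    case (Suc n)
    have "(LINT x|lborel. \<psi> x * K ((K ^^ n) f) x) = (LINT y|lborel. K \<psi> y * (K ^^ n) f y)"
      by (rule K_weighted_pairing(2)[OF weight_half_space K_pow_half_line[OF admissible_half_line[OF f]] _ \<psi>(1) \<psi>b W_coeff])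
         (use K_pow_weighted[OF weight_half_space admissible_half_line[OF f] admissible_linear_int(3)[OF f], of n] in auto)
    then show ?case using Suc by (simp add: \<psi>(2))
  qed simp
  note sp = K_series_pairing[OF weight_half_space admissible_half_line[OF f] C' admissible_linear_int(3)[OF f] poisson_abs_summable[OF t] poisson_power_summable[OF t] half_line_fun_meas[OF \<psi>(1)] \<psi>b]
  have "(\<lambda>n. poisson_weight t n * (LINT x|lborel. \<psi> x * f x)) sums (LINT x|lborel. \<psi> x * S t f x)"
    using sp(2) unfolding cons S_def .
  moreover have "(\<lambda>n. poisson_weight t n * (LINT x|lborel. \<psi> x * f x)) sums (1 * (LINT x|lborel. \<psi> x * f x))"
    by (intro sums_mult2 poisson_weight_sums)
  ultimately show e: "(LINT x|lborel. \<psi> x * S t f x) = (LINT x|lborel. \<psi> x * f x)" by (simp add: sums_iff)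
  show i: "integrable lborel (\<lambda>x. \<psi> x * S t f x)" using sp(1) unfolding S_def .
  note a = admissible_S[OF f t]
  have eq: "(LINT y|lborel. y * S t f y) - (LINT x|lborel. \<psi> x * f x) = (LINT y|lborel. y * S t f y - \<psi> y * S t f y)"
    unfolding e[symmetric] using admissible_linear_int(1)[OF a] i by simp
  have "\<bar>(LINT y|lborel. y * S t f y) - (LINT x|lborel. \<psi> x * f x)\<bar> \<le> (LINT y|lborel. \<bar>y * S t f y - \<psi> y * S t f y\<bar>)"
    unfolding eq by (rule integral_abs_bound)
  also have "\<dots> \<le> (LINT y|lborel. C * \<bar>S t f y\<bar>)"
  proof (intro integral_mono integrable_abs Bochner_Integration.integrable_diff admissible_linear_int(1)[OF a] i integrable_mult_right admissible_int a)
    fix y show "\<bar>y * S t f y - \<psi> y * S t f y\<bar> \<le> C * \<bar>S t f y\<bar>"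
    proof (cases "y < 0")
      case False
      then have "\<bar>y - \<psi> y\<bar> \<le> C" using b(2)[of y] by (subst abs_minus_commute) simp
      then have "\<bar>y - \<psi> y\<bar> * \<bar>S t f y\<bar> \<le> C * \<bar>S t f y\<bar>" by (rule mult_right_mono) simp
      moreover have "y * S t f y - \<psi> y * S t f y = (y - \<psi> y) * S t f y" by (simp add: left_diff_distrib)
      ultimately show ?thesis by (simp only: abs_mult)
    qed (simp add: half_line_fun_neg[OF admissible_half_line[OF a]])
  qed
  finally show "\<bar>(LINT y|lborel. y * S t f y) - (LINT x|lborel. \<psi> x * f x)\<bar> \<le> C * (LINT y|lborel. \<bar>S t f y\<bar>)" by simp
qed

text \<open>Mass beyond \<open>R\<close> is at most \<open>mom1 f / R\<close> because
  \<open>mom1\<close> does not increase; on the fixed interval up to \<open>R\<close> the pointwise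
  bound decays.\<close>

lemma S_mass_tendsto_0:
  assumes f: "admissible f" shows "((\<lambda>t. LINT x|lborel. \<bar>S t f x\<bar>) \<longlongrightarrow> 0) at_top"
proof (rule tendstoI)
  fix \<epsilon> :: real assume eps: "\<epsilon> > 0"
  obtain C where C: "\<And>x. \<bar>f x\<bar> \<le> C" using admissible_bdd f by metis
  obtain D T0 where D: "D > 0" "T0 > 0" "\<And>s. s \<ge> T0 \<Longrightarrow> sym_norm s \<le> D * s powr (- (3/2))" by (rule sym_norm_asymp, rule that)
  define N where "N = mom1 f"
  have N: "N \<ge> 0" by (simp add: N_def mom1_nonneg)
  define R where "R = 2 * N / \<epsilon> + 1"
  have R: "R > 0" "N / R < \<epsilon> / 2" using eps N by (auto simp: R_def field_simps add_nonneg_pos)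
  define A where "A = (R + d) * N * D / pi"
  define b where "b t = exp (- t) * C + A * t powr (- (3/2))" for t
  have "((\<lambda>t. R * b t) \<longlongrightarrow> 0) at_top" unfolding b_def by real_asymp
  then have "\<forall>\<^sub>F t in at_top. R * b t < \<epsilon> / 2" using eps by (intro order_tendstoD) auto
  then show "\<forall>\<^sub>F t in at_top. dist (LINT x|lborel. \<bar>S t f x\<bar>) 0 < \<epsilon>"
    using eventually_ge_at_top[of T0]
  proof eventually_elim
    case (elim t)
    have t: "t > 0" using elim D by simp
    note a = admissible_S[OF f less_imp_le[OF t]]
    have pw: "\<bar>S t f x\<bar> \<le> indicator {0..R} x * b t + half_weight x * \<bar>S t f x\<bar> / R" for x
    proof -
      consider "x < 0" | "0 \<le> x" "x \<le> R" | "x > R" by linarith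
      then show ?thesis
      proof cases
        case 1 then show ?thesis using half_line_fun_neg[OF admissible_half_line[OF a]] by simp
      next
        case 2
        have "\<bar>S t f x\<bar> \<le> exp (- t) * \<bar>f x\<bar> + (x + d) * mom1 f * sym_norm t / pi"
          by (rule S_pointwise_bound[OF f t 2(1)])
        also have "\<dots> \<le> exp (- t) * C + (R + d) * N * (D * t powr (- (3/2))) / pi"
          unfolding N_def using 2 d_pos elim sym_norm_nonneg mom1_nonneg
          by (intro add_mono mult_left_mono divide_right_mono mult_mono C D) auto
        also have "\<dots> = b t" by (simp add: b_def A_def)
        finally show ?thesis using 2 R d_pos by (simp add: add_increasing2)
      next
        case 3
        then have "R * \<bar>S t f x\<bar> \<le> half_weight x * \<bar>S t f x\<bar>" using R d_pos by (intro mult_right_mono) auto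
        then show ?thesis using 3 R by (simp add: field_simps)
      qed
    qed
    have "integrable lborel (indicat_real {0..R})"
      by (rule integrable_real_indicator) (auto simp: emeasure_lborel_Icc_eq)
    then have i: "integrable lborel (\<lambda>x. indicator {0..R} x * b t)" "integrable lborel (\<lambda>x. half_weight x * \<bar>S t f x\<bar> / R)"
      using admissible_linear_int(3)[OF admissible_abs[OF a]] by auto
    have "(LINT x|lborel. \<bar>S t f x\<bar>) \<le> (LINT x|lborel. indicator {0..R} x * b t + half_weight x * \<bar>S t f x\<bar> / R)"
      by (intro integral_mono integrable_abs admissible_int a Bochner_Integration.integrable_add i pw)
    also have "\<dots> = R * b t + mom1 (S t f) / R"
      using i R by (simp add: mom1_def)
    also have "\<dots> \<le> R * b t + N / R"
      using mom1_S_le[OF f less_imp_le[OF t]] R by (simp add: N_def divide_right_mono)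
    also have "\<dots> < \<epsilon>" using elim(1) R(2) by linarith
    finally show ?case by (simp add: abs_of_nonneg)
  qed
qed

subsection \<open>Far and near field\<close>

lemma far_err_asymp: "((\<lambda>s. s powr (3/2) * far_err f s) \<longlongrightarrow> 0) at_top"
proof -
  have "((\<lambda>s. s powr (3/2) * (r * s) powr (- 2)) \<longlongrightarrow> 0) at_top" if "r > 0" for r :: real
    using that by real_asymp
  note 1 = this[OF q_pos]
  have "((\<lambda>s. (mom1 f * (s powr (3/2) * sym_err s) + mom2 f * (gauss_moment 3 * (s powr (3/2) * (q * s) powr (- 2)))) / pi)
      \<longlongrightarrow> (mom1 f * 0 + mom2 f * (gauss_moment 3 * 0)) / pi) at_top"
    by (intro tendsto_intros sym_err_asymp 1) simp
  then show ?thesis by (simp add: far_err_def algebra_simps)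
qed

lemma far_err_shift_asymp: "((\<lambda>t. t powr (3/2) * far_err f (t - \<tau>)) \<longlongrightarrow> 0) at_top"
proof -
  have 1: "((\<lambda>t. (t - \<tau>) powr (3/2) * far_err f (t - \<tau>)) \<longlongrightarrow> 0) at_top"
    by (rule filterlim_compose[OF far_err_asymp]) real_asymp
  have 2: "((\<lambda>t. t powr (3/2) / (t - \<tau>) powr (3/2)) \<longlongrightarrow> 1) at_top" by real_asymp
  have "\<forall>\<^sub>F t in at_top. (t powr (3/2) / (t - \<tau>) powr (3/2)) * ((t - \<tau>) powr (3/2) * far_err f (t - \<tau>)) = t powr (3/2) * far_err f (t - \<tau>)"
    using eventually_gt_at_top[of \<tau>] by eventually_elim auto
  from Lim_transform_eventually[OF tendsto_mult[OF 2 1] this] show ?thesis by simp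
qed

definition moment_wrt :: "(real \<Rightarrow> real) \<Rightarrow> (real \<Rightarrow> real) \<Rightarrow> real" where
  "moment_wrt \<psi> f = (LINT x|lborel. \<psi> x * f x)"

text \<open>The limit of t^(3/2) W(x, t) / x as t tends to infinity, for x different from 0; compare
  \<open>W_scaled\<close>.\<close>

definition W_coeff :: real where "W_coeff = sqrt (pi / q) / (2 * q * pi)"

lemma W_coeff_pos: "W_coeff > 0" using q_pos by (simp add: W_coeff_def)

lemma W_scaled:
  assumes t: "t > 0" shows "t powr (3/2) * W x t = x * W_coeff * exp (- (x\<^sup>2 / (4 * (q * t))))"
proof -
  have "t powr (3/2) = t * sqrt t"
    using t powr_add[of t 1 "1/2"] by (simp add: powr_half_sqrt)
  moreover have "sqrt (pi / (q * t)) = sqrt (pi / q) / sqrt t" by (simp add: real_sqrt_divide real_sqrt_mult)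
  ultimately show ?thesis unfolding W_eq[OF t] W_coeff_def using t by simp
qed

lemma gauss_defect: "a \<ge> 0 \<Longrightarrow> 0 \<le> 1 - exp (- a) \<and> 1 - exp (- a) \<le> a" for a :: real
  using exp_ge_add_one_self[of "- a"] by auto

context
  fixes f \<psi> :: "real \<Rightarrow> real" and C\<psi> :: real
  assumes f: "admissible f"
    and sg: "\<And>\<tau> t. 0 \<le> \<tau> \<Longrightarrow> \<tau> \<le> t \<Longrightarrow> AE x in lborel. S t f x = S (t - \<tau>) (S \<tau> f) x"
    and \<psi>: "half_line_fun \<psi>" "\<And>x. K \<psi> x = \<psi> x"
    and C\<psi>: "C\<psi> \<ge> 0" "\<And>x. x \<ge> 0 \<Longrightarrow> \<bar>\<psi> x - x\<bar> \<le> C\<psi>"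
begin

text \<open>The generator commutes with the semigroup, so it can be applied at a fixed time
  \<open>\<tau>\<close>, where it gains the factor \<open>1 / sqrt \<tau>\<close> in the weighted
  norm; evolving for the remaining time adds the rate t^(-3/2). A large \<open>\<tau>\<close>, fixed
  before t, makes the constant small.\<close>

lemma generator_decay:
  assumes X: "X \<ge> 0" and del: "\<delta> > 0"
  shows "\<forall>\<^sub>F t in at_top. AE x in lborel. 0 \<le> x \<and> x \<le> X \<longrightarrow> t powr (3/2) * \<bar>K (S t f) x - S t f x\<bar> \<le> \<delta>"
proof -
  obtain C where C: "\<And>x. \<bar>f x\<bar> \<le> C" using admissible_bdd f by metis
  obtain D T0 where D: "D > 0" "T0 > 0" "\<And>s. s \<ge> T0 \<Longrightarrow> sym_norm s \<le> D * s powr (- (3/2))" by (rule sym_norm_asymp, rule that)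
  define N where "N = mom1 f"
  have N: "N \<ge> 0" by (simp add: N_def mom1_nonneg)
  define A where "A = (X + d) * N * D / pi"
  have A: "A \<ge> 0" using X d_pos N D by (simp add: A_def)
  \<comment> \<open>\<open>A / r\<close> is the limiting constant when
    \<open>\<tau> = r\<^sup>2\<close>; this choice pushes it below
    \<open>\<delta> / 2\<close>.\<close>
  define r where "r = 2 * A / \<delta> + 1"
  have r: "r > 0" "A / r < \<delta> / 2" using A del by (auto simp: r_def field_simps add_nonneg_pos)
  define \<tau> where "\<tau> = r\<^sup>2"
  have \<tau>: "\<tau> > 0" "sqrt \<tau> = r" using r by (auto simp: \<tau>_def)
  note a = admissible_S[OF f less_imp_le[OF \<tau>(1)]]
  define g where "g x = K (S \<tau> f) x - S \<tau> f x" for x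
  have g: "admissible g" unfolding g_def[abs_def] by (rule admissible_diff[OF admissible_K[OF a] a])
  have Sb: "\<bar>S \<tau> f x\<bar> \<le> C" for x by (rule S_bdd[OF admissible_half_line[OF f] C less_imp_le[OF \<tau>(1)]])
  have KSb: "\<bar>K (S \<tau> f) x\<bar> \<le> C" for x by (rule K_bdd[OF admissible_meas[OF a] Sb])
  have gb: "\<bar>g x\<bar> \<le> 2 * C" for x using Sb[of x] KSb[of x] unfolding g_def by linarith
  have "mom1 g \<le> 1 / sqrt \<tau> * N"
    unfolding mom1_def g_def N_def by (rule S_generator[OF admissible_half_line[OF f] C \<tau>(1) admissible_linear_int(3)[OF f]])
  then have mg: "mom1 g \<le> N / r" by (simp add: \<tau>)
  define E where "E = A / r"
  have "((\<lambda>t. t powr (3/2) * (exp (- (t - \<tau>)) * (2 * C) + E * (t - \<tau>) powr (- (3/2)))) \<longlongrightarrow> E) at_top"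
    by real_asymp
  moreover have "E < \<delta>" unfolding E_def using r(2) del by linarith
  ultimately have "\<forall>\<^sub>F t in at_top. t powr (3/2) * (exp (- (t - \<tau>)) * (2 * C) + E * (t - \<tau>) powr (- (3/2))) < \<delta>"
    by (rule order_tendstoD)
  then show ?thesis
    using eventually_ge_at_top[of "\<tau> + T0"]
  proof eventually_elim
    case (elim t)
    note lt = elim(1)
    define s where "s = t - \<tau>"
    have s: "s > 0" "s \<ge> T0" using elim D by (auto simp: s_def)
    have "\<tau> \<le> t" using elim D by simp
    note ae = sg[OF less_imp_le[OF \<tau>(1)] this, folded s_def]
    have pas: "summable (\<lambda>n. \<bar>poisson_weight s n\<bar>)" using s by (intro poisson_abs_summable) simp
    \<comment> \<open>The semigroup law is known almost everywhere only, but under \<open>K\<close>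
      it becomes an identity at every point.\<close>
    have Keq: "K (S t f) x = S s (K (S \<tau> f)) x" for x
    proof -
      have "K (S t f) x = K (S s (S \<tau> f)) x"
        by (rule K_cong_AE[OF admissible_meas[OF admissible_S[OF f]] admissible_meas[OF admissible_S[OF a]] ae])
           (use \<open>\<tau> \<le> t\<close> \<tau> s in auto)
      then show ?thesis unfolding S_def[of s] using K_commutes_K_series(1)[OF admissible_half_line[OF a] Sb pas] by simp
    qed
    show ?case
      using ae
    proof eventually_elim
      case (elim x)
      have "K (S t f) x - S t f x = S s g x"
        unfolding Keq elim g_def[abs_def] S_def[of s]
        by (rule K_series_diff[symmetric, OF admissible_half_line[OF admissible_K[OF a]] KSb admissible_half_line[OF a] Sb pas])
      then have eq: "\<bar>K (S t f) x - S t f x\<bar> = \<bar>S s g x\<bar>" by simp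
      show ?case
      proof (intro impI, elim conjE)
        assume x: "0 \<le> x" "x \<le> X"
        have "\<bar>S s g x\<bar> \<le> exp (- s) * \<bar>g x\<bar> + (x + d) * mom1 g * sym_norm s / pi"
          by (rule S_pointwise_bound[OF g s(1) x(1)])
        also have "\<dots> \<le> exp (- s) * (2 * C) + (X + d) * (N / r) * (D * s powr (- (3/2))) / pi"
          using x d_pos X N r sym_norm_nonneg mom1_nonneg
          by (intro add_mono mult_left_mono gb divide_right_mono mult_mono D mg s) auto
        also have "\<dots> = exp (- s) * (2 * C) + E * s powr (- (3/2))" by (simp add: E_def A_def mult_ac)
        finally have "\<bar>S s g x\<bar> \<le> exp (- s) * (2 * C) + E * s powr (- (3/2))" .
        then have "t powr (3/2) * \<bar>S s g x\<bar> \<le> t powr (3/2) * (exp (- s) * (2 * C) + E * s powr (- (3/2)))"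
          by (rule mult_left_mono) simp
        then show "t powr (3/2) * \<bar>K (S t f) x - S t f x\<bar> \<le> \<delta>"
          unfolding eq using lt by (simp add: s_def)
      qed
    qed
  qed
qed

abbreviation M :: real where "M \<equiv> moment_wrt \<psi> f"

text \<open>The order of choices is decisive. \<open>X\<close> absorbs the part of the barrier gap
  proportional to the first moment, which need not decay in \<open>\<tau>\<close> but is divided by
  x + 1; a large \<open>\<tau>\<close> makes the mass small; t goes to infinity last, so that
  \<open>far_err\<close> of the fixed datum \<open>S \<tau> f\<close> disappears. The bound
  \<open>N\<close> on \<open>mom1\<close> is uniform in \<open>\<tau>\<close>, hence
  \<open>X\<close> does not depend on it.\<close>

lemma far_field:
  assumes eps: "\<epsilon> > 0"
  obtains X where "X \<ge> X0" "X \<ge> 0"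
    "\<forall>\<^sub>F t in at_top. AE x in lborel. X \<le> x \<longrightarrow> t powr (3/2) * \<bar>S t f x - M * W x t\<bar> \<le> \<epsilon> * (x + 1)"
proof -
  obtain C where C: "\<And>x. \<bar>f x\<bar> \<le> C" using admissible_bdd f by metis
  have Cnn: "C \<ge> 0" using order_trans[OF abs_ge_zero C] .
  define N where "N = mom1 f"
  have N: "N \<ge> 0" by (simp add: N_def mom1_nonneg)
  define k1 where "k1 = W_slope 1"
  have k1: "k1 \<ge> 0" by (simp add: k1_def W_slope_nonneg)
  \<comment> \<open>Coefficient of the mass: \<open>d * (1 + d)\<close> from the barrier gap, with x
    + d <= (1 + d)(x + 1), and \<open>C\<psi>\<close> from replacing the moment of
    \<open>S \<tau> f\<close> by \<open>M\<close>.\<close>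
  define P where "P = d * (1 + d) + C\<psi>"
  have P: "P \<ge> 0" using d_pos C\<psi> by (simp add: P_def)
  define X where "X = max (max X0 0) (3 * k1 * d * N / \<epsilon>)"
  have X: "X \<ge> X0" "X \<ge> 0" by (auto simp: X_def)
  have "3 * k1 * d * N / \<epsilon> < X + 1" by (simp add: X_def)
  then have XX: "k1 * (d * N / (X + 1)) < \<epsilon> / 3" using eps X by (simp add: field_simps)
  have "((\<lambda>\<tau>. k1 * P * (LINT x|lborel. \<bar>S \<tau> f x\<bar>)) \<longlongrightarrow> 0) at_top"
    using tendsto_mult_right_zero[OF S_mass_tendsto_0[OF f]] .
  then have "\<forall>\<^sub>F \<tau> in at_top. k1 * P * (LINT x|lborel. \<bar>S \<tau> f x\<bar>) < \<epsilon> / 3"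
    using eps by (intro order_tendstoD) auto
  then have "\<forall>\<^sub>F \<tau> in at_top. k1 * P * (LINT x|lborel. \<bar>S \<tau> f x\<bar>) < \<epsilon> / 3 \<and> \<tau> \<ge> 0"
    using eventually_ge_at_top[of 0] by eventually_elim auto
  then obtain \<tau> where \<tau>: "k1 * P * (LINT x|lborel. \<bar>S \<tau> f x\<bar>) < \<epsilon> / 3" "\<tau> \<ge> 0"
    unfolding eventually_at_top_linorder by blast
  define g where "g = S \<tau> f"
  define n where "n = (LINT x|lborel. \<bar>g x\<bar>)"
  have g: "admissible g" unfolding g_def by (rule admissible_S[OF f \<tau>(2)])
  have gb: "\<bar>g x\<bar> \<le> C" for x unfolding g_def by (rule S_bdd[OF admissible_half_line[OF f] C \<tau>(2)])
  have n: "n \<ge> 0" unfolding n_def by (intro Bochner_Integration.integral_nonneg) auto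
  have mg: "mom1 g \<le> N" unfolding g_def N_def by (rule mom1_S_le[OF f \<tau>(2)])
  define m where "m = (LINT y|lborel. y * g y)"
  have mM: "\<bar>m - M\<bar> \<le> C\<psi> * n"
    unfolding m_def n_def g_def moment_wrt_def by (rule S_moment_conserved(3)[OF f \<tau>(2) \<psi> C\<psi>])
  \<comment> \<open>What survives the limit in t, per unit of x + 1 and up to the factor
    \<open>k1\<close>; the first term is made small by \<open>X\<close>, the second by
    \<open>\<tau>\<close>.\<close>
  define A where "A = d * N / (X + 1) + P * n"
  have A: "k1 * A < \<epsilon>"
  proof -
    have "k1 * A = k1 * (d * N / (X + 1)) + k1 * P * n" unfolding A_def by (simp only: distrib_left mult.assoc)
    then show ?thesis using XX \<tau>(1) eps unfolding n_def g_def by linarith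
  qed
  have Ann: "A \<ge> 0" using d_pos N X P n by (simp add: A_def)
  \<comment> \<open>All errors except \<open>far_err\<close>: the singular part, the surviving part,
    and the change of time from t - \<tau> to t in \<open>W\<close>.\<close>
  define H where "H t = exp (- (t - \<tau>)) * C + k1 * (t - \<tau>) powr (- (3/2)) * A
      + \<bar>M\<bar> * (k1 * (t - \<tau>) powr (- (3/2)) - k1 * t powr (- (3/2)))" for t
  have "((\<lambda>t. t powr (3/2) * (exp (- (t - \<tau>)) * C + k1 * (t - \<tau>) powr (- (3/2)) * A
      + m0 * (k1 * (t - \<tau>) powr (- (3/2)) - k1 * t powr (- (3/2))))) \<longlongrightarrow> k1 * A) at_top" for m0
    by real_asymp
  then have "((\<lambda>t. t powr (3/2) * H t) \<longlongrightarrow> k1 * A) at_top" unfolding H_def .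
  from tendsto_add[OF this tendsto_mult_right_zero[OF far_err_shift_asymp[of g \<tau>], of "1 + d"]]
  have "((\<lambda>t. t powr (3/2) * H t + (1 + d) * (t powr (3/2) * far_err g (t - \<tau>))) \<longlongrightarrow> k1 * A) at_top" by simp
  then have ev: "\<forall>\<^sub>F t in at_top. t powr (3/2) * H t + (1 + d) * (t powr (3/2) * far_err g (t - \<tau>)) < \<epsilon>"
    using A by (rule order_tendstoD)
  show thesis
  proof (rule that[OF X])
    show "\<forall>\<^sub>F t in at_top. AE x in lborel. X \<le> x \<longrightarrow> t powr (3/2) * \<bar>S t f x - M * W x t\<bar> \<le> \<epsilon> * (x + 1)"
      using ev eventually_gt_at_top[of \<tau>]
    proof eventually_elim
      case (elim t)
      note lt = elim(1)
      define s where "s = t - \<tau>"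
      have s: "s > 0" "s \<le> t" and t: "t > 0" using elim \<tau> by (auto simp: s_def)
      have ks: "W_slope s = k1 * s powr (- (3/2))" "W_slope t = k1 * t powr (- (3/2))"
        using W_slope_eq[OF s(1)] W_slope_eq[OF t] by (simp_all add: k1_def)
      have "\<tau> \<le> t" using elim by simp
      from sg[OF \<tau>(2) this] show ?case
      proof eventually_elim
        case (elim x)
        show ?case
        proof
          assume "X \<le> x"
          then have x: "x \<ge> 0" "X + 1 \<le> x + 1" using X by auto
          have e: "S t f x = S s g x" using elim by (simp add: s_def g_def)
          have b1: "\<bar>S s g x - W x s * m\<bar> \<le> exp (- s) * \<bar>g x\<bar> + (x + d) * far_err g s + d * W_slope s * (mom1 g + (x + d) * n)"
            unfolding m_def n_def by (rule S_far[OF g s(1) x(1)])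
          have b2: "\<bar>W x s * (m - M)\<bar> \<le> x * W_slope s * (C\<psi> * n)"
            unfolding abs_mult using W_bound[OF s(1), of x] x mM W_slope_nonneg by (intro mult_mono) auto
          have b3: "\<bar>M * (W x s - W x t)\<bar> \<le> \<bar>M\<bar> * (x * (W_slope s - W_slope t))"
            unfolding abs_mult using W_time[OF s, of x] x by (intro mult_left_mono) auto
          have kd: "W_slope s - W_slope t \<ge> 0"
          proof -
            have "t powr (- (3/2)) \<le> s powr (- (3/2))" using s by (intro powr_mono2') auto
            then show ?thesis unfolding ks using k1 by (simp add: mult_left_mono)
          qed
          have "S t f x - M * W x t = (S s g x - W x s * m) + W x s * (m - M) + M * (W x s - W x t)"
            unfolding e by (simp add: algebra_simps)
          then have "\<bar>S t f x - M * W x t\<bar> \<le> \<bar>S s g x - W x s * m\<bar> + \<bar>W x s * (m - M)\<bar> + \<bar>M * (W x s - W x t)\<bar>"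
            by linarith
          also have "\<dots> \<le> (exp (- s) * \<bar>g x\<bar> + (x + d) * far_err g s + d * W_slope s * (mom1 g + (x + d) * n))
              + x * W_slope s * (C\<psi> * n) + \<bar>M\<bar> * (x * (W_slope s - W_slope t))"
            using b1 b2 b3 by linarith
          also have "\<dots> \<le> (x + 1) * (exp (- s) * C) + ((1 + d) * (x + 1)) * far_err g s
              + ((x + 1) * (W_slope s * (d * N / (X + 1))) + (W_slope s * d * n) * ((1 + d) * (x + 1)))
              + (x + 1) * (W_slope s * (C\<psi> * n)) + (x + 1) * (\<bar>M\<bar> * (W_slope s - W_slope t))"
          proof (intro add_mono)
            have "exp (- s) * \<bar>g x\<bar> \<le> 1 * (exp (- s) * C)" using gb[of x] by simp
            also have "\<dots> \<le> (x + 1) * (exp (- s) * C)" using x Cnn by (intro mult_right_mono) auto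
            finally show "exp (- s) * \<bar>g x\<bar> \<le> (x + 1) * (exp (- s) * C)" .
            have xd: "x + d \<le> (1 + d) * (x + 1)" using x d_pos by (simp add: algebra_simps)
            then show "(x + d) * far_err g s \<le> ((1 + d) * (x + 1)) * far_err g s"
              by (rule mult_right_mono[OF _ far_err_nonneg])
            have "d * W_slope s * mom1 g \<le> 1 * (W_slope s * (d * N))"
              using mult_left_mono[OF mg, of "d * W_slope s"] d_pos W_slope_nonneg[of s] by (simp add: mult_ac)
            also have "\<dots> \<le> (x + 1) / (X + 1) * (W_slope s * (d * N))"
              using x X d_pos W_slope_nonneg[of s] N by (intro mult_right_mono) auto
            finally have m1: "d * W_slope s * mom1 g \<le> (x + 1) * (W_slope s * (d * N / (X + 1)))" by simp
            have "(W_slope s * d * n) * (x + d) \<le> (W_slope s * d * n) * ((1 + d) * (x + 1))"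
              using d_pos W_slope_nonneg[of s] n by (intro mult_left_mono xd) auto
            moreover have "d * W_slope s * (mom1 g + (x + d) * n) = d * W_slope s * mom1 g + (W_slope s * d * n) * (x + d)"
              by (simp add: algebra_simps)
            ultimately show "d * W_slope s * (mom1 g + (x + d) * n) \<le> (x + 1) * (W_slope s * (d * N / (X + 1))) + (W_slope s * d * n) * ((1 + d) * (x + 1))"
              using m1 by linarith
            have "x * (W_slope s * (C\<psi> * n)) \<le> (x + 1) * (W_slope s * (C\<psi> * n))"
              using W_slope_nonneg[of s] C\<psi> n by (intro mult_right_mono) auto
            then show "x * W_slope s * (C\<psi> * n) \<le> (x + 1) * (W_slope s * (C\<psi> * n))" by (simp add: mult.assoc)
            have "x * (\<bar>M\<bar> * (W_slope s - W_slope t)) \<le> (x + 1) * (\<bar>M\<bar> * (W_slope s - W_slope t))"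
              using kd by (intro mult_right_mono) auto
            then show "\<bar>M\<bar> * (x * (W_slope s - W_slope t)) \<le> (x + 1) * (\<bar>M\<bar> * (W_slope s - W_slope t))"
              by (simp add: mult.left_commute)
          qed
          also have "\<dots> = (x + 1) * (H t + (1 + d) * far_err g s)"
            unfolding H_def A_def P_def s_def[symmetric] ks by (simp add: algebra_simps)
          finally have "t powr (3/2) * \<bar>S t f x - M * W x t\<bar> \<le> t powr (3/2) * ((x + 1) * (H t + (1 + d) * far_err g s))"
            by (rule mult_left_mono) simp
          also have "\<dots> = (x + 1) * (t powr (3/2) * H t + (1 + d) * (t powr (3/2) * far_err g s))"
            by (simp add: algebra_simps)
          also have "\<dots> \<le> (x + 1) * \<epsilon>"
            using lt x by (intro mult_left_mono) (auto simp: s_def)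
          finally show "t powr (3/2) * \<bar>S t f x - M * W x t\<bar> \<le> \<epsilon> * (x + 1)" by (simp add: mult.commute)
        qed
      qed
    qed
  qed
qed

text \<open>\<open>\<psi>\<close> is unbounded, but the support of \<open>J\<close> confines y to y
  < x + d.\<close>

lemma J_stationary_int: assumes "x \<ge> 0" shows "integrable lborel (\<lambda>y. J (x - y) * \<psi> y)"
proof -
  have [measurable]: "\<psi> \<in> borel_measurable borel" by (rule half_line_fun_meas[OF \<psi>(1)])
  show ?thesis
  proof (rule Bochner_Integration.integrable_bound[OF integrable_mult_right[OF J_reflect_int[of x], of "x + d + C\<psi>"]])
    show "AE y in lborel. norm (J (x - y) * \<psi> y) \<le> norm ((x + d + C\<psi>) * J (x - y))"
    proof (rule AE_I2)
      fix y
      have "\<bar>\<psi> y\<bar> \<le> x + d + C\<psi>" if "\<bar>x - y\<bar> < d"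
        using C\<psi>(1) C\<psi>(2)[of y] half_line_fun_neg[OF \<psi>(1), of y] that assms by (cases "y < 0") auto
      then have "\<bar>\<psi> y\<bar> * J (x - y) \<le> (x + d + C\<psi>) * J (x - y)"
        using J_supp[of "x - y"] J_nonneg[of "x - y"] by (cases "\<bar>x - y\<bar> < d") (auto intro: mult_right_mono)
      moreover have "\<bar>x + d + C\<psi>\<bar> = x + d + C\<psi>" using assms d_pos C\<psi>(1) by simp
      ultimately show "norm (J (x - y) * \<psi> y) \<le> norm ((x + d + C\<psi>) * J (x - y))"
        using J_nonneg[of "x - y"] by (simp add: abs_mult mult.commute)
    qed
  qed measurable
qed

text \<open>Beyond \<open>X\<close> the far field applies, as replacing \<open>\<psi> x\<close> by x
  is cheap there. On [0, X] the rescaled difference to the stationary profile nearly solves the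
  stationary equation, vanishes for x < 0 and is small on the collar by the far field, so the
  maximum principle bounds it from both sides.\<close>

lemma semigroup_asymptotics:
  assumes eps: "\<epsilon> > 0"
  shows "\<forall>\<^sub>F t in at_top. AE x in lborel. 0 < x \<longrightarrow> t powr (3/2) * \<bar>S t f x - M * (\<psi> x / x * W x t)\<bar> \<le> \<epsilon> * (x + 1)"
proof -
  obtain C where C: "\<And>x. \<bar>f x\<bar> \<le> C" using admissible_bdd f by metis
  \<comment> \<open>Budget: near the boundary the contributions add up to at most (5 + 3d) h (x +
    1), in the far field to 2h (x + 1).\<close>
  define h where "h = \<epsilon> / (6 + 3 * d)"
  have h: "h > 0" using eps d_pos by (simp add: h_def)
  have heps: "(5 + 3 * d) * h \<le> \<epsilon>" "2 * h \<le> \<epsilon>" using eps d_pos by (auto simp: h_def field_simps)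
  define G where "G = \<bar>M\<bar> * W_coeff"
  have G: "G \<ge> 0" using W_coeff_pos by (simp add: G_def)
  \<comment> \<open>The lower bound on \<open>X\<close> makes the cost of replacing x by
    \<open>\<psi> x\<close>, at most \<open>G * C\<psi>\<close>, no larger than h (x + 1) beyond
    \<open>X\<close>.\<close>
  obtain X where X: "X \<ge> G * C\<psi> / h" "X \<ge> 0"
    and far: "\<forall>\<^sub>F t in at_top. AE x in lborel. X \<le> x \<longrightarrow> t powr (3/2) * \<bar>S t f x - M * W x t\<bar> \<le> h * (x + 1)"
    by (rule far_field[OF h, of "G * C\<psi> / h"], rule that)
  have GX: "G * C\<psi> \<le> h * (x + 1)" if "x \<ge> X" for x
  proof -
    have "G * C\<psi> \<le> h * X" using X(1) h by (simp add: field_simps)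
    also have "\<dots> \<le> h * (x + 1)" using that h by (intro mult_left_mono) auto
    finally show ?thesis .
  qed
  define Y where "Y = X + d"
  have Y: "Y > 0" using X d_pos by (simp add: Y_def)
  \<comment> \<open>Chosen so that the quadratic part of the barrier is at most
    \<open>h\<close>.\<close>
  define \<delta> where "\<delta> = h * q / Y\<^sup>2"
  have del: "\<delta> > 0" "\<delta> / q * Y\<^sup>2 = h" using h q_pos Y by (auto simp: \<delta>_def)
  \<comment> \<open>\<open>L / t\<close> bounds the error of dropping the Gaussian factor of
    \<open>W\<close> on [0, Y].\<close>
  define L where "L = G * (Y + C\<psi>) * Y\<^sup>2 / (4 * q)"
  have "((\<lambda>t. L / t) \<longlongrightarrow> 0) at_top" by real_asymp
  then have Lev: "\<forall>\<^sub>F t in at_top. L / t < h" using h by (intro order_tendstoD) auto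
  show ?thesis
    using far generator_decay[OF X(2) del(1)] Lev eventually_gt_at_top[of 0]
  proof eventually_elim
    case (elim t)
    have t: "t > 0" and Lt: "L / t < h" by fact+
    define E where "E x = exp (- (x\<^sup>2 / (4 * (q * t))))" for x
    have WE: "t powr (3/2) * W x t = x * W_coeff * E x" for x unfolding E_def by (rule W_scaled[OF t])
    have E01: "0 \<le> 1 - E x" "1 - E x \<le> x\<^sup>2 / (4 * (q * t))" "E x \<le> 1" "E x \<ge> 0" for x
      using gauss_defect[of "x\<^sup>2 / (4 * (q * t))"] t q_pos by (auto simp: E_def)
    have defect: "G * (Y + C\<psi>) * (1 - E x) \<le> h" if "0 \<le> x" "x \<le> Y" for x
    proof -
      have "x\<^sup>2 \<le> Y\<^sup>2" using that by (intro power_mono) auto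
      then have "x\<^sup>2 / (4 * (q * t)) \<le> Y\<^sup>2 / (4 * (q * t))" using t q_pos by (intro divide_right_mono) auto
      with E01(2)[of x] have "1 - E x \<le> Y\<^sup>2 / (4 * (q * t))" by linarith
      then have "G * (Y + C\<psi>) * (1 - E x) \<le> G * (Y + C\<psi>) * (Y\<^sup>2 / (4 * (q * t)))"
        using G Y C\<psi> by (intro mult_left_mono) auto
      also have "\<dots> = L / t" using t q_pos by (simp add: L_def)
      finally show ?thesis using Lt by linarith
    qed
    \<comment> \<open>For bounded x the factor \<open>E x\<close> tends to 1, so the expected limit
      of the rescaled solution is the exactly stationary
      \<open>M * W_coeff * \<psi> x\<close>.\<close>
    define e where "e x = t powr (3/2) * S t f x - M * W_coeff * \<psi> x" for x
    have hS: "half_line_fun (S t f)" by (rule S_half_line[OF admissible_half_line[OF f]])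
    have [measurable]: "S t f \<in> borel_measurable borel" "\<psi> \<in> borel_measurable borel"
      using half_line_fun_meas[OF hS] half_line_fun_meas[OF \<psi>(1)] by auto
    have Sb: "\<bar>S t f x\<bar> \<le> C" for x by (rule S_bdd[OF admissible_half_line[OF f] C]) (use t in simp)
    have "e \<in> borel_measurable borel" unfolding e_def[abs_def] by measurable
    then have ehl: "half_line_fun e" "half_line_fun (\<lambda>x. - e x)"
      using half_line_fun_neg[OF hS] half_line_fun_neg[OF \<psi>(1)] unfolding half_line_fun_def
      by (auto simp: e_def[of "_ :: real"])
    have \<psi>abs: "\<bar>\<psi> x\<bar> \<le> Y + C\<psi>" if "x \<le> Y" for x
      using C\<psi>(1) C\<psi>(2)[of x] half_line_fun_neg[OF \<psi>(1), of x] that Y by (cases "x < 0") auto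
    have eb: "\<bar>e x\<bar> \<le> t powr (3/2) * C + G * (Y + C\<psi>)" if "x \<le> X + d" for x
    proof -
      have "\<bar>e x\<bar> \<le> t powr (3/2) * \<bar>S t f x\<bar> + G * \<bar>\<psi> x\<bar>"
        unfolding e_def G_def using W_coeff_pos by (intro order_trans[OF abs_triangle_ineq4]) (simp add: abs_mult)
      also have "\<dots> \<le> t powr (3/2) * C + G * (Y + C\<psi>)"
        using that \<psi>abs[of x] by (intro add_mono mult_left_mono Sb G) (auto simp: Y_def)
      finally show ?thesis .
    qed
    have Ke: "K e x = t powr (3/2) * K (S t f) x - M * W_coeff * \<psi> x" if "x \<ge> 0" for x
    proof -
      have "(LINT y|lborel. J (x - y) * e y) = (LINT y|lborel. t powr (3/2) * (J (x - y) * S t f y) - M * W_coeff * (J (x - y) * \<psi> y))"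
        by (simp add: e_def algebra_simps)
      also have "\<dots> = t powr (3/2) * (LINT y|lborel. J (x - y) * S t f y) - M * W_coeff * (LINT y|lborel. J (x - y) * \<psi> y)"
        using J_reflect_mult_int[OF _ Sb, where x = x] J_stationary_int[OF that] by simp
      also have "(LINT y|lborel. J (x - y) * \<psi> y) = \<psi> x" using \<psi>(2)[of x] that by (simp add: K_def)
      finally show ?thesis using that by (simp add: K_def)
    qed
    have Kneg: "K (\<lambda>x. - e x) x = - K e x" for x by (simp add: K_def)
    have sub: "AE x in lborel. 0 \<le> x \<and> x \<le> X \<longrightarrow> \<bar>e x - K e x\<bar> \<le> \<delta>"
      using elim(2)
    proof eventually_elim
      case (elim x)
      have "\<bar>e x - K e x\<bar> = t powr (3/2) * \<bar>K (S t f) x - S t f x\<bar>" if "0 \<le> x"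
      proof -
        have "e x - K e x = t powr (3/2) * (S t f x - K (S t f) x)"
          unfolding Ke[OF that] e_def by (simp add: right_diff_distrib)
        then show ?thesis by (simp add: abs_mult abs_minus_commute)
      qed
      then show ?case using elim by simp
    qed
    have bdry: "AE x in lborel. X < x \<and> x \<le> X + d \<longrightarrow> \<bar>e x\<bar> \<le> 3 * h * (x + 1)"
      using elim(1)
    proof eventually_elim
      case (elim x)
      show ?case
      proof (intro impI, elim conjE)
        assume x: "X < x" "x \<le> X + d"
        have x0: "x \<ge> 0" "x \<le> Y" using x X by (auto simp: Y_def)
        \<comment> \<open>On the collar: far-field error, Gaussian defect, and difference between x
          and \<open>\<psi> x\<close>, each at most h (x + 1).\<close>
        have "e x = t powr (3/2) * (S t f x - M * W x t) - M * W_coeff * x * (1 - E x) + M * W_coeff * (x - \<psi> x)"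
          using WE[of x] by (simp add: e_def algebra_simps)
        then have "\<bar>e x\<bar> \<le> t powr (3/2) * \<bar>S t f x - M * W x t\<bar> + \<bar>M * W_coeff * x * (1 - E x)\<bar> + \<bar>M * W_coeff * (x - \<psi> x)\<bar>"
          using abs_mult[of "t powr (3/2)" "S t f x - M * W x t"] by simp
        moreover have "\<bar>M * W_coeff * x * (1 - E x)\<bar> \<le> h * (x + 1)"
        proof -
          have "\<bar>M * W_coeff * x * (1 - E x)\<bar> = G * x * (1 - E x)" using x0 W_coeff_pos E01 by (simp add: abs_mult G_def)
          also have "\<dots> \<le> G * (Y + C\<psi>) * (1 - E x)" using x0 G C\<psi> E01 by (intro mult_right_mono mult_left_mono) auto
          also have "\<dots> \<le> h" by (rule defect[OF x0])
          also have "\<dots> \<le> h * (x + 1)" using x0 h by simp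
          finally show ?thesis .
        qed
        moreover have "\<bar>M * W_coeff * (x - \<psi> x)\<bar> \<le> h * (x + 1)"
        proof -
          have "\<bar>M * W_coeff * (x - \<psi> x)\<bar> = G * \<bar>\<psi> x - x\<bar>"
            using W_coeff_pos by (simp add: abs_mult G_def abs_minus_commute)
          also have "\<dots> \<le> G * C\<psi>" by (intro mult_left_mono C\<psi> x0 G)
          also have "\<dots> \<le> h * (x + 1)" using GX x by simp
          finally show ?thesis .
        qed
        ultimately show "\<bar>e x\<bar> \<le> 3 * h * (x + 1)" using elim x by simp
      qed
    qed
    have h3: "3 * h > 0" using h by simp
    have sub1: "AE x in lborel. 0 \<le> x \<and> x \<le> X \<longrightarrow> e x \<le> K e x + \<delta>"
      using sub by eventually_elim (auto simp: abs_le_iff)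
    have sub2: "AE x in lborel. 0 \<le> x \<and> x \<le> X \<longrightarrow> - e x \<le> K (\<lambda>x. - e x) x + \<delta>"
      using sub by eventually_elim (auto simp: abs_le_iff Kneg)
    have bdry1: "AE x in lborel. X < x \<and> x \<le> X + d \<longrightarrow> e x \<le> 3 * h * (x + 1)"
      using bdry by eventually_elim (auto simp: abs_le_iff)
    have bdry2: "AE x in lborel. X < x \<and> x \<le> X + d \<longrightarrow> - e x \<le> 3 * h * (x + 1)"
      using bdry by eventually_elim (auto simp: abs_le_iff)
    have eb': "\<bar>- e x\<bar> \<le> t powr (3/2) * C + G * (Y + C\<psi>)" if "x \<le> X + d" for x using eb[OF that] by simp
    have mp1: "AE x in lborel. 0 \<le> x \<and> x \<le> X \<longrightarrow> e x \<le> 3 * h * (x + d + 1) + \<delta> / q * ((X + d)\<^sup>2 - x\<^sup>2)"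
      by (rule maximum_principle[OF ehl(1) eb X(2) h3 del(1) sub1 bdry1])
    have mp2: "AE x in lborel. 0 \<le> x \<and> x \<le> X \<longrightarrow> - e x \<le> 3 * h * (x + d + 1) + \<delta> / q * ((X + d)\<^sup>2 - x\<^sup>2)"
      by (rule maximum_principle[OF ehl(2) eb' X(2) h3 del(1) sub2 bdry2])
    show ?case
      using mp1 mp2 elim(1)
    proof eventually_elim
      case (elim x)
      show ?case
      proof
        assume x: "0 < x"
        have rep: "t powr (3/2) * (\<psi> x / x * W x t) = W_coeff * \<psi> x * E x"
          using WE[of x] x by (simp add: field_simps)
        show "t powr (3/2) * \<bar>S t f x - M * (\<psi> x / x * W x t)\<bar> \<le> \<epsilon> * (x + 1)"
        proof (cases "x \<le> X")
          case True
          then have xY: "x \<le> Y" using d_pos by (simp add: Y_def)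
          have "\<delta> / q * ((X + d)\<^sup>2 - x\<^sup>2) \<le> \<delta> / q * Y\<^sup>2"
            using del q_pos by (intro mult_left_mono) (auto simp: Y_def)
          then have "\<delta> / q * ((X + d)\<^sup>2 - x\<^sup>2) \<le> h" using del by simp
          then have "\<bar>e x\<bar> \<le> 3 * h * (x + d + 1) + h" using elim x True by linarith
          \<comment> \<open>The claimed profile carries the factor \<open>E x\<close>, the
            stationary one does not; the Gaussian defect is their difference.\<close>
          moreover have "t powr (3/2) * (S t f x - M * (\<psi> x / x * W x t)) = e x + M * W_coeff * \<psi> x * (1 - E x)"
          proof -
            have "t powr (3/2) * (S t f x - M * (\<psi> x / x * W x t))
              = t powr (3/2) * S t f x - M * (t powr (3/2) * (\<psi> x / x * W x t))" by (simp add: right_diff_distrib)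
            then show ?thesis unfolding rep by (simp add: e_def algebra_simps)
          qed
          moreover have "\<bar>M * W_coeff * \<psi> x * (1 - E x)\<bar> \<le> h"
          proof -
            have "\<bar>M * W_coeff * \<psi> x * (1 - E x)\<bar> = G * \<bar>\<psi> x\<bar> * (1 - E x)" using W_coeff_pos E01 by (simp add: abs_mult G_def)
            also have "\<dots> \<le> G * (Y + C\<psi>) * (1 - E x)" using \<psi>abs[OF xY] G E01 by (intro mult_right_mono mult_left_mono) auto
            also have "\<dots> \<le> h" using x by (intro defect xY) simp
            finally show ?thesis .
          qed
          ultimately have "\<bar>t powr (3/2) * (S t f x - M * (\<psi> x / x * W x t))\<bar> \<le> 3 * h * (x + d + 1) + 2 * h"
            by linarith
          also have "\<dots> \<le> (5 + 3 * d) * h * (x + 1)" using x h d_pos by (simp add: algebra_simps)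
          also have "\<dots> \<le> \<epsilon> * (x + 1)" using heps x by (intro mult_right_mono) auto
          finally show ?thesis by (simp add: abs_mult)
        next
          case False
          then have xX: "x \<ge> X" by simp
          have "t powr (3/2) * (S t f x - M * (\<psi> x / x * W x t))
              = t powr (3/2) * (S t f x - M * W x t) + M * (t powr (3/2) * W x t - t powr (3/2) * (\<psi> x / x * W x t))"
            by (simp add: algebra_simps)
          also have "t powr (3/2) * W x t - t powr (3/2) * (\<psi> x / x * W x t) = W_coeff * (x - \<psi> x) * E x"
            unfolding rep WE by (simp add: algebra_simps)
          finally have eq: "t powr (3/2) * (S t f x - M * (\<psi> x / x * W x t))
              = t powr (3/2) * (S t f x - M * W x t) + M * (W_coeff * (x - \<psi> x) * E x)" .
          have "\<bar>M * (W_coeff * (x - \<psi> x) * E x)\<bar> = G * \<bar>\<psi> x - x\<bar> * E x"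
            using W_coeff_pos E01 by (simp add: abs_mult G_def abs_minus_commute)
          also have "\<dots> \<le> G * C\<psi> * 1"
            using C\<psi>(2)[of x] x G C\<psi>(1) E01 by (intro mult_mono mult_left_mono) auto
          also have "\<dots> \<le> h * (x + 1)" using GX[OF xX] by simp
          finally have b: "\<bar>M * (W_coeff * (x - \<psi> x) * E x)\<bar> \<le> h * (x + 1)" .
          have "t powr (3/2) * \<bar>S t f x - M * (\<psi> x / x * W x t)\<bar> = \<bar>t powr (3/2) * (S t f x - M * (\<psi> x / x * W x t))\<bar>"
            by (simp add: abs_mult)
          also have "\<dots> \<le> t powr (3/2) * \<bar>S t f x - M * W x t\<bar> + \<bar>M * (W_coeff * (x - \<psi> x) * E x)\<bar>"
            unfolding eq by (rule order_trans[OF abs_triangle_ineq]) (simp add: abs_mult)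
          also have "\<dots> \<le> 2 * h * (x + 1)" using elim xX b by simp
          also have "\<dots> \<le> \<epsilon> * (x + 1)" using heps x by (intro mult_right_mono) auto
          finally show ?thesis .
        qed
      qed
    qed
  qed
qed

end

section \<open>Identification of the dipole and application to the given solution\<close>

lemma diffusivity_eq: "diffusivity J = q"
  by (simp add: diffusivity_def q_def integral_completion)

lemma dipole_eq_W:
  assumes t: "t > 0" shows "2 * dipole x (q * t) = - W x t"
proof -
  define s where "s = q * t"
  have s: "s > 0" using t q_pos by (simp add: s_def)
  have "((\<lambda>y. heat_kernel y s) has_real_derivative
      (4 * pi * s) powr (- (1 / 2)) * (exp (- (x\<^sup>2 / (4 * s))) * (- (2 * x / (4 * s))))) (at x)"
    unfolding heat_kernel_def using s by (auto intro!: derivative_eq_intros simp: power2_eq_square)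
  then have d: "dipole x s = (4 * pi * s) powr (- (1 / 2)) * (exp (- (x\<^sup>2 / (4 * s))) * (- (2 * x / (4 * s))))"
    unfolding dipole_def by (rule DERIV_imp_deriv)
  have k: "(4 * pi * s) powr (- (1 / 2)) = sqrt (pi / s) / (2 * pi)"
  proof -
    have "(4 * pi * s) powr (- (1 / 2)) = inverse (sqrt (4 * pi * s))"
      using s by (simp add: powr_minus powr_half_sqrt)
    also have "\<dots> = sqrt (pi / s) / (2 * pi)"
      using s by (simp add: real_sqrt_mult real_sqrt_divide field_simps)
    finally show ?thesis .
  qed
  show ?thesis
    unfolding W_eq[OF t] s_def[symmetric] d k using s by (simp add: field_simps)
qed

lemma twice_dipole_profile:
  assumes "t > 0" "x > 0" shows "2 * m * dipole_profile (diffusivity J) \<phi> x t = - (m * (\<phi> x / x * W x t))"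
proof -
  have "2 * m * dipole_profile (diffusivity J) \<phi> x t = m * (\<phi> x / x) * (2 * dipole x (q * t))"
    using assms by (simp add: dipole_profile_def diffusivity_eq)
  then show ?thesis unfolding dipole_eq_W[OF assms(1)] by simp
qed

text \<open>Uniqueness identifies the given solution with the series twice, once started at 0 and
  once restarted at \<open>\<tau>\<close>; comparing the two gives the semigroup law that
  \<open>semigroup_asymptotics\<close> requires.\<close>

lemma solution_asymptotics:
  assumes u0: "in_weighted_L1 (\<lambda>x. 1 + x + x\<^sup>2) {0<..} u0" "in_Linf {0<..} u0"
    and sol: "half_line_solution J u0 u" and st: "stationary_solution d J \<phi>" and eps: "\<epsilon> > 0"
  shows "\<forall>\<^sub>F t in at_top. AE x in lborel. 0 < x \<longrightarrow>
    t powr (3/2) * \<bar>u x t - modified_moment u0 \<phi> * (\<phi> x / x * W x t)\<bar> \<le> \<epsilon> * (x + 1)"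
proof -
  obtain v where v: "curve v" "\<And>t. t \<ge> 0 \<Longrightarrow> AE x in lborel. x > 0 \<longrightarrow> v t x = u x t"
    by (rule solution_curve[OF sol], rule that)
  obtain g where g: "g \<in> borel_measurable borel" "\<And>x. x \<le> 0 \<Longrightarrow> g x = 0"
    "integrable lborel (\<lambda>x. (1 + x + x\<^sup>2) * g x)" "AE x in lborel. x > 0 \<longrightarrow> g x = u0 x"
    by (rule weighted_L1_representative[OF u0(1)]) (auto intro!: add_pos_nonneg)
  obtain C where C: "AE x in lborel. x > 0 \<longrightarrow> \<bar>u0 x\<bar> \<le> C"
    using u0(2) by (auto simp: in_Linf_def AE_completion_iff)
  \<comment> \<open>Cutting at the essential bound changes \<open>g\<close> on a null set only and
    makes the datum bounded at every point.\<close>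
  define f where "f x = (if \<bar>g x\<bar> \<le> \<bar>C\<bar> then g x else 0)" for x
  note [measurable] = g(1)
  have fm: "f \<in> borel_measurable borel" unfolding f_def by measurable
  have fb: "\<bar>f x\<bar> \<le> \<bar>C\<bar>" for x by (simp add: f_def)
  have fhl: "half_line_fun f" using fm g(2) by (auto simp: half_line_fun_def f_def)
  have "integrable lborel (\<lambda>y. (1 + y\<^sup>2) * f y)"
  proof (rule Bochner_Integration.integrable_bound[OF g(3)])
    show "AE x in lborel. norm ((1 + x\<^sup>2) * f x) \<le> norm ((1 + x + x\<^sup>2) * g x)"
    proof (rule AE_I2)
      fix x show "norm ((1 + x\<^sup>2) * f x) \<le> norm ((1 + x + x\<^sup>2) * g x)"
      proof (cases "x \<le> 0")
        case False
        have "\<bar>f x\<bar> \<le> \<bar>g x\<bar>" by (simp add: f_def)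
        then have "(1 + x\<^sup>2) * \<bar>f x\<bar> \<le> (1 + x + x\<^sup>2) * \<bar>g x\<bar>"
          using False by (intro mult_mono) auto
        then show ?thesis using False by (simp add: abs_mult)
      qed (simp add: f_def g(2))
    qed
  qed (use fm in measurable)
  then have f: "admissible f" using fhl fb by (auto simp: admissible_def)
  have fu: "AE x in lborel. x > 0 \<longrightarrow> f x = u0 x"
    using g(4) C by eventually_elim (auto simp: f_def)
  have init: "AE x in lborel. v 0 x = f x"
  proof -
    have v0: "half_line_fun (v 0)" using v(1) by (simp add: curve_def)
    have "AE x in lborel. u x 0 = u0 x" using sol by (simp add: half_line_solution_def AE_completion_iff)
    then show ?thesis
      using v(2)[OF order_refl] fu AE_lborel_singleton[of "0::real"]
    proof eventually_elim
      case (elim x)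
      then show ?case using half_line_fun_neg[OF fhl, of x] half_line_fun_neg[OF v0, of x]
        by (cases "x > 0"; cases "x < 0") auto
    qed
  qed
  have vS: "AE x in lborel. v t x = S t f x" if "t \<ge> 0" for t
    using curve_unique[OF v(1) order_refl that fhl fb admissible_linear_int(3)[OF f] init] by simp
  have sg: "AE x in lborel. S t f x = S (t - \<tau>) (S \<tau> f) x" if \<tau>: "0 \<le> \<tau>" "\<tau> \<le> t" for \<tau> t
  proof -
    note a = admissible_S[OF f \<tau>(1)]
    have "AE x in lborel. v t x = S (t - \<tau>) (S \<tau> f) x"
      by (rule curve_unique[OF v(1) \<tau> admissible_half_line[OF a] S_bdd[OF fhl fb \<tau>(1)] admissible_linear_int(3)[OF a] vS[OF \<tau>(1)]])
    then show ?thesis using vS[of t] \<tau> by (auto elim: eventually_elim2)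
  qed
  obtain \<psi> C\<psi> where \<psi>: "half_line_fun \<psi>" "\<And>x. x \<ge> 0 \<Longrightarrow> \<psi> x = \<phi> x" "\<And>x. K \<psi> x = \<psi> x"
    "C\<psi> \<ge> 0" "\<And>x. x \<ge> 0 \<Longrightarrow> \<bar>\<psi> x - x\<bar> \<le> C\<psi>"
    by (rule stationary_representative[OF st], rule that)
  have mm: "modified_moment u0 \<phi> = moment_wrt \<psi> f"
    unfolding modified_moment_def set_lebesgue_integral_def moment_wrt_def
  proof (rule lebesgue_integral_AE_lborel)
    show "(\<lambda>x. \<psi> x * f x) \<in> borel_measurable borel" using fm half_line_fun_meas[OF \<psi>(1)] by measurable
    show "AE x in lborel. indicator {0<..} x *\<^sub>R (u0 x * \<phi> x) = \<psi> x * f x"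
      using fu AE_lborel_singleton[of "0::real"]
    proof eventually_elim
      case (elim x)
      then show ?case using half_line_fun_neg[OF fhl, of x] \<psi>(2)[of x]
        by (cases "x > 0"; cases "x < 0") auto
    qed
  qed
  have "\<forall>\<^sub>F t in at_top. AE x in lborel. 0 < x \<longrightarrow>
      t powr (3/2) * \<bar>S t f x - moment_wrt \<psi> f * (\<psi> x / x * W x t)\<bar> \<le> \<epsilon> * (x + 1)"
    by (rule semigroup_asymptotics[OF f sg \<psi>(1,3,4,5) eps])
  then show ?thesis
    using eventually_ge_at_top[of 0]
  proof eventually_elim
    case (elim t)
    from elim(1) vS[OF elim(2)] v(2)[OF elim(2)] show ?case
    proof eventually_elim
      case (elim x)
      then show ?case using \<psi>(2)[of x] by (simp add: mm)
    qed
  qed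
qed

end

theorem theorem1p2:
  fixes J u0 \<phi> :: "real \<Rightarrow> real" and u :: "real \<Rightarrow> real \<Rightarrow> real" and d :: real
  assumes "dispersal_kernel d J"
    and "in_weighted_L1 (\<lambda>x. 1 + x + x\<^sup>2) {0<..} u0"
    and "in_Linf {0<..} u0"
    and "\<forall>x<0. u0 x = 0"
    and "half_line_solution J u0 u"
    and "stationary_solution d J \<phi>"
  shows "\<forall>\<epsilon>>0. \<forall>\<^sub>F t in at_top. AE x in lebesgue. x \<ge> 0 \<longrightarrow>
    t powr (3 / 2) / (x + 1) *
      \<bar>u x t + 2 * modified_moment u0 \<phi> * dipole_profile (diffusivity J) \<phi> x t\<bar> < \<epsilon>"
proof (intro allI impI)
  fix \<epsilon> :: real assume eps: "\<epsilon> > 0"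
  interpret kernel J d by unfold_locales (rule assms(1))
  \<comment> \<open>Half of \<epsilon> leaves room for the strict inequality.\<close>
  have "\<epsilon> / 2 > 0" using eps by simp
  from solution_asymptotics[OF assms(2,3,5,6) this] eventually_gt_at_top[of 0]
  show "\<forall>\<^sub>F t in at_top. AE x in lebesgue. x \<ge> 0 \<longrightarrow>
    t powr (3 / 2) / (x + 1) *
      \<bar>u x t + 2 * modified_moment u0 \<phi> * dipole_profile (diffusivity J) \<phi> x t\<bar> < \<epsilon>"
  proof eventually_elim
    case (elim t)
    note t = elim(2)
    \<comment> \<open>The asymptotics are available for x > 0; the boundary point is a null
      set.\<close>
    from elim(1) AE_lborel_singleton[of "0::real"] show ?case
      unfolding AE_completion_iff
    proof eventually_elim
      case (elim x)
      show ?case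
      proof
        assume "x \<ge> 0"
        then have x: "x > 0" using elim(2) by simp
        have "t powr (3/2) * \<bar>u x t + 2 * modified_moment u0 \<phi> * dipole_profile (diffusivity J) \<phi> x t\<bar> \<le> \<epsilon> / 2 * (x + 1)"
          using elim(1) x unfolding twice_dipole_profile[OF t x] by simp
        also have "\<dots> < \<epsilon> * (x + 1)" using eps x by simp
        finally show "t powr (3 / 2) / (x + 1) *
          \<bar>u x t + 2 * modified_moment u0 \<phi> * dipole_profile (diffusivity J) \<phi> x t\<bar> < \<epsilon>"
          using x by (simp add: pos_divide_less_eq)
      qed
    qed
  qed
qed

end
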